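(* Let $\|\cdot\|_\ell$ be a symmetric norm on $\mathbb{R}^n$ and let $S\in\mathbb{R}^{O(d)\times n}$ be a SymSketch. For a given matrix $A\in\mathbb{R}^{n\times d}$, with probability at least $0.9$, for all $x\in\mathbb{R}^d$, $\Omega\big(1/(\sqrt{d}\log^3n)\big)\cdot\|Ax\|_\ell\le\|SAx\|_2\le O\big(\mathrm{mmc}(\ell)\cdot d^2\log^{5/2}n\big)\cdot\|Ax\|_\ell$. Furthermore, $SA$ can be computed in $\widetilde{O}(\mathrm{nnz}(A)+\mathrm{poly}(d))$ time.
   Context: SymSketch: let $t=\Theta(\log n)$. For $i\in\{0,\dots,t\}$ let $D_i=\mathrm{diag}(z_{i,1},\dots,z_{i,n})$ with independent $z_{i,j}\sim\mathrm{Bernoulli}(1/2^i)$, and $w_i=\|(1,\dots,1,0,\dots,0)\|_\ell$ (with $2^i$ ones). Let $\widetilde{D}\in\mathbb{R}^{n(t+1)\times n}$ be the vertical stacking of $w_0D_0,w_1D_1,\dots,w_tD_t$. Let $\Pi=S_G\Pi_C\in\mathbb{R}^{O(d)\times n(t+1)}$ where $\Pi_C\in\mathbb{R}^{m\times n(t+1)}$, $m=\Theta(d^2/\varepsilon^2)$, is a CountSketch matrix ($\Pi_C=\Phi D$ with $D$ a random $\pm1$ diagonal matrix and $\Phi_{h(j),j}=1$, other entries $0$, for a uniformly random map $h$ into $[m]$) and $S_G=\frac{1}{\sqrt{m'}}G'\in\mathbb{R}^{m'\times m}$, $m'=\Theta(d/\varepsilon^2)$, with $G'$ having i.i.d. standard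 Gaussian entries, with $\varepsilon=0.1$. Then $S=\Pi\widetilde{D}$. A symmetric norm is invariant under coordinate permutations and sign flips. $\mathrm{mmc}(\ell)=\max_{k\in[n]}\max_{x\in\mathbb{S}^{k-1}}\|(x,0,\dots,0)\|_\ell/M_{\ell^{(k)}}$, where $M_{\ell^{(k)}}$ is the median of $\|(x,0,\dots,0)\|_\ell$ for $x$ uniform on $\mathbb{S}^{k-1}$. *)

theory Defs
  imports "HOL-Probability.Probability" "Jordan_Normal_Form.Matrix"
begin

hide_const (open) Finite_Cartesian_Product.vec Finite_Cartesian_Product.mat
  Finite_Cartesian_Product.row Finite_Cartesian_Product.column
hide_type (open) Finite_Cartesian_Product.vec
unbundle no vec_syntax and no inner_syntax

section \<open>Symmetric norms and their maximum modulus of concentration\<close>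

definition symmetric_norm :: "nat \<Rightarrow> (real vec \<Rightarrow> real) \<Rightarrow> bool" where
  "symmetric_norm n l \<longleftrightarrow>
     (\<forall>x\<in>carrier_vec n. 0 \<le> l x \<and> (l x = 0 \<longleftrightarrow> x = 0\<^sub>v n)) \<and>
     (\<forall>x\<in>carrier_vec n. \<forall>c. l (c \<cdot>\<^sub>v x) = \<bar>c\<bar> * l x) \<and>
     (\<forall>x\<in>carrier_vec n. \<forall>y\<in>carrier_vec n. l (x + y) \<le> l x + l y) \<and>
     (\<forall>x\<in>carrier_vec n. \<forall>p. p permutes {..<n} \<longrightarrow> l (vec n (\<lambda>i. x $ p i)) = l x) \<and>
     (\<forall>x\<in>carrier_vec n. \<forall>s. (\<forall>i<n. s i \<in> {-1, 1}) \<longrightarrow> l (vec n (\<lambda>i. s i * x $ i)) = l x)"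

definition l2_norm :: "real vec \<Rightarrow> real" where
  "l2_norm v = sqrt (v \<bullet> v)"

definition unit_sphere :: "nat \<Rightarrow> (nat \<Rightarrow> real) set" where
  "unit_sphere k = {x \<in> {..<k} \<rightarrow>\<^sub>E UNIV. (\<Sum>i<k. (x i)\<^sup>2) = 1}"

text \<open>The uniform distribution on the unit sphere of dimension \<open>k - 1\<close>, as the normalised cone
  measure: the direction of a uniformly distributed point of the closed unit ball. (The origin,
  where the direction is undefined, is a null set.)\<close>

definition sphere_uniform :: "nat \<Rightarrow> (nat \<Rightarrow> real) measure" where
  "sphere_uniform k =
     distr (uniform_measure (Pi\<^sub>M {..<k} (\<lambda>_. lborel))
              {x \<in> {..<k} \<rightarrow>\<^sub>E UNIV. (\<Sum>i<k. (x i)\<^sup>2) \<le> 1})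
       (Pi\<^sub>M {..<k} (\<lambda>_. borel))
       (\<lambda>x. \<lambda>i\<in>{..<k}. x i / sqrt (\<Sum>j<k. (x j)\<^sup>2))"

definition is_median :: "'a measure \<Rightarrow> ('a \<Rightarrow> real) \<Rightarrow> real \<Rightarrow> bool" where
  "is_median M X c \<longleftrightarrow>
     measure M {\<omega> \<in> space M. X \<omega> \<le> c} \<ge> 1 / 2 \<and> measure M {\<omega> \<in> space M. X \<omega> \<ge> c} \<ge> 1 / 2"

definition pad_vec :: "nat \<Rightarrow> nat \<Rightarrow> (nat \<Rightarrow> real) \<Rightarrow> real vec" where
  "pad_vec n k x = vec n (\<lambda>i. if i < k then x i else 0)"

definition sphere_median :: "nat \<Rightarrow> (real vec \<Rightarrow> real) \<Rightarrow> nat \<Rightarrow> real" where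
  "sphere_median n l k = (SOME c. is_median (sphere_uniform k) (\<lambda>x. l (pad_vec n k x)) c)"

definition mmc :: "nat \<Rightarrow> (real vec \<Rightarrow> real) \<Rightarrow> real" where
  "mmc n l = (MAX k\<in>{1..n}. SUP x\<in>unit_sphere k. l (pad_vec n k x) / sphere_median n l k)"

section \<open>The sketch\<close>

text \<open>For \<open>2 ^ i > n\<close> this is the norm of the all-ones vector.\<close>

definition level_weight :: "nat \<Rightarrow> (real vec \<Rightarrow> real) \<Rightarrow> nat \<Rightarrow> real" where
  "level_weight n l i = l (pad_vec n (2 ^ i) (\<lambda>_. 1))"

text \<open>The randomness \<open>((z, h, s), g)\<close>: the sampling variables, the hash map and the signs of the
  CountSketch matrix, and the entries of the unnormalised Gaussian matrix.\<close>

type_synonym seed =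
  "((nat \<times> nat \<Rightarrow> bool) \<times> (nat \<Rightarrow> nat) \<times> (nat \<Rightarrow> real)) \<times> (nat \<times> nat \<Rightarrow> real)"

definition seed_measure :: "nat \<Rightarrow> nat \<Rightarrow> nat \<Rightarrow> nat \<Rightarrow> seed measure" where
  "seed_measure n t m m' =
     measure_pmf
       (pair_pmf (Pi_pmf ({..t} \<times> {..<n}) False (\<lambda>(i, j). bernoulli_pmf (1 / 2 ^ i)))
         (pair_pmf (pmf_of_set ({..<n * (t + 1)} \<rightarrow>\<^sub>E {..<m}))
           (Pi_pmf {..<n * (t + 1)} 1 (\<lambda>_. pmf_of_set {-1, 1}))))
     \<Otimes>\<^sub>M Pi\<^sub>M ({..<m'} \<times> {..<m}) (\<lambda>_. density lborel (\<lambda>x. ennreal (std_normal_density x)))"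

definition sampling_mat :: "nat \<Rightarrow> (nat \<times> nat \<Rightarrow> bool) \<Rightarrow> nat \<Rightarrow> real mat" where
  "sampling_mat n z i = mat_diag n (\<lambda>j. of_bool (z (i, j)))"

text \<open>Vertical stacking: row \<open>i * n + j\<close> is row \<open>j\<close> of the \<open>i\<close>-th weighted block.\<close>

definition stacked_mat ::
    "nat \<Rightarrow> nat \<Rightarrow> (real vec \<Rightarrow> real) \<Rightarrow> (nat \<times> nat \<Rightarrow> bool) \<Rightarrow> real mat" where
  "stacked_mat n t l z =
     mat (n * (t + 1)) n
       (\<lambda>(r, c). (level_weight n l (r div n) \<cdot>\<^sub>m sampling_mat n z (r div n)) $$ (r mod n, c))"

definition count_sketch :: "nat \<Rightarrow> nat \<Rightarrow> (nat \<Rightarrow> nat) \<Rightarrow> (nat \<Rightarrow> real) \<Rightarrow> real mat" where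
  "count_sketch m N h s = mat m N (\<lambda>(i, j). if i = h j then 1 else 0) * mat_diag N s"

definition gauss_sketch :: "nat \<Rightarrow> nat \<Rightarrow> (nat \<times> nat \<Rightarrow> real) \<Rightarrow> real mat" where
  "gauss_sketch m' m g = (1 / sqrt (real m')) \<cdot>\<^sub>m mat m' m g"

definition sym_sketch ::
    "nat \<Rightarrow> nat \<Rightarrow> nat \<Rightarrow> nat \<Rightarrow> (real vec \<Rightarrow> real) \<Rightarrow> seed \<Rightarrow> real mat" where
  "sym_sketch n t m m' l = (\<lambda>((z, h, s), g).
     (gauss_sketch m' m g * count_sketch m (n * (t + 1)) h s) * stacked_mat n t l z)"

section \<open>A real random access machine\<close>

text \<open>Running times are measured on a real RAM, presented as a small structured language. A state
  holds named arrays of natural numbers and named arrays of reals, each addressed by a pair of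
  indices. Reals support exact arithmetic and comparison, but cannot be rounded to integers.
  Integers have addition and truncated subtraction only, so that large integers cannot
  be used to simulate unbounded parallelism. Every assignment and every evaluated test costs one
  unit; the expressions occurring in a fixed program have bounded size, so this agrees up to a
  constant factor with counting the elementary operations.\<close>

datatype nexp =
    NConst nat
  | NLoad string nexp nexp
  | NAdd nexp nexp
  | NSub nexp nexp

datatype rexp =
    RConst rat
  | RLoad string nexp nexp
  | RAdd rexp rexp
  | RSub rexp rexp
  | RMul rexp rexp
  | RDiv rexp rexp

datatype bexp =
    NLess nexp nexp
  | RLess rexp rexp
  | Neg bexp
  | Conj bexp bexp

datatype com =
    Skip
  | NStore string nexp nexp nexp
  | RStore string nexp nexp rexp
  | Seq com com
  | Cond bexp com com
  | While bexp com

type_synonym nmem = "string \<Rightarrow> nat \<Rightarrow> nat \<Rightarrow> nat"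
type_synonym rmem = "string \<Rightarrow> nat \<Rightarrow> nat \<Rightarrow> real"
type_synonym state = "nmem \<times> rmem"

definition store :: "(string \<Rightarrow> nat \<Rightarrow> nat \<Rightarrow> 'a) \<Rightarrow> string \<Rightarrow> nat \<Rightarrow> nat \<Rightarrow> 'a \<Rightarrow> (string \<Rightarrow> nat \<Rightarrow> nat \<Rightarrow> 'a)"
  where "store \<mu> x i j v = \<mu>(x := (\<mu> x)(i := (\<mu> x i)(j := v)))"

primrec nval :: "nexp \<Rightarrow> nmem \<Rightarrow> nat" where
  "nval (NConst k) \<mu> = k"
| "nval (NLoad x a b) \<mu> = \<mu> x (nval a \<mu>) (nval b \<mu>)"
| "nval (NAdd a b) \<mu> = nval a \<mu> + nval b \<mu>"
| "nval (NSub a b) \<mu> = nval a \<mu> - nval b \<mu>"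

primrec rval :: "rexp \<Rightarrow> state \<Rightarrow> real" where
  "rval (RConst q) \<sigma> = of_rat q"
| "rval (RLoad x a b) \<sigma> = snd \<sigma> x (nval a (fst \<sigma>)) (nval b (fst \<sigma>))"
| "rval (RAdd a b) \<sigma> = rval a \<sigma> + rval b \<sigma>"
| "rval (RSub a b) \<sigma> = rval a \<sigma> - rval b \<sigma>"
| "rval (RMul a b) \<sigma> = rval a \<sigma> * rval b \<sigma>"
| "rval (RDiv a b) \<sigma> = rval a \<sigma> / rval b \<sigma>"

primrec bval :: "bexp \<Rightarrow> state \<Rightarrow> bool" where
  "bval (NLess a b) \<sigma> \<longleftrightarrow> nval a (fst \<sigma>) < nval b (fst \<sigma>)"
| "bval (RLess a b) \<sigma> \<longleftrightarrow> rval a \<sigma> < rval b \<sigma>"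
| "bval (Neg a) \<sigma> \<longleftrightarrow> \<not> bval a \<sigma>"
| "bval (Conj a b) \<sigma> \<longleftrightarrow> bval a \<sigma> \<and> bval b \<sigma>"

text \<open>\<open>exec c \<sigma> k \<sigma>'\<close>: started in \<open>\<sigma>\<close>, the program \<open>c\<close> terminates in \<open>\<sigma>'\<close> at cost \<open>k\<close>.\<close>

inductive exec :: "com \<Rightarrow> state \<Rightarrow> nat \<Rightarrow> state \<Rightarrow> bool" where
  exec_Skip: "exec Skip \<sigma> 0 \<sigma>"
| exec_NStore: "exec (NStore x a b e) \<sigma> 1
    (store (fst \<sigma>) x (nval a (fst \<sigma>)) (nval b (fst \<sigma>)) (nval e (fst \<sigma>)), snd \<sigma>)"
| exec_RStore: "exec (RStore x a b e) \<sigma> 1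
    (fst \<sigma>, store (snd \<sigma>) x (nval a (fst \<sigma>)) (nval b (fst \<sigma>)) (rval e \<sigma>))"
| exec_Seq: "exec c1 \<sigma> k1 \<sigma>' \<Longrightarrow> exec c2 \<sigma>' k2 \<sigma>'' \<Longrightarrow> exec (Seq c1 c2) \<sigma> (k1 + k2) \<sigma>''"
| exec_CondT: "bval b \<sigma> \<Longrightarrow> exec c1 \<sigma> k \<sigma>' \<Longrightarrow> exec (Cond b c1 c2) \<sigma> (1 + k) \<sigma>'"
| exec_CondF: "\<not> bval b \<sigma> \<Longrightarrow> exec c2 \<sigma> k \<sigma>' \<Longrightarrow> exec (Cond b c1 c2) \<sigma> (1 + k) \<sigma>'"
| exec_WhileF: "\<not> bval b \<sigma> \<Longrightarrow> exec (While b c) \<sigma> 1 \<sigma>"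
| exec_WhileT: "bval b \<sigma> \<Longrightarrow> exec c \<sigma> k1 \<sigma>' \<Longrightarrow> exec (While b c) \<sigma>' k2 \<sigma>'' \<Longrightarrow>
    exec (While b c) \<sigma> (1 + k1 + k2) \<sigma>''"

section \<open>Computing the product of the sketch with a sparse matrix\<close>

definition nonzeros :: "real mat \<Rightarrow> (nat \<times> nat) set" where
  "nonzeros A = {(i, j). i < dim_row A \<and> j < dim_col A \<and> A $$ (i, j) \<noteq> 0}"

definition nnz :: "real mat \<Rightarrow> nat" where
  "nnz A = card (nonzeros A)"

definition lists_nonzeros :: "real mat \<Rightarrow> (nat \<times> nat) list \<Rightarrow> bool" where
  "lists_nonzeros A es \<longleftrightarrow> distinct es \<and> set es = nonzeros A"

definition cell :: "'a :: zero \<Rightarrow> nat \<Rightarrow> nat \<Rightarrow> 'a" where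
  "cell v = (\<lambda>i j. if i = 0 \<and> j = 0 then v else 0)"

definition table1 :: "nat \<Rightarrow> (nat \<Rightarrow> 'a :: zero) \<Rightarrow> nat \<Rightarrow> nat \<Rightarrow> 'a" where
  "table1 p f = (\<lambda>i j. if i < p \<and> j = 0 then f i else 0)"

definition table2 :: "nat \<Rightarrow> nat \<Rightarrow> (nat \<times> nat \<Rightarrow> 'a :: zero) \<Rightarrow> nat \<Rightarrow> nat \<Rightarrow> 'a" where
  "table2 p q f = (\<lambda>i j. if i < p \<and> j < q then f (i, j) else 0)"

text \<open>The input consists of the dimensions, the matrix \<open>A\<close> in coordinate format (the list \<open>es\<close> of the
  positions of its nonzero entries and their values), and the sketch given through the data that
  define it: the weights, the sampling variables, the hash map, the signs and the (scaled) Gaussian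
  factor. All other memory cells are zero.\<close>

definition input_state ::
    "nat \<Rightarrow> nat \<Rightarrow> nat \<Rightarrow> nat \<Rightarrow> nat \<Rightarrow> (real vec \<Rightarrow> real) \<Rightarrow> seed \<Rightarrow> real mat \<Rightarrow> (nat \<times> nat) list \<Rightarrow> state"
  where
  "input_state n d t m m' l = (\<lambda>((z, h, s), g) A es.
     ((\<lambda>_ _ _. 0)
        (''n'' := cell n, ''d'' := cell d, ''t'' := cell t, ''m'' := cell m, ''m1'' := cell m',
         ''nnz'' := cell (length es),
         ''row'' := table1 (length es) (\<lambda>e. fst (es ! e)),
         ''col'' := table1 (length es) (\<lambda>e. snd (es ! e)),
         ''sample'' := table2 (t + 1) n (\<lambda>ij. of_bool (z ij)),
         ''hash'' := table1 (n * (t + 1)) h),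
      (\<lambda>_ _ _. 0)
        (''val'' := table1 (length es) (\<lambda>e. A $$ (es ! e)),
         ''weight'' := table1 (t + 1) (level_weight n l),
         ''sign'' := table1 (n * (t + 1)) s,
         ''gauss'' := table2 m' m (\<lambda>ij. gauss_sketch m' m g $$ ij))))"

definition outputs_mat :: "state \<Rightarrow> real mat \<Rightarrow> bool" where
  "outputs_mat \<sigma> B \<longleftrightarrow> (\<forall>i<dim_row B. \<forall>j<dim_col B. snd \<sigma> ''out'' i j = B $$ (i, j))"

end

theory Submission
  imports Defs "Jordan_Normal_Form.Determinant"
begin

hide_const (open) Determinants.det

text \<open>
  The Gaussian matrix and the CountSketch matrix are both subspace embeddings of the column space, with
  constant distortion: the former by a net argument, the latter because the Gram matrix of an orthonormal
  basis of the space is preserved up to a Frobenius error whose second moment is \<open>O(d\<^sup>2/m)\<close>. So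
  everything reduces to comparing the norm of \<open>y = Ax\<close> with the Euclidean norm of the stack of the
  sampled vectors \<open>w\<^sub>i D\<^sub>i y\<close>.

  Contraction: by dyadic bucketing some \<open>2\<^sup>k\<close> coordinates of \<open>y\<close> have size at least \<open>\<alpha>\<close>, where
  \<open>\<alpha> w\<^sub>k\<close> is the norm of \<open>y\<close> up to a factor \<open>O(log n)\<close>. Level \<open>k - p\<close> samples about \<open>2\<^sup>p\<close> of
  them with failure probability \<open>exp(-2\<^sup>p/4)\<close>, which for \<open>2\<^sup>p\<close> of order \<open>d log n\<close> beats the size of
  a polynomially fine net of the column space.

  Dilation: the Euclidean norm is bounded on an Auerbach basis, in which coordinates are at most twice the
  norm. For one basis vector, with high probability no coordinate of rank much smaller than \<open>2\<^sup>i\<close> is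
  sampled at level \<open>i\<close>, and the expectation of the rest is controlled because the norm of a flat vector
  with \<open>s\<close> ones grows like \<open>sqrt s\<close> up to mmc and logarithmic factors: the median of a symmetric norm
  on the sphere is at most \<open>O(sqrt (log k / k))\<close> times the norm of the all-ones vector.
\<close>

section \<open>Symmetric norms\<close>

text \<open>The two directions need different union bounds. Going down \<open>p\<close> levels
  divides the weight by at most \<open>2 ^ p\<close>, while the sampled set keeps about
  \<open>2 ^ p\<close> members, so the squared norm loses a factor of order \<open>2 ^ p\<close>;
  the net forces \<open>2 ^ p\<close> to be of order \<open>d log n\<close>, which is where
  \<open>sqrt d\<close> comes from. For dilation a net is out of reach: one large coordinate sampled
  at a high level makes the stack heavy-tailed, so only Markov's inequality is available, and it can
  be afforded for at most \<open>d\<close> basis vectors. Even the expectation would be too large if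
  those high samples were not removed first. The mmc enters only through flat vectors, in the form
  that \<open>W s / sqrt s\<close> is nearly increasing in \<open>s\<close>. The losses obtained are
  \<open>sqrt d * log^(3/2) n\<close> and \<open>mmc * d^(3/2) * log^(3/2) n\<close>, both smaller
  than claimed; the closing arithmetic gives the rest away. The failure probabilities,
  \<open>0.03\<close> for sampling, \<open>0.01\<close> for CountSketch and \<open>0.03\<close> for
  the Gaussian matrix, stay below \<open>0.1\<close> together.\<close>

locale sym_norm =
  fixes n :: nat and L :: "(nat \<Rightarrow> real) \<Rightarrow> real"
  assumes dim_pos: "n \<ge> 1"
    and cong: "(\<And>i. i < n \<Longrightarrow> x i = y i) \<Longrightarrow> L x = L y"
    and nonneg: "0 \<le> L x"
    and zero_iff: "L x = 0 \<longleftrightarrow> (\<forall>i<n. x i = 0)"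
    and scale: "L (\<lambda>i. c * x i) = \<bar>c\<bar> * L x"
    and triangle: "L (\<lambda>i. x i + y i) \<le> L x + L y"
    and perm: "p permutes {..<n} \<Longrightarrow> L (\<lambda>i. x (p i)) = L x"
    and sign: "(\<And>i. i < n \<Longrightarrow> s i \<in> {-1, 1}) \<Longrightarrow> L (\<lambda>i. s i * x i) = L x"
begin

text \<open>\<open>W k\<close> saturates at \<open>W n\<close> for \<open>k > n\<close>, exactly as
  \<open>level_weight\<close> does, so \<open>W (2 ^ i)\<close> is the weight of level
  \<open>i\<close> without a case distinction on \<open>2 ^ i <= n\<close>.\<close>

definition W :: "nat \<Rightarrow> real" where
  "W k = L (\<lambda>i. if i < k then 1 else 0)"

lemma zero [simp]: "L (\<lambda>i. 0) = 0"
  by (simp add: zero_iff)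

text \<open>The vector with the smaller coordinate is a convex combination of \<open>x\<close> and
  of \<open>x\<close> with coordinate \<open>j\<close> negated, which have the same norm;
  \<open>\<theta>\<close> is the weight that produces the value \<open>a\<close>.\<close>

lemma mono_coord:
  assumes "\<bar>a\<bar> \<le> \<bar>x j\<bar>"
  shows "L (x(j := a)) \<le> L x"
proof (cases "x j = 0")
  case True
  then have "x(j := a) = x" using assms by auto
  then show ?thesis by simp
next
  case False
  define \<theta> where "\<theta> = (1 + a / x j) / 2"
  have "\<bar>a / x j\<bar> \<le> 1" using assms False by (simp add: abs_divide divide_le_eq_1)
  then have "- 1 \<le> a / x j" "a / x j \<le> 1" by linarith+
  then have th: "0 \<le> \<theta>" "\<theta> \<le> 1" by (simp_all add: \<theta>_def)
  have "L (\<lambda>i. (if i = j then -1 else 1) * x i) = L x" by (rule sign) auto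
  moreover have "x(j := a) = (\<lambda>i. \<theta> * x i + (1 - \<theta>) * ((if i = j then -1 else 1) * x i))"
    using False by (auto simp: \<theta>_def field_simps fun_eq_iff)
  ultimately have "L (x(j := a)) \<le> \<bar>\<theta>\<bar> * L x + \<bar>1 - \<theta>\<bar> * L x"
    using triangle[of "\<lambda>i. \<theta> * x i" "\<lambda>i. (1 - \<theta>) * ((if i = j then -1 else 1) * x i)"]
    by (simp only: scale)
  also have "\<dots> = L x" using th by (simp add: algebra_simps)
  finally show ?thesis .
qed

lemma mono:
  assumes "\<And>i. i < n \<Longrightarrow> \<bar>x i\<bar> \<le> \<bar>y i\<bar>"
  shows "L x \<le> L y"
proof -
  have "k \<le> n \<Longrightarrow> L (\<lambda>i. if i < k then x i else y i) \<le> L y" for k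
  proof (induction k)
    case (Suc k)
    let ?z = "\<lambda>i. if i < k then x i else y i"
    have "(\<lambda>i. if i < Suc k then x i else y i) = ?z(k := x k)" by (auto simp: fun_eq_iff less_Suc_eq)
    moreover have "L (?z(k := x k)) \<le> L ?z" using Suc.prems assms by (intro mono_coord) auto
    ultimately show ?case using Suc by simp
  qed simp
  from this[of n] show ?thesis using cong[of "\<lambda>i. if i < n then x i else y i" x] by simp
qed

lemma minus: "L (\<lambda>i. - x i) = L x"
  using scale[of "-1" x] by simp

lemma sum_le: "finite I \<Longrightarrow> L (\<lambda>i. \<Sum>k\<in>I. f k i) \<le> (\<Sum>k\<in>I. L (f k))"
proof (induction I rule: finite_induct)
  case (insert k I)
  have "L (\<lambda>i. \<Sum>k\<in>insert k I. f k i) = L (\<lambda>i. f k i + (\<Sum>k\<in>I. f k i))" using insert by simp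
  also have "\<dots> \<le> L (f k) + L (\<lambda>i. \<Sum>k\<in>I. f k i)" by (rule triangle)
  finally show ?case using insert by simp
qed simp

text \<open>A bijection from \<open>J\<close> onto \<open>{..<card J}\<close> and one between the
  complements glue to a permutation of \<open>{..<n}\<close>, so permutation invariance leaves only
  the cardinality.\<close>

lemma W_indicator:
  assumes "J \<subseteq> {..<n}"
  shows "L (\<lambda>i. of_bool (i \<in> J)) = W (card J)"
proof -
  have fin: "finite J" using assms finite_subset by blast
  have cJ: "card J \<le> n" using card_mono[OF _ assms] by simp
  obtain p where p: "p permutes {..<n}" "p ` J = {..<card J}"
  proof -
    obtain f where f: "bij_betw f J {..<card J}"
      using fin by (metis card_lessThan finite_lessThan finite_same_card_bij)
    have "card ({..<n} - J) = card ({..<n} - {..<card J})"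
      using assms cJ fin by (simp add: card_Diff_subset)
    then obtain g where g: "bij_betw g ({..<n} - J) ({..<n} - {..<card J})"
      by (meson finite_Diff finite_lessThan finite_same_card_bij)
    define p where "p i = (if i \<in> J then f i else if i < n then g i else i)" for i
    have 1: "bij_betw p J {..<card J}" using f by (rule bij_betw_cong[THEN iffD1, rotated]) (simp add: p_def)
    have 2: "bij_betw p ({..<n} - J) ({..<n} - {..<card J})"
      using g by (rule bij_betw_cong[THEN iffD1, rotated]) (simp add: p_def)
    have "bij_betw p (J \<union> ({..<n} - J)) ({..<card J} \<union> ({..<n} - {..<card J}))"
      by (rule bij_betw_combine[OF 1 2]) auto
    moreover have "J \<union> ({..<n} - J) = {..<n}" "{..<card J} \<union> ({..<n} - {..<card J}) = {..<n}"
      using assms cJ by auto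
    ultimately have "bij_betw p {..<n} {..<n}" by simp
    then have "p permutes {..<n}"
      using assms by (intro bij_imp_permutes) (auto simp: p_def)
    moreover have "p ` J = {..<card J}" using 1 by (simp add: bij_betw_def)
    ultimately show ?thesis using that by blast
  qed
  have "i \<in> J \<longleftrightarrow> p i < card J" for i
    using p(2) permutes_inj[OF p(1)] by (metis (no_types, lifting) image_eqI image_iff injD lessThan_iff)
  then have "L (\<lambda>i. of_bool (i \<in> J)) = L (\<lambda>i. (\<lambda>i. if i < card J then 1 else 0) (p i))"
    by (intro cong) simp
  also have "\<dots> = W (card J)" unfolding W_def by (rule perm[OF p(1)])
  finally show ?thesis .
qed

section \<open>Growth of the norms of flat vectors\<close>

lemma W_mono: "a \<le> b \<Longrightarrow> W a \<le> W b"
  unfolding W_def by (rule mono) auto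

lemma W_ge_dim: "n \<le> k \<Longrightarrow> W k = W n"
  unfolding W_def by (rule cong) auto

lemma W_1_pos: "W 1 > 0"
proof -
  have "W 1 \<noteq> 0" unfolding W_def zero_iff using dim_pos by force
  then show ?thesis using nonneg by (metis W_def less_eq_real_def)
qed

lemma W_nonneg: "W k \<ge> 0"
  unfolding W_def by (rule nonneg)

lemma W_pos: "k \<ge> 1 \<Longrightarrow> W k > 0"
  using W_1_pos W_mono by fastforce

lemma W_add: "W (a + b) \<le> W a + W b"
proof (cases "a \<le> n")
  case True
  let ?g = "\<lambda>i. of_bool (i \<in> {a..<min n (a + b)}) :: real"
  have "W (a + b) = L (\<lambda>i. (if i < a then 1 else 0) + ?g i)"
    unfolding W_def by (rule cong) auto
  also have "\<dots> \<le> W a + L ?g" unfolding W_def by (rule triangle)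
  also have "L ?g = W (min n (a + b) - a)" by (subst W_indicator) auto
  also have "\<dots> \<le> W b" by (rule W_mono) auto
  finally show ?thesis by simp
next
  case False
  then have "W (a + b) = W n" "W a = W n" by (auto intro: W_ge_dim)
  then show ?thesis using W_nonneg by simp
qed

lemma W_mult: "W (q * k) \<le> real q * W k"
proof (induction q)
  case 0
  show ?case by (simp add: W_def)
next
  case (Suc q)
  have "W (Suc q * k) \<le> W k + W (q * k)" using W_add[of k "q * k"] by simp
  then show ?case using Suc by (simp add: algebra_simps)
qed

text \<open>\<open>s\<close> positions are covered by \<open>s div r + 1\<close> blocks of length
  \<open>r\<close>, and the extra block at most doubles the ratio since \<open>r <= s\<close>. In
  the dilation bound this limits the weight of levels above the rank of a coordinate.\<close>

lemma W_ratio: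
  assumes "1 \<le> r" "r \<le> s"
  shows "W s \<le> 2 * (real s / real r) * W r"
proof -
  have "s \<le> (s div r + 1) * r"
    using dividend_less_div_times[of r s] assms by (simp add: algebra_simps)
  then have "W s \<le> W ((s div r + 1) * r)" by (rule W_mono)
  also have "\<dots> \<le> real (s div r + 1) * W r" by (rule W_mult)
  also have "\<dots> \<le> (2 * (real s / real r)) * W r"
  proof (rule mult_right_mono)
    have "real (s div r) \<le> real s / real r" by (rule of_nat_div_le_of_nat)
    moreover have "1 \<le> real s / real r" using assms by simp
    ultimately show "real (s div r + 1) \<le> 2 * (real s / real r)" by simp
  qed (rule W_nonneg)
  finally show ?thesis .
qed

text \<open>Crude, but it makes coordinates bounded on the unit ball: this bounds the determinants
  in \<open>auerbach_basis\<close> and the discretisation error in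
  \<open>sketch_sq_crude\<close>.\<close>

lemma coord_le: "j < n \<Longrightarrow> \<bar>x j\<bar> * W 1 \<le> L x"
proof -
  assume j: "j < n"
  have "\<bar>x j\<bar> * W 1 = \<bar>x j\<bar> * L (\<lambda>i. of_bool (i \<in> {j}))" using j by (subst W_indicator) auto
  also have "\<dots> = L (\<lambda>i. x j * of_bool (i \<in> {j}))" by (simp only: scale)
  also have "\<dots> \<le> L x" by (rule mono) auto
  finally show ?thesis .
qed

text \<open>The comparison with the sum of absolute values is the Lipschitz bound behind
  \<open>continuous\<close>.\<close>

lemma le_sum_abs: "L x \<le> (\<Sum>j<n. \<bar>x j\<bar>) * W 1"
proof -
  have "L x = L (\<lambda>i. \<Sum>j<n. x j * of_bool (i \<in> {j}))"
    by (rule cong) (simp add: of_bool_def if_distrib cong: if_cong)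
  also have "\<dots> \<le> (\<Sum>j<n. L (\<lambda>i. x j * of_bool (i \<in> {j})))" by (rule sum_le) simp
  also have "\<dots> = (\<Sum>j<n. \<bar>x j\<bar> * W 1)"
    by (intro sum.cong refl) (subst scale, subst W_indicator, auto)
  finally show ?thesis by (simp add: sum_distrib_right)
qed

section \<open>Decreasing rearrangement and dyadic blocks\<close>

lemma sorted_perm_exists:
  fixes x :: "nat \<Rightarrow> real"
  shows "\<exists>\<sigma>. \<sigma> permutes {..<n} \<and> (\<forall>i j. i \<le> j \<longrightarrow> j < n \<longrightarrow> \<bar>x (\<sigma> j)\<bar> \<le> \<bar>x (\<sigma> i)\<bar>)"
proof -
  define xs where "xs = sort_key (\<lambda>j. - \<bar>x j\<bar>) [0..<n]"
  have len: "length xs = n" by (simp add: xs_def)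
  have bij: "bij_betw (\<lambda>i. xs ! i) {..<n} {..<n}"
    by (rule bij_betw_nth) (auto simp: xs_def)
  define \<sigma> where "\<sigma> i = (if i < n then xs ! i else i)" for i
  have "bij_betw \<sigma> {..<n} {..<n}" using bij by (rule bij_betw_cong[THEN iffD1, rotated]) (simp add: \<sigma>_def)
  then have "\<sigma> permutes {..<n}" by (rule bij_imp_permutes) (simp add: \<sigma>_def)
  moreover have "\<bar>x (\<sigma> j)\<bar> \<le> \<bar>x (\<sigma> i)\<bar>" if "i \<le> j" "j < n" for i j
  proof -
    have "sorted (map (\<lambda>j. - \<bar>x j\<bar>) xs)" by (simp add: xs_def)
    from sorted_nth_mono[OF this that(1)] show ?thesis using that len by (simp add: \<sigma>_def)
  qed
  ultimately show ?thesis by blast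
qed

text \<open>By monotonicity: the \<open>r + 1\<close> largest coordinates dominate a flat vector of
  height \<open>\<bar>x (\<sigma> r)\<bar>\<close>.\<close>

lemma W_rank_le:
  assumes "\<sigma> permutes {..<n}" "\<And>i j. i \<le> j \<Longrightarrow> j < n \<Longrightarrow> \<bar>x (\<sigma> j)\<bar> \<le> \<bar>x (\<sigma> i)\<bar>" "r < n"
  shows "\<bar>x (\<sigma> r)\<bar> * W (r + 1) \<le> L x"
proof -
  have "\<bar>x (\<sigma> r)\<bar> * W (r + 1) = L (\<lambda>i. x (\<sigma> r) * (if i < r + 1 then 1 else 0))"
    unfolding W_def by (simp only: scale)
  also have "\<dots> \<le> L (\<lambda>i. x (\<sigma> i))" using assms(2,3) by (intro mono) auto
  also have "\<dots> = L x" by (rule perm[OF assms(1)])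
  finally show ?thesis .
qed

text \<open>After sorting, the 0-based ranks from \<open>2 ^ k - 1\<close> to
  \<open>2 ^ (k + 1) - 2\<close> form a block of at most \<open>2 ^ k\<close> positions dominated by
  its first entry. The triangle inequality over at most \<open>q\<close> blocks makes one of them
  account for a \<open>1 / q\<close> share of the norm. For that \<open>k\<close>, \<open>J\<close>
  consists of the \<open>2 ^ k\<close> largest coordinates, all at least the first entry of the
  block.\<close>

lemma dyadic_large_set:
  assumes "n < 2 ^ q"
  shows "\<exists>k J \<alpha>. 2 ^ k \<le> n \<and> J \<subseteq> {..<n} \<and> card J = 2 ^ k \<and> 0 \<le> \<alpha> \<and> (\<forall>j\<in>J. \<alpha> \<le> \<bar>x j\<bar>) \<and>
    L x \<le> real q * (\<alpha> * W (2 ^ k))"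
proof -
  obtain \<sigma> where \<sigma>: "\<sigma> permutes {..<n}" and mon: "\<And>i j. i \<le> j \<Longrightarrow> j < n \<Longrightarrow> \<bar>x (\<sigma> j)\<bar> \<le> \<bar>x (\<sigma> i)\<bar>"
    using sorted_perm_exists[of x] by blast
  define y where "y i = (if i < n then x (\<sigma> i) else 0)" for i
  define I where "I = {k. k < q \<and> 2 ^ k \<le> n}"
  let ?B = "\<lambda>k. {i. i < n \<and> 2 ^ k - 1 \<le> i \<and> i < 2 ^ (k + 1) - 1} :: nat set"
  have finI: "finite I" by (simp add: I_def)
  have I0: "0 \<in> I" using dim_pos assms by (cases q) (auto simp: I_def)
  have "L x = L y" using perm[OF \<sigma>, of x] cong[of "\<lambda>i. x (\<sigma> i)" y] by (simp add: y_def)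
  also have "\<dots> \<le> L (\<lambda>i. \<Sum>k\<in>I. \<bar>y (2 ^ k - 1)\<bar> * of_bool (i \<in> ?B k))"
  proof (rule mono)
    fix i assume i: "i < n"
    obtain k where k: "2 ^ k \<le> i + 1" "i + 1 < 2 ^ (k + 1)"
      using ex_power_ivl1[of 2 "i + 1"] by auto
    have "2 ^ k < (2::nat) ^ q" using k i assms by linarith
    then have "k < q" by simp
    then have kI: "k \<in> I" using k i by (auto simp: I_def)
    have "\<bar>y i\<bar> \<le> \<bar>y (2 ^ k - 1)\<bar> * of_bool (i \<in> ?B k)"
      using mon[of "2 ^ k - 1" i] k i by (auto simp: y_def)
    also have "\<dots> \<le> (\<Sum>k\<in>I. \<bar>y (2 ^ k - 1)\<bar> * of_bool (i \<in> ?B k))"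
      using kI finI by (intro member_le_sum) auto
    finally show "\<bar>y i\<bar> \<le> \<bar>\<Sum>k\<in>I. \<bar>y (2 ^ k - 1)\<bar> * of_bool (i \<in> ?B k)\<bar>" by linarith
  qed
  also have "\<dots> \<le> (\<Sum>k\<in>I. L (\<lambda>i. \<bar>y (2 ^ k - 1)\<bar> * of_bool (i \<in> ?B k)))"
    by (rule sum_le[OF finI])
  also have "\<dots> \<le> (\<Sum>k\<in>I. \<bar>y (2 ^ k - 1)\<bar> * W (2 ^ k))"
  proof (rule sum_mono)
    fix k assume "k \<in> I"
    have "card (?B k) \<le> card {2 ^ k - 1..<(2::nat) ^ (k + 1) - 1}" by (intro card_mono) auto
    then have c: "card (?B k) \<le> 2 ^ k" by simp
    have "L (\<lambda>i. \<bar>y (2 ^ k - 1)\<bar> * of_bool (i \<in> ?B k)) = \<bar>y (2 ^ k - 1)\<bar> * W (card (?B k))"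
      by (subst scale, subst W_indicator) auto
    also have "\<dots> \<le> \<bar>y (2 ^ k - 1)\<bar> * W (2 ^ k)" by (intro mult_left_mono W_mono c) auto
    finally show "L (\<lambda>i. \<bar>y (2 ^ k - 1)\<bar> * of_bool (i \<in> ?B k)) \<le> \<bar>y (2 ^ k - 1)\<bar> * W (2 ^ k)" .
  qed
  finally have le: "L x \<le> (\<Sum>k\<in>I. \<bar>y (2 ^ k - 1)\<bar> * W (2 ^ k))" .
  obtain k where k: "k \<in> I" "\<And>k'. k' \<in> I \<Longrightarrow> \<bar>y (2 ^ k' - 1)\<bar> * W (2 ^ k') \<le> \<bar>y (2 ^ k - 1)\<bar> * W (2 ^ k)"
  proof -
    let ?f = "\<lambda>k. \<bar>y (2 ^ k - 1)\<bar> * W (2 ^ k)"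
    have "Max (?f ` I) \<in> ?f ` I" using finI I0 by (intro Max_in) auto
    then obtain k where "k \<in> I" "?f k = Max (?f ` I)" by force
    then show ?thesis using that[of k] finI by (metis (no_types, lifting) Max_ge finite_imageI image_eqI)
  qed
  let ?\<alpha> = "\<bar>y (2 ^ k - 1)\<bar>"
  have kn: "2 ^ k \<le> n" using k by (simp add: I_def)
  have "(\<Sum>k\<in>I. \<bar>y (2 ^ k - 1)\<bar> * W (2 ^ k)) \<le> real (card I) * (?\<alpha> * W (2 ^ k))"
    by (rule sum_bounded_above) (use k in auto)
  also have "\<dots> \<le> real q * (?\<alpha> * W (2 ^ k))"
  proof (rule mult_right_mono)
    have "card I \<le> card {..<q}" by (intro card_mono) (auto simp: I_def)
    then show "real (card I) \<le> real q" by simp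
  qed (use W_nonneg in auto)
  finally have "L x \<le> real q * (?\<alpha> * W (2 ^ k))" using le by simp
  moreover have "\<sigma> ` {..<2 ^ k} \<subseteq> {..<n}" using permutes_image[OF \<sigma>] kn by auto
  moreover have "card (\<sigma> ` {..<2 ^ k}) = 2 ^ k"
    using permutes_inj[OF \<sigma>] by (subst card_image) (auto intro: inj_on_subset)
  moreover have "?\<alpha> \<le> \<bar>x j\<bar>" if j: "j \<in> \<sigma> ` {..<2 ^ k}" for j
  proof -
    obtain i where i: "i < 2 ^ k" "j = \<sigma> i" using j by blast
    have "(2::nat) ^ k \<ge> 1" by simp
    then have "2 ^ k - 1 < n" using kn by linarith
    then show ?thesis using mon[of i "2 ^ k - 1"] i by (simp add: y_def)
  qed
  ultimately show ?thesis using kn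
    by (intro exI[of _ k] exI[of _ "\<sigma> ` {..<2 ^ k}"] exI[of _ ?\<alpha>]) auto
qed

end

text \<open>The estimates work with functions on \<open>nat\<close>, of which only the first
  \<open>n\<close> values matter (\<open>cong\<close>): sums, permutations and truncations are then
  plain lambda terms without carrier conditions.\<close>

lemma symmetric_norm_sym_norm:
  assumes "symmetric_norm n l" "n \<ge> 1"
  shows "sym_norm n (\<lambda>x. l (vec n x))"
proof
  fix x y :: "nat \<Rightarrow> real" and c and p :: "nat \<Rightarrow> nat" and s :: "nat \<Rightarrow> real"
  note S = assms(1)[unfolded symmetric_norm_def]
  have [simp]: "vec n x \<in> carrier_vec n" for x :: "nat \<Rightarrow> real" by simp
  show "n \<ge> 1" by fact
  show "l (vec n x) = l (vec n y)" if "\<And>i. i < n \<Longrightarrow> x i = y i"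
    using that by (intro arg_cong[of _ _ l]) (auto intro!: eq_vecI)
  show "0 \<le> l (vec n x)" using S by simp
  have "vec n x = 0\<^sub>v n \<longleftrightarrow> (\<forall>i<n. x i = 0)" by (auto simp: vec_eq_iff)
  then show "l (vec n x) = 0 \<longleftrightarrow> (\<forall>i<n. x i = 0)" using S by simp
  have "c \<cdot>\<^sub>v vec n x = vec n (\<lambda>i. c * x i)" by (auto intro!: eq_vecI)
  then show "l (vec n (\<lambda>i. c * x i)) = \<bar>c\<bar> * l (vec n x)" using S by (metis vec_carrier)
  have "vec n x + vec n y = vec n (\<lambda>i. x i + y i)" by (auto intro!: eq_vecI)
  then show "l (vec n (\<lambda>i. x i + y i)) \<le> l (vec n x) + l (vec n y)" using S by (metis vec_carrier)
  show "l (vec n (\<lambda>i. x (p i))) = l (vec n x)" if p: "p permutes {..<n}"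
  proof -
    have "vec n (\<lambda>i. x (p i)) = vec n (\<lambda>i. vec n x $ p i)"
      using permutes_in_image[OF p] by (intro eq_vecI) auto
    then show ?thesis using S p by simp
  qed
  show "l (vec n (\<lambda>i. s i * x i)) = l (vec n x)" if p: "\<And>i. i < n \<Longrightarrow> s i \<in> {-1, 1}"
  proof -
    have "vec n (\<lambda>i. s i * x i) = vec n (\<lambda>i. s i * vec n x $ i)" by (intro eq_vecI) auto
    moreover have "\<forall>i<n. s i \<in> {-1, 1}" using p by blast
    ultimately show ?thesis using S by (metis vec_carrier)
  qed
qed

section \<open>Well-conditioned bases\<close>

definition inner_n :: "nat \<Rightarrow> (nat \<Rightarrow> real) \<Rightarrow> (nat \<Rightarrow> real) \<Rightarrow> real" where
  "inner_n N x y = (\<Sum>i<N. x i * y i)"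

definition sqn :: "nat \<Rightarrow> (nat \<Rightarrow> real) \<Rightarrow> real" where
  "sqn N x = (\<Sum>i<N. (x i)\<^sup>2)"

text \<open>Stands for the column space of a matrix with columns \<open>v j\<close>. The columns may
  be dependent, which is why the bases below have their own length \<open>r <= d\<close>.\<close>

definition lincomb_n :: "nat \<Rightarrow> (nat \<Rightarrow> nat \<Rightarrow> real) \<Rightarrow> (nat \<Rightarrow> real) \<Rightarrow> nat \<Rightarrow> real" where
  "lincomb_n d v c = (\<lambda>i. \<Sum>j<d. c j * v j i)"

lemma inner_n_self: "inner_n N x x = sqn N x"
  by (simp add: inner_n_def sqn_def power2_eq_square)

lemma sqn_nonneg [simp]: "0 \<le> sqn N x"
  by (simp add: sqn_def sum_nonneg)

lemma inner_n_commute: "inner_n N x y = inner_n N y x"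
  by (simp add: inner_n_def mult.commute)

lemma inner_n_lincomb: "inner_n N (lincomb_n d v c) y = (\<Sum>j<d. c j * inner_n N (v j) y)"
  unfolding inner_n_def lincomb_n_def
  by (simp add: sum_distrib_left sum_distrib_right mult.assoc) (rule sum.swap)

lemma sqn_zero_iff: "sqn N x = 0 \<longleftrightarrow> (\<forall>i<N. x i = 0)"
  by (auto simp: sqn_def sum_nonneg_eq_0_iff)

text \<open>Gram-Schmidt by induction on the number of columns; a column whose residual vanishes on
  \<open>{..<N}\<close> adds no basis vector. Expansions in \<open>q\<close> hold only on the first
  \<open>N\<close> coordinates, because the residual is controlled only there.\<close>

lemma orthonormal_basis_exists:
  fixes v :: "nat \<Rightarrow> nat \<Rightarrow> real"
  shows "\<exists>r q. r \<le> d \<and> (\<forall>a<r. \<forall>b<r. inner_n N (q a) (q b) = of_bool (a = b)) \<and>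
    (\<forall>a<r. \<exists>c. q a = lincomb_n d v c) \<and>
    (\<forall>c. \<exists>e. \<forall>i<N. lincomb_n d v c i = lincomb_n r q e i)"
proof (induction d)
  case 0
  show ?case by (intro exI[of _ 0]) (auto simp: lincomb_n_def)
next
  case (Suc d)
  then obtain r q where r: "r \<le> d" and on: "\<And>a b. a < r \<Longrightarrow> b < r \<Longrightarrow> inner_n N (q a) (q b) = of_bool (a = b)"
    and sp: "\<And>a. a < r \<Longrightarrow> \<exists>c. q a = lincomb_n d v c"
    and cov: "\<And>c. \<exists>e. \<forall>i<N. lincomb_n d v c i = lincomb_n r q e i" by metis
  \<comment> \<open>The residual of the new column after projection onto the span of the vectors
    found so far.\<close>
  define w where "w i = v d i - lincomb_n r q (\<lambda>a. inner_n N (v d) (q a)) i" for i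
  have lin_Suc: "lincomb_n (Suc d) v c = (\<lambda>i. lincomb_n d v c i + c d * v d i)" for c
    by (simp add: lincomb_n_def)
  have sp': "\<exists>c. q a = lincomb_n (Suc d) v c" if a: "a < r" for a
  proof -
    obtain c where "q a = lincomb_n d v c" using sp a by blast
    then have "q a = lincomb_n (Suc d) v (c(d := 0))" by (simp add: lin_Suc) (simp add: lincomb_n_def)
    then show ?thesis by blast
  qed
  have w_orth: "inner_n N w (q b) = 0" if b: "b < r" for b
  proof -
    have "inner_n N w (q b) = inner_n N (v d) (q b) - inner_n N (lincomb_n r q (\<lambda>a. inner_n N (v d) (q a))) (q b)"
      unfolding inner_n_def w_def by (simp add: algebra_simps sum_subtractf)
    also have "inner_n N (lincomb_n r q (\<lambda>a. inner_n N (v d) (q a))) (q b) =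
        (\<Sum>a<r. inner_n N (v d) (q a) * of_bool (a = b))"
      unfolding inner_n_lincomb using on b by (intro sum.cong) auto
    also have "\<dots> = inner_n N (v d) (q b)" using b by (simp add: of_bool_def if_distrib cong: if_cong)
    finally show ?thesis by simp
  qed
  have w_sp: "\<exists>c. w = lincomb_n (Suc d) v c"
  proof -
    obtain C where C: "\<And>a. a < r \<Longrightarrow> q a = lincomb_n (Suc d) v (C a)" using sp' by metis
    let ?k = "\<lambda>a. inner_n N (v d) (q a)"
    have "w = lincomb_n (Suc d) v (\<lambda>j. of_bool (j = d) - (\<Sum>a<r. ?k a * C a j))"
    proof
      fix i
      have "lincomb_n r q ?k i = (\<Sum>a<r. ?k a * (\<Sum>j<Suc d. C a j * v j i))"
        unfolding lincomb_n_def[of r] using C by (intro sum.cong refl) (simp add: lincomb_n_def)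
      also have "\<dots> = (\<Sum>a<r. \<Sum>j<Suc d. ?k a * C a j * v j i)"
        by (simp only: sum_distrib_left mult.assoc)
      also have "\<dots> = (\<Sum>j<Suc d. \<Sum>a<r. ?k a * C a j * v j i)"
        by (rule sum.swap)
      also have "\<dots> = (\<Sum>j<Suc d. (\<Sum>a<r. ?k a * C a j) * v j i)"
        by (simp only: sum_distrib_right)
      finally have 1: "lincomb_n r q ?k i = (\<Sum>j<Suc d. (\<Sum>a<r. ?k a * C a j) * v j i)" .
      have 2: "v d i = (\<Sum>j<Suc d. of_bool (j = d) * v j i)" by simp
      show "w i = lincomb_n (Suc d) v (\<lambda>j. of_bool (j = d) - (\<Sum>a<r. ?k a * C a j)) i"
        unfolding w_def 1 by (subst 2) (simp only: lincomb_n_def left_diff_distrib sum_subtractf)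
    qed
    then show ?thesis by blast
  qed
  show ?case
  proof (cases "sqn N w = 0")
    case True
    then have w0: "w i = 0" if "i < N" for i using that by (simp add: sqn_zero_iff)
    have "\<exists>e. \<forall>i<N. lincomb_n (Suc d) v c i = lincomb_n r q e i" for c
    proof -
      obtain e where e: "\<And>i. i < N \<Longrightarrow> lincomb_n d v c i = lincomb_n r q e i" using cov by blast
      have "lincomb_n (Suc d) v c i = lincomb_n r q (\<lambda>a. e a + c d * inner_n N (v d) (q a)) i" if "i < N" for i
        using e[OF that] w0[OF that] unfolding lin_Suc w_def
        by (simp add: lincomb_n_def algebra_simps sum.distrib sum_distrib_left)
      then show ?thesis by blast
    qed
    then show ?thesis using r on sp' by (intro exI[of _ r] exI[of _ q]) auto
  next
    case False
    define s where "s = sqrt (sqn N w)"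
    have s: "s > 0" "s * s = sqn N w" using False sqn_nonneg[of N w] by (auto simp: s_def order.strict_iff_order)
    define q' where "q' a = (if a = r then (\<lambda>i. w i / s) else q a)" for a
    have q'r: "q' r = (\<lambda>i. w i / s)" by (simp add: q'_def)
    have q'o: "a < r \<Longrightarrow> q' a = q a" for a by (simp add: q'_def)
    have in1: "inner_n N (\<lambda>i. w i / s) y = inner_n N w y / s" for y
      by (simp add: inner_n_def sum_divide_distrib)
    have rr: "inner_n N (q' r) (q' r) = 1"
      unfolding q'r in1 using s by (subst inner_n_commute) (simp add: in1 inner_n_self flip: s(2))
    have ro: "inner_n N (q' r) (q' b) = 0" if "b < r" for b
      using w_orth[OF that] that by (simp add: q'r q'o in1)
    have ON: "inner_n N (q' a) (q' b) = of_bool (a = b)" if "a < Suc r" "b < Suc r" for a b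
      using that rr ro[of a] ro[of b] on[of a b] by (cases "a = r"; cases "b = r") (auto simp: q'o inner_n_commute less_Suc_eq)
    have SP: "\<exists>c. q' a = lincomb_n (Suc d) v c" if "a < Suc r" for a
    proof (cases "a = r")
      case True
      obtain c where c: "w = lincomb_n (Suc d) v c" using w_sp by blast
      have "q' r = lincomb_n (Suc d) v (\<lambda>j. c j / s)"
        unfolding q'r c by (simp add: lincomb_n_def sum_divide_distrib add_divide_distrib)
      then show ?thesis using True by blast
    next
      case False
      then show ?thesis using that sp'[of a] q'o[of a] by simp
    qed
    have COV: "\<exists>e. \<forall>i<N. lincomb_n (Suc d) v c i = lincomb_n (Suc r) q' e i" for c
    proof -
      obtain e where e: "\<And>i. i < N \<Longrightarrow> lincomb_n d v c i = lincomb_n r q e i" using cov by blast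
      let ?e = "\<lambda>a. if a = r then c d * s else e a + c d * inner_n N (v d) (q a)"
      have "lincomb_n (Suc d) v c i = lincomb_n (Suc r) q' ?e i" if "i < N" for i
      proof -
        have "lincomb_n (Suc r) q' ?e i = (\<Sum>a<r. (e a + c d * inner_n N (v d) (q a)) * q a i) + c d * w i"
          unfolding lincomb_n_def using s by (simp add: q'o q'r)
        also have "\<dots> = lincomb_n r q e i + c d * v d i"
          unfolding w_def by (simp add: lincomb_n_def algebra_simps sum.distrib sum_distrib_left)
        finally show ?thesis using e[OF that] by (simp add: lin_Suc)
      qed
      then show ?thesis by blast
    qed
    show ?thesis using r ON SP COV by (intro exI[of _ "Suc r"] exI[of _ q']) auto
  qed
qed

lemma sqn_lincomb_orthonormal:
  assumes "\<And>a b. a < r \<Longrightarrow> b < r \<Longrightarrow> inner_n N (q a) (q b) = of_bool (a = b)"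
  shows "sqn N (lincomb_n r q e) = sqn r e"
proof -
  have "sqn N (lincomb_n r q e) = (\<Sum>a<r. e a * inner_n N (q a) (lincomb_n r q e))"
    by (simp only: inner_n_lincomb flip: inner_n_self)
  also have "\<dots> = (\<Sum>a<r. e a * (\<Sum>b<r. e b * of_bool (b = a)))"
    using assms by (intro sum.cong refl arg_cong2[of _ _ _ _ "(*)"]) (subst inner_n_commute, simp add: inner_n_lincomb)
  also have "\<dots> = sqn r e" unfolding sqn_def
    by (intro sum.cong refl) (simp add: of_bool_def if_distrib power2_eq_square cong: if_cong)
  finally show ?thesis .
qed

section \<open>Auerbach bases for a symmetric norm\<close>

context sym_norm
begin

text \<open>A determinant within a factor 2 of the supremum suffices for Cramer's rule, so that no compactness
  argument is needed; this is where the factor 2 comes from.\<close>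

lemma auerbach_basis:
  fixes v :: "nat \<Rightarrow> nat \<Rightarrow> real"
  shows "\<exists>r u. r \<le> d \<and> (\<forall>k<r. L (u k) \<le> 1 \<and> (\<exists>c. u k = lincomb_n d v c)) \<and>
    (\<forall>c. \<exists>e. (\<forall>i<n. lincomb_n d v c i = lincomb_n r u e i) \<and> (\<forall>k<r. \<bar>e k\<bar> \<le> 2 * L (lincomb_n d v c)))"
proof -
  obtain r q where r: "r \<le> d" and on: "\<And>a b. a < r \<Longrightarrow> b < r \<Longrightarrow> inner_n n (q a) (q b) = of_bool (a = b)"
    and sp: "\<And>a. a < r \<Longrightarrow> \<exists>c. q a = lincomb_n d v c"
    and cov: "\<And>c. \<exists>e. \<forall>i<n. lincomb_n d v c i = lincomb_n r q e i"
    using orthonormal_basis_exists[of d n v] by metis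
  \<comment> \<open>The columns are coordinate vectors, in the orthonormal basis \<open>q\<close>,
    of \<open>r\<close> vectors in the unit ball of \<open>L\<close>; the basis wanted is one of
    nearly maximal volume.\<close>
  define F where "F = {X \<in> carrier_mat r r. \<forall>k<r. L (lincomb_n r q (\<lambda>a. X $$ (a, k))) \<le> 1}"
  have coord: "\<bar>e a\<bar> \<le> (\<Sum>i<n. \<bar>q a i\<bar>) / W 1 * L (lincomb_n r q e)" if a: "a < r" for e a
  proof -
    have "e a = (\<Sum>b<r. e b * of_bool (b = a))" using a by (simp add: of_bool_def if_distrib cong: if_cong)
    also have "\<dots> = inner_n n (lincomb_n r q e) (q a)"
      unfolding inner_n_lincomb using on a by (intro sum.cong) auto
    finally have "\<bar>e a\<bar> \<le> (\<Sum>i<n. \<bar>lincomb_n r q e i * q a i\<bar>)"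
      unfolding inner_n_def by (metis sum_abs)
    also have "\<dots> \<le> (\<Sum>i<n. (L (lincomb_n r q e) / W 1) * \<bar>q a i\<bar>)"
      unfolding abs_mult by (intro sum_mono mult_right_mono) (use coord_le[of _ "lincomb_n r q e"] W_1_pos in \<open>auto simp: pos_le_divide_eq\<close>)
    finally show ?thesis by (simp only: sum_distrib_left [symmetric]) (simp add: mult.commute)
  qed
  define M where "M = (\<Sum>a<r. \<Sum>i<n. \<bar>q a i\<bar>) / W 1"
  have entry: "\<bar>X $$ (a, k)\<bar> \<le> M" if "X \<in> F" "a < r" "k < r" for X a k
  proof -
    have "\<bar>X $$ (a, k)\<bar> \<le> (\<Sum>i<n. \<bar>q a i\<bar>) / W 1 * L (lincomb_n r q (\<lambda>a. X $$ (a, k)))"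
      using coord[of a "\<lambda>a. X $$ (a, k)"] that by simp
    also have "\<dots> \<le> (\<Sum>i<n. \<bar>q a i\<bar>) / W 1 * 1"
      using that W_1_pos by (intro mult_left_mono) (auto simp: F_def sum_nonneg)
    also have "(\<Sum>i<n. \<bar>q a i\<bar>) \<le> (\<Sum>a<r. \<Sum>i<n. \<bar>q a i\<bar>)"
      using that by (intro member_le_sum[of a "{..<r}" "\<lambda>a. \<Sum>i<n. \<bar>q a i\<bar>"]) (auto simp: sum_nonneg)
    finally show ?thesis using W_1_pos by (simp add: M_def divide_right_mono)
  qed
  \<comment> \<open>Bounded entries bound the determinant through the Leibniz formula, so the
    supremum below is finite.\<close>
  have det_bd: "\<bar>det X\<bar> \<le> real (card {p. p permutes {0..<r}}) * M ^ r" if X: "X \<in> F" for X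
  proof -
    have Xc: "X \<in> carrier_mat r r" using X by (simp add: F_def)
    have "\<bar>det X\<bar> \<le> (\<Sum>p | p permutes {0..<r}. \<bar>signof p * (\<Prod>i = 0..<r. X $$ (i, p i))\<bar>)"
      unfolding det_def'[OF Xc] by (rule sum_abs)
    also have "\<dots> \<le> (\<Sum>p | p permutes {0..<r}. M ^ r)"
    proof (rule sum_mono)
      fix p assume "p \<in> {p. p permutes {0..<r}}"
      then have p: "p permutes {0..<r}" by simp
      have "\<bar>\<Prod>i = 0..<r. X $$ (i, p i)\<bar> \<le> (\<Prod>i = 0..<r. M)"
        unfolding abs_prod using p by (intro prod_mono) (auto intro!: entry[OF X] simp: permutes_in_image[OF p, of _, simplified atLeastLessThan_iff])
      then show "\<bar>signof p * (\<Prod>i = 0..<r. X $$ (i, p i))\<bar> \<le> M ^ r"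
        by (simp add: abs_mult sign_def)
    qed
    finally show ?thesis by simp
  qed
  have bdd: "bdd_above ((\<lambda>X. \<bar>det X\<bar>) ` F)" using det_bd by (auto simp: bdd_above_def)
  \<comment> \<open>A small multiple of the identity is admissible, so the supremum is positive; the
    summand \<open>1\<close> keeps the denominator positive.\<close>
  define \<delta> where "\<delta> = 1 / (1 + (\<Sum>a<r. L (q a)))"
  have \<delta>: "\<delta> > 0" "\<And>a. a < r \<Longrightarrow> \<delta> * L (q a) \<le> 1"
  proof -
    have nn: "(\<Sum>a<r. L (q a)) \<ge> 0" using nonneg by (auto intro: sum_nonneg)
    then show "\<delta> > 0" by (simp add: \<delta>_def)
    fix a assume "a < r"
    then have "L (q a) \<le> (\<Sum>a<r. L (q a))" using nonneg by (intro member_le_sum) auto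
    then show "\<delta> * L (q a) \<le> 1" using nn by (simp add: \<delta>_def)
  qed
  have X0: "\<delta> \<cdot>\<^sub>m 1\<^sub>m r \<in> F"
  proof -
    have "L (lincomb_n r q (\<lambda>a. (\<delta> \<cdot>\<^sub>m 1\<^sub>m r) $$ (a, k))) \<le> 1" if k: "k < r" for k
    proof -
      have "lincomb_n r q (\<lambda>a. (\<delta> \<cdot>\<^sub>m 1\<^sub>m r) $$ (a, k)) = (\<lambda>i. \<Sum>a<r. if a = k then \<delta> * q a i else 0)"
        unfolding lincomb_n_def using k by (intro ext sum.cong) auto
      also have "\<dots> = (\<lambda>i. \<delta> * q k i)" using k by simp
      finally show ?thesis using scale[of \<delta> "q k"] \<delta> k by simp
    qed
    then show ?thesis by (simp add: F_def)
  qed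
  define S where "S = (SUP X\<in>F. \<bar>det X\<bar>)"
  have Spos: "S > 0"
  proof -
    have "0 < \<bar>det (\<delta> \<cdot>\<^sub>m 1\<^sub>m r :: real mat)\<bar>" using \<delta> by (simp add: det_smult)
    also have "\<dots> \<le> S" unfolding S_def by (rule cSUP_upper[OF X0 bdd])
    finally show ?thesis .
  qed
  obtain X where X: "X \<in> F" and half: "S / 2 < \<bar>det X\<bar>"
  proof -
    have "S / 2 < S" using Spos by simp
    then show ?thesis using that less_cSUP_iff[OF _ bdd, of "S / 2"] X0 unfolding S_def by blast
  qed
  have Xc: "X \<in> carrier_mat r r" using X by (simp add: F_def)
  have detX: "det X \<noteq> 0" using half Spos by auto
  define u where "u k = lincomb_n r q (\<lambda>a. X $$ (a, k))" for k
  have u1: "L (u k) \<le> 1" if "k < r" for k using X that by (simp add: F_def u_def)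
  have lin_u: "lincomb_n r u (\<lambda>k. x $ k) = lincomb_n r q (\<lambda>a. (X *\<^sub>v x) $ a)" if "x \<in> carrier_vec r" for x
  proof
    fix i
    have "lincomb_n r u (\<lambda>k. x $ k) i = (\<Sum>k<r. \<Sum>a<r. X $$ (a, k) * x $ k * q a i)"
      unfolding u_def lincomb_n_def by (simp add: sum_distrib_left mult.assoc mult.left_commute)
    also have "\<dots> = (\<Sum>a<r. \<Sum>k<r. X $$ (a, k) * x $ k * q a i)" by (rule sum.swap)
    also have "\<dots> = lincomb_n r q (\<lambda>a. (X *\<^sub>v x) $ a) i"
      unfolding lincomb_n_def using that Xc
      by (intro sum.cong refl) (simp add: scalar_prod_def atLeast0LessThan sum_distrib_right)
    finally show "lincomb_n r u (\<lambda>k. x $ k) i = lincomb_n r q (\<lambda>a. (X *\<^sub>v x) $ a) i" .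
  qed
  have span_u: "\<exists>c. u k = lincomb_n d v c" for k
  proof -
    obtain C where C: "\<And>a. a < r \<Longrightarrow> q a = lincomb_n d v (C a)" using sp by metis
    have "u k = lincomb_n d v (\<lambda>j. \<Sum>a<r. X $$ (a, k) * C a j)"
    proof
      fix i
      have "u k i = (\<Sum>a<r. \<Sum>j<d. X $$ (a, k) * C a j * v j i)"
        unfolding u_def lincomb_n_def[of r] using C by (intro sum.cong refl) (simp add: lincomb_n_def sum_distrib_left mult.assoc)
      also have "\<dots> = (\<Sum>j<d. \<Sum>a<r. X $$ (a, k) * C a j * v j i)" by (rule sum.swap)
      finally show "u k i = lincomb_n d v (\<lambda>j. \<Sum>a<r. X $$ (a, k) * C a j) i"
        by (simp add: lincomb_n_def sum_distrib_right)
    qed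
    then show ?thesis by blast
  qed
  obtain Y where Y: "Y \<in> carrier_mat r r" "X * Y = 1\<^sub>m r"
    using det_non_zero_imp_unit[OF Xc detX] unfolding Units_def ring_mat_def by auto
  have main: "\<bar>x $ k\<bar> \<le> 2 * L (lincomb_n r q (\<lambda>a. (X *\<^sub>v x) $ a))" if x: "x \<in> carrier_vec r" and k: "k < r" for x k
  proof -
    have unit: "\<bar>x $ k\<bar> \<le> 2" if x: "x \<in> carrier_vec r" and le: "L (lincomb_n r q (\<lambda>a. (X *\<^sub>v x) $ a)) \<le> 1" for x
    proof -
      \<comment> \<open>Replacing column \<open>k\<close> by another vector of the unit ball stays
        in \<open>F\<close>, and by Cramer's rule it multiplies the determinant by
        \<open>x $ k\<close>; near-maximality of \<open>X\<close> then bounds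
        \<open>x $ k\<close>.\<close>
      let ?R = "replace_col X (X *\<^sub>v x) k"
      have "L (lincomb_n r q (\<lambda>a. ?R $$ (a, j))) \<le> 1" if j: "j < r" for j
      proof (cases "j = k")
        case True
        have "lincomb_n r q (\<lambda>a. ?R $$ (a, j)) = lincomb_n r q (\<lambda>a. (X *\<^sub>v x) $ a)"
          unfolding lincomb_n_def replace_col_def using True Xc k by (intro ext sum.cong) auto
        then show ?thesis using le by simp
      next
        case False
        have "lincomb_n r q (\<lambda>a. ?R $$ (a, j)) = u j"
          unfolding u_def lincomb_n_def replace_col_def using False Xc j by (intro ext sum.cong) auto
        then show ?thesis using u1 j by simp
      qed
      then have "?R \<in> F" using Xc by (simp add: F_def replace_col_def)
      then have "\<bar>det ?R\<bar> \<le> S" unfolding S_def by (rule cSUP_upper[OF _ bdd])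
      then have "\<bar>x $ k\<bar> * \<bar>det X\<bar> \<le> S" using cramer_lemma_mat[OF Xc x k] by (simp add: abs_mult)
      also have "\<dots> \<le> 2 * \<bar>det X\<bar>" using half by simp
      finally show ?thesis using detX by simp
    qed
    let ?l = "L (lincomb_n r q (\<lambda>a. (X *\<^sub>v x) $ a))"
    have hom: "L (lincomb_n r q (\<lambda>a. (X *\<^sub>v (c \<cdot>\<^sub>v x)) $ a)) = \<bar>c\<bar> * ?l" for c
    proof -
      have "lincomb_n r q (\<lambda>a. (X *\<^sub>v (c \<cdot>\<^sub>v x)) $ a) = (\<lambda>i. c * lincomb_n r q (\<lambda>a. (X *\<^sub>v x) $ a) i)"
        unfolding lincomb_n_def sum_distrib_left using Xc x
        by (intro ext sum.cong refl) (simp add: mult_mat_vec)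
      then show ?thesis by (simp add: scale)
    qed
    show ?thesis
    proof (cases "?l = 0")
      case True
      have "x $ k = 0"
      proof (rule ccontr)
        \<comment> \<open>If the norm is zero, every multiple of \<open>x\<close> satisfies
          \<open>unit\<close>; the factor \<open>3 / x $ k\<close> would produce the coordinate
          \<open>3 > 2\<close>.\<close>
        assume nz: "x $ k \<noteq> 0"
        have "\<bar>((3 / x $ k) \<cdot>\<^sub>v x) $ k\<bar> \<le> 2" by (rule unit) (use x True hom in auto)
        then show False using nz x k by simp
      qed
      then show ?thesis using nonneg by simp
    next
      case False
      then have l: "?l > 0" using nonneg by (simp add: order.strict_iff_order)
      have "\<bar>((1 / ?l) \<cdot>\<^sub>v x) $ k\<bar> \<le> 2" by (rule unit) (use x l hom in auto)
      then show ?thesis using l x k by (simp add: abs_mult field_simps)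
    qed
  qed
  have cov_u: "\<exists>e. (\<forall>i<n. lincomb_n d v c i = lincomb_n r u e i) \<and> (\<forall>k<r. \<bar>e k\<bar> \<le> 2 * L (lincomb_n d v c))" for c
  proof -
    obtain e where e: "\<And>i. i < n \<Longrightarrow> lincomb_n d v c i = lincomb_n r q e i" using cov by blast
    define x where "x = Y *\<^sub>v vec r e"
    have x: "x \<in> carrier_vec r" using Y by (simp add: x_def)
    have "X *\<^sub>v x = vec r e" unfolding x_def using Xc Y assoc_mult_mat_vec[OF Xc Y(1), of "vec r e"] by simp
    then have "lincomb_n r q (\<lambda>a. (X *\<^sub>v x) $ a) = lincomb_n r q e"
      by (auto simp: lincomb_n_def intro!: sum.cong)
    then have eq: "lincomb_n d v c i = lincomb_n r q (\<lambda>a. (X *\<^sub>v x) $ a) i" if "i < n" for i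
      using e[OF that] by simp
    then have "L (lincomb_n d v c) = L (lincomb_n r q (\<lambda>a. (X *\<^sub>v x) $ a))" by (rule cong)
    then show ?thesis using main[OF x] eq lin_u[OF x] by (intro exI[of _ "\<lambda>k. x $ k"]) auto
  qed
  show ?thesis using r u1 span_u cov_u by (intro exI[of _ r] exI[of _ u]) auto
qed

end

section \<open>The sketching program\<close>

text \<open>Asserts a terminating run within the budget, the form in which the running time enters
  the theorem.\<close>

definition hoare_cost :: "(state \<Rightarrow> bool) \<Rightarrow> com \<Rightarrow> nat \<Rightarrow> (state \<Rightarrow> bool) \<Rightarrow> bool" where
  "hoare_cost P c k Q \<longleftrightarrow> (\<forall>\<sigma>. P \<sigma> \<longrightarrow> (\<exists>\<sigma>' j. exec c \<sigma> j \<sigma>' \<and> j \<le> k \<and> Q \<sigma>'))"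

lemma hoare_cost_Seq:
  assumes "hoare_cost P c1 k1 Q" "hoare_cost Q c2 k2 R"
  shows "hoare_cost P (Seq c1 c2) (k1 + k2) R"
  using assms unfolding hoare_cost_def by (meson add_mono exec_Seq)

lemma hoare_cost_Skip: "(\<And>\<sigma>. P \<sigma> \<Longrightarrow> Q \<sigma>) \<Longrightarrow> hoare_cost P Skip k Q"
  unfolding hoare_cost_def using exec_Skip by blast

lemma hoare_cost_NStore:
  assumes "\<And>\<sigma>. P \<sigma> \<Longrightarrow> Q (store (fst \<sigma>) x (nval a (fst \<sigma>)) (nval b (fst \<sigma>)) (nval e (fst \<sigma>)), snd \<sigma>)"
  shows "hoare_cost P (NStore x a b e) 1 Q"
  using assms exec_NStore unfolding hoare_cost_def by blast

lemma hoare_cost_RStore: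
  assumes "\<And>\<sigma>. P \<sigma> \<Longrightarrow> Q (fst \<sigma>, store (snd \<sigma>) x (nval a (fst \<sigma>)) (nval b (fst \<sigma>)) (rval e \<sigma>))"
  shows "hoare_cost P (RStore x a b e) 1 Q"
  using assms exec_RStore unfolding hoare_cost_def by blast

lemma hoare_cost_Cond:
  assumes "hoare_cost (\<lambda>\<sigma>. P \<sigma> \<and> bval b \<sigma>) c1 k Q" "hoare_cost (\<lambda>\<sigma>. P \<sigma> \<and> \<not> bval b \<sigma>) c2 k Q"
  shows "hoare_cost P (Cond b c1 c2) (1 + k) Q"
  unfolding hoare_cost_def
proof (intro allI impI)
  fix \<sigma> assume P: "P \<sigma>"
  show "\<exists>\<sigma>' j. exec (Cond b c1 c2) \<sigma> j \<sigma>' \<and> j \<le> 1 + k \<and> Q \<sigma>'"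
  proof (cases "bval b \<sigma>")
    case True
    then obtain \<sigma>' j where "exec c1 \<sigma> j \<sigma>'" "j \<le> k" "Q \<sigma>'" using assms(1) P unfolding hoare_cost_def by blast
    then show ?thesis using exec_CondT[OF True] by (intro exI[of _ \<sigma>'] exI[of _ "1 + j"]) auto
  next
    case False
    then obtain \<sigma>' j where "exec c2 \<sigma> j \<sigma>'" "j \<le> k" "Q \<sigma>'" using assms(2) P unfolding hoare_cost_def by blast
    then show ?thesis using exec_CondF[OF False] by (intro exI[of _ \<sigma>'] exI[of _ "1 + j"]) auto
  qed
qed

text \<open>The counter is an index of the invariant and not read from the state, so
  \<open>test\<close> has to link it to the guard. A round costs one test plus the body; the leading
  \<open>1\<close> is the last, failing test. The induction is on the number of rounds left.\<close>

lemma hoare_cost_For: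
  assumes step: "\<And>i. i < N \<Longrightarrow> hoare_cost (I i) c k (I (Suc i))"
    and test: "\<And>i \<sigma>. i \<le> N \<Longrightarrow> I i \<sigma> \<Longrightarrow> bval b \<sigma> \<longleftrightarrow> i < N"
  shows "hoare_cost (I 0) (While b c) (1 + N * (1 + k)) (I N)"
proof -
  have "hoare_cost (I (N - j)) (While b c) (1 + j * (1 + k)) (I N)" if "j \<le> N" for j
    using that
  proof (induction j)
    case 0
    show ?case unfolding hoare_cost_def
    proof (intro allI impI)
      fix \<sigma> assume "I (N - 0) \<sigma>"
      then show "\<exists>\<sigma>' j. exec (While b c) \<sigma> j \<sigma>' \<and> j \<le> 1 + 0 * (1 + k) \<and> I N \<sigma>'"
        using exec_WhileF[of b \<sigma> c] test[of N \<sigma>] by (intro exI[of _ \<sigma>] exI[of _ 1]) simp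
    qed
  next
    case (Suc j)
    let ?i = "N - Suc j"
    have i: "?i < N" "Suc ?i = N - j" using Suc.prems by auto
    show ?case unfolding hoare_cost_def
    proof (intro allI impI)
      fix \<sigma> assume I: "I ?i \<sigma>"
      then obtain \<sigma>1 k1 where 1: "exec c \<sigma> k1 \<sigma>1" "k1 \<le> k" "I (N - j) \<sigma>1"
        using step[OF i(1)] i(2) unfolding hoare_cost_def by fastforce
      then obtain \<sigma>2 k2 where 2: "exec (While b c) \<sigma>1 k2 \<sigma>2" "k2 \<le> 1 + j * (1 + k)" "I N \<sigma>2"
        using Suc unfolding hoare_cost_def by (meson Suc_leD)
      have "bval b \<sigma>" using test[of ?i \<sigma>] I i by simp
      from exec_WhileT[OF this 1(1) 2(1)]
      show "\<exists>\<sigma>' ja. exec (While b c) \<sigma> ja \<sigma>' \<and> ja \<le> 1 + Suc j * (1 + k) \<and> I N \<sigma>'"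
        using 1 2 by (intro exI[of _ \<sigma>2] exI[of _ "1 + k1 + k2"]) auto
    qed
  qed
  from this[of N] show ?thesis by simp
qed

lemma hoare_cost_conseq:
  assumes "hoare_cost P' c k' Q'" "\<And>\<sigma>. P \<sigma> \<Longrightarrow> P' \<sigma>" "\<And>\<sigma>. Q' \<sigma> \<Longrightarrow> Q \<sigma>" "k' \<le> k"
  shows "hoare_cost P c k Q"
  using assms unfolding hoare_cost_def by (meson le_trans)

section \<open>The program: scatter the nonzero entries, then multiply by the dense Gaussian
  factor\<close>

abbreviation scalar :: "string \<Rightarrow> nexp" where
  "scalar x \<equiv> NLoad x (NConst 0) (NConst 0)"

abbreviation set_scalar :: "string \<Rightarrow> nexp \<Rightarrow> com" where
  "set_scalar x \<equiv> NStore x (NConst 0) (NConst 0)"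

abbreviation load1 :: "string \<Rightarrow> nexp \<Rightarrow> nexp" where
  "load1 x a \<equiv> NLoad x a (NConst 0)"

abbreviation increment :: "string \<Rightarrow> com" where
  "increment x \<equiv> set_scalar x (NAdd (scalar x) (NConst 1))"

text \<open>Adds one summand to CountSketch times the stacked matrix times \<open>A\<close>. The
  variable \<open>q\<close> holds the stacked row index \<open>row + i * n\<close>; the stacked
  matrix itself is never formed.\<close>

definition scatter_update :: com where
  "scatter_update =
     Cond (NLess (NConst 0) (NLoad ''sample'' (scalar ''i'') (load1 ''row'' (scalar ''e''))))
       (RStore ''acc'' (load1 ''hash'' (scalar ''q'')) (load1 ''col'' (scalar ''e''))
         (RAdd (RLoad ''acc'' (load1 ''hash'' (scalar ''q'')) (load1 ''col'' (scalar ''e'')))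
           (RMul (RMul (RLoad ''weight'' (scalar ''i'') (NConst 0)) (RLoad ''sign'' (scalar ''q'') (NConst 0)))
             (RLoad ''val'' (scalar ''e'') (NConst 0)))))
       Skip"

text \<open>As the machine has no integer multiplication, the stacked row index is advanced by
  \<open>n\<close> at every level.\<close>

definition scatter_levels :: com where
  "scatter_levels =
     While (NLess (scalar ''i'') (NAdd (scalar ''t'') (NConst 1)))
       (Seq scatter_update (Seq (set_scalar ''q'' (NAdd (scalar ''q'') (scalar ''n''))) (increment ''i'')))"

definition scatter :: com where
  "scatter =
     While (NLess (scalar ''e'') (scalar ''nnz''))
       (Seq (set_scalar ''i'' (NConst 0)) (Seq (set_scalar ''q'' (load1 ''row'' (scalar ''e'')))
         (Seq scatter_levels (increment ''e''))))"

definition gauss_entry :: com where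
  "gauss_entry =
     While (NLess (scalar ''b'') (scalar ''m''))
       (Seq (RStore ''out'' (scalar ''a'') (scalar ''c'')
          (RAdd (RLoad ''out'' (scalar ''a'') (scalar ''c''))
            (RMul (RLoad ''gauss'' (scalar ''a'') (scalar ''b'')) (RLoad ''acc'' (scalar ''b'') (scalar ''c'')))))
         (increment ''b''))"

definition gauss_row :: com where
  "gauss_row =
     While (NLess (scalar ''c'') (scalar ''d''))
       (Seq (set_scalar ''b'' (NConst 0)) (Seq gauss_entry (increment ''c'')))"

definition gauss_all :: com where
  "gauss_all =
     While (NLess (scalar ''a'') (scalar ''m1''))
       (Seq (set_scalar ''c'' (NConst 0)) (Seq gauss_row (increment ''a'')))"

definition sketch_prog :: com where
  "sketch_prog = Seq scatter gauss_all"

definition scratch :: "string set" where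
  "scratch = {''e'', ''i'', ''q'', ''a'', ''b'', ''c''}"

text \<open>Retains of the input state only that outputs and counters start at zero; what the input
  arrays mean is supplied in \<open>sketch_prog_output\<close>.\<close>

locale sketch_input =
  fixes \<mu> :: nmem and \<rho> :: rmem
  assumes acc0: "\<rho> ''acc'' = (\<lambda>_ _. 0)" and out0: "\<rho> ''out'' = (\<lambda>_ _. 0)"
    and scratch0: "x \<in> scratch \<Longrightarrow> \<mu> x 0 0 = 0"
begin

abbreviation "N x \<equiv> \<mu> x 0 0"

definition frame :: "state \<Rightarrow> bool" where
  "frame \<sigma> \<longleftrightarrow> (\<forall>x. x \<notin> scratch \<longrightarrow> fst \<sigma> x = \<mu> x) \<and> (\<forall>x. x \<notin> {''acc'', ''out''} \<longrightarrow> snd \<sigma> x = \<rho> x)"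

definition contrib :: "nat \<Rightarrow> nat \<Rightarrow> nat \<Rightarrow> nat \<Rightarrow> real" where
  "contrib e i b c = (let q = \<mu> ''row'' e 0 + i * N ''n'' in
     if 0 < \<mu> ''sample'' i (\<mu> ''row'' e 0) \<and> \<mu> ''hash'' q 0 = b \<and> \<mu> ''col'' e 0 = c
     then \<rho> ''weight'' i 0 * \<rho> ''sign'' q 0 * \<rho> ''val'' e 0 else 0)"

text \<open>The counter \<open>a\<close> is carried along with value zero because
  \<open>gauss_all\<close> starts counting without resetting it.\<close>

definition acc_inv :: "nat \<Rightarrow> nat \<Rightarrow> state \<Rightarrow> bool" where
  "acc_inv e i \<sigma> \<longleftrightarrow> frame \<sigma> \<and> fst \<sigma> ''e'' 0 0 = e \<and> snd \<sigma> ''out'' = (\<lambda>_ _. 0) \<and> fst \<sigma> ''a'' 0 0 = 0 \<and>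
     snd \<sigma> ''acc'' = (\<lambda>b c. (\<Sum>e'<e. \<Sum>i'<Suc (N ''t''). contrib e' i' b c) + (\<Sum>i'<i. contrib e i' b c))"

definition level_inv :: "nat \<Rightarrow> nat \<Rightarrow> state \<Rightarrow> bool" where
  "level_inv e i \<sigma> \<longleftrightarrow> acc_inv e i \<sigma> \<and> fst \<sigma> ''i'' 0 0 = i \<and> fst \<sigma> ''q'' 0 0 = \<mu> ''row'' e 0 + i * N ''n''"

lemma frame_fst: "frame \<sigma> \<Longrightarrow> x \<notin> scratch \<Longrightarrow> fst \<sigma> x = \<mu> x"
  and frame_snd: "frame \<sigma> \<Longrightarrow> x \<noteq> ''acc'' \<Longrightarrow> x \<noteq> ''out'' \<Longrightarrow> snd \<sigma> x = \<rho> x"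
  by (auto simp: frame_def)

text \<open>Serves both branches of the sampling test: when the coordinate is not sampled, the
  contribution is zero and the memory unchanged.\<close>

lemma acc_inv_Suc:
  assumes "level_inv e i \<sigma>" and "\<rho>' = (snd \<sigma>)(''acc'' := (\<lambda>b c. snd \<sigma> ''acc'' b c + contrib e i b c))"
  shows "acc_inv e (Suc i) (fst \<sigma>, \<rho>') \<and> fst \<sigma> ''i'' 0 0 = i \<and> fst \<sigma> ''q'' 0 0 = \<mu> ''row'' e 0 + i * N ''n''"
  using assms(1) unfolding assms(2) level_inv_def acc_inv_def frame_def by (simp add: add.assoc)

lemma scatter_update_correct:
  "hoare_cost (level_inv e i) scatter_update 2
    (\<lambda>\<sigma>. acc_inv e (Suc i) \<sigma> \<and> fst \<sigma> ''i'' 0 0 = i \<and> fst \<sigma> ''q'' 0 0 = \<mu> ''row'' e 0 + i * N ''n'')"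
  (is "hoare_cost _ _ _ ?Q")
proof -
  let ?b = "NLess (NConst 0) (NLoad ''sample'' (scalar ''i'') (load1 ''row'' (scalar ''e'')))"
  have "hoare_cost (level_inv e i) scatter_update (1 + 1) ?Q"
    unfolding scatter_update_def
  proof (intro hoare_cost_Cond hoare_cost_RStore hoare_cost_Skip, goal_cases)
    case (1 \<sigma>)
    then have lv: "level_inv e i \<sigma>" and b: "bval ?b \<sigma>" by auto
    then have fr: "frame \<sigma>" by (simp add: level_inv_def acc_inv_def)
    have f: "fst \<sigma> ''sample'' = \<mu> ''sample''" "fst \<sigma> ''row'' = \<mu> ''row''" "fst \<sigma> ''col'' = \<mu> ''col''"
      "fst \<sigma> ''hash'' = \<mu> ''hash''" "snd \<sigma> ''weight'' = \<rho> ''weight''"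
      "snd \<sigma> ''sign'' = \<rho> ''sign''" "snd \<sigma> ''val'' = \<rho> ''val''"
      using fr by (auto simp: frame_fst frame_snd scratch_def)
    have v: "fst \<sigma> ''i'' 0 0 = i" "fst \<sigma> ''q'' 0 0 = \<mu> ''row'' e 0 + i * N ''n''" "fst \<sigma> ''e'' 0 0 = e"
      using lv by (auto simp: level_inv_def acc_inv_def)
    have smp: "0 < \<mu> ''sample'' i (\<mu> ''row'' e 0)" using b by (simp add: f v)
    show ?case
      unfolding fst_conv
      by (rule acc_inv_Suc[OF lv]) (use smp in \<open>simp add: f v store_def contrib_def Let_def fun_eq_iff\<close>)
  next
    case (2 \<sigma>)
    then have lv: "level_inv e i \<sigma>" and b: "\<not> bval ?b \<sigma>" by auto
    then have fr: "frame \<sigma>" by (simp add: level_inv_def acc_inv_def)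
    have f: "fst \<sigma> ''sample'' = \<mu> ''sample''" "fst \<sigma> ''row'' = \<mu> ''row''"
      using fr by (auto simp: frame_fst scratch_def)
    have v: "fst \<sigma> ''i'' 0 0 = i" "fst \<sigma> ''e'' 0 0 = e"
      using lv by (auto simp: level_inv_def acc_inv_def)
    have "contrib e i = (\<lambda>_ _. 0)" using b by (simp add: f v contrib_def Let_def fun_eq_iff)
    then show ?case using acc_inv_Suc[OF lv, of "snd \<sigma>"] by simp
  qed
  then show ?thesis by (rule hoare_cost_conseq) simp_all
qed

lemma scatter_levels_correct:
  "hoare_cost (level_inv e 0) scatter_levels (1 + Suc (N ''t'') * 5) (level_inv e (Suc (N ''t'')))"
proof -
  have "hoare_cost (level_inv e 0) scatter_levels (1 + Suc (N ''t'') * (1 + (2 + (1 + 1)))) (level_inv e (Suc (N ''t'')))"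
    unfolding scatter_levels_def
  proof (intro hoare_cost_For hoare_cost_Seq)
    fix i
    show "hoare_cost (level_inv e i) scatter_update 2
    (\<lambda>\<sigma>. acc_inv e (Suc i) \<sigma> \<and> fst \<sigma> ''i'' 0 0 = i \<and> fst \<sigma> ''q'' 0 0 = \<mu> ''row'' e 0 + i * N ''n'')"
      by (rule scatter_update_correct)
    show "hoare_cost (\<lambda>\<sigma>. acc_inv e (Suc i) \<sigma> \<and> fst \<sigma> ''i'' 0 0 = i \<and> fst \<sigma> ''q'' 0 0 = \<mu> ''row'' e 0 + i * N ''n'')
        (set_scalar ''q'' (NAdd (scalar ''q'') (scalar ''n''))) 1
        (\<lambda>\<sigma>. acc_inv e (Suc i) \<sigma> \<and> fst \<sigma> ''i'' 0 0 = i \<and> fst \<sigma> ''q'' 0 0 = \<mu> ''row'' e 0 + Suc i * N ''n'')"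
      by (rule hoare_cost_NStore) (auto simp: acc_inv_def store_def frame_def scratch_def)
    show "hoare_cost (\<lambda>\<sigma>. acc_inv e (Suc i) \<sigma> \<and> fst \<sigma> ''i'' 0 0 = i \<and> fst \<sigma> ''q'' 0 0 = \<mu> ''row'' e 0 + Suc i * N ''n'')
        (increment ''i'') 1 (level_inv e (Suc i))"
      by (rule hoare_cost_NStore) (auto simp: level_inv_def acc_inv_def store_def frame_def scratch_def)
    show "bval (NLess (scalar ''i'') (NAdd (scalar ''t'') (NConst 1))) \<sigma> \<longleftrightarrow> i < Suc (N ''t'')" if "level_inv e i \<sigma>" for \<sigma>
      using that by (auto simp: level_inv_def acc_inv_def frame_def scratch_def)
  qed
  then show ?thesis by (rule hoare_cost_conseq) (simp_all add: algebra_simps)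
qed

lemma scatter_correct:
  "hoare_cost (acc_inv 0 0) scatter (1 + N ''nnz'' * (5 + Suc (N ''t'') * 5)) (acc_inv (N ''nnz'') 0)"
proof -
  have "hoare_cost (acc_inv 0 0) scatter (1 + N ''nnz'' * (1 + (1 + (1 + ((1 + Suc (N ''t'') * 5) + 1))))) (acc_inv (N ''nnz'') 0)"
    unfolding scatter_def
  proof (rule hoare_cost_For, intro hoare_cost_Seq)
    fix e
    show "hoare_cost (acc_inv e 0) (set_scalar ''i'' (NConst 0)) 1 (\<lambda>\<sigma>. acc_inv e 0 \<sigma> \<and> fst \<sigma> ''i'' 0 0 = 0)"
      by (rule hoare_cost_NStore) (auto simp: acc_inv_def store_def frame_def scratch_def)
    show "hoare_cost (\<lambda>\<sigma>. acc_inv e 0 \<sigma> \<and> fst \<sigma> ''i'' 0 0 = 0) (set_scalar ''q'' (load1 ''row'' (scalar ''e''))) 1 (level_inv e 0)"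
      by (rule hoare_cost_NStore) (auto simp: level_inv_def acc_inv_def store_def frame_def scratch_def)
    show "hoare_cost (level_inv e 0) scatter_levels (1 + Suc (N ''t'') * 5) (level_inv e (Suc (N ''t'')))"
      by (rule scatter_levels_correct)
    \<comment> \<open>All \<open>t + 1\<close> levels of entry \<open>e\<close> are done, so its
      inner sum becomes the last term of the outer sum.\<close>
    show "hoare_cost (level_inv e (Suc (N ''t''))) (increment ''e'') 1 (acc_inv (Suc e) 0)"
      by (rule hoare_cost_NStore) (auto simp: level_inv_def acc_inv_def store_def frame_def scratch_def fun_eq_iff)
    show "bval (NLess (scalar ''e'') (scalar ''nnz'')) \<sigma> \<longleftrightarrow> e < N ''nnz''" if "acc_inv e 0 \<sigma>" for \<sigma>
      using that by (auto simp: acc_inv_def frame_def scratch_def)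
  qed
  then show ?thesis by (rule hoare_cost_conseq) (simp_all add: algebra_simps)
qed

text \<open>This is entry \<open>(b, c)\<close> of CountSketch times the stacked matrix times
  \<open>A\<close>, as \<open>sketch_prog_output\<close> shows.\<close>

definition acc_final :: "nat \<Rightarrow> nat \<Rightarrow> real" where
  "acc_final b c = (\<Sum>e<N ''nnz''. \<Sum>i<Suc (N ''t''). contrib e i b c)"

definition dot :: "nat \<Rightarrow> nat \<Rightarrow> nat \<Rightarrow> real" where
  "dot k a c = (\<Sum>b<k. \<rho> ''gauss'' a b * acc_final b c)"

text \<open>A fresh cell equals the empty sum \<open>dot 0\<close>, so finishing a cell or a row
  only reindexes the output: \<open>(a, c, m)\<close> describes the same array as
  \<open>(a, c + 1, 0)\<close>, and \<open>(a, d, 0)\<close> the same as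
  \<open>(a + 1, 0, 0)\<close>.\<close>

definition out_inv :: "nat \<Rightarrow> nat \<Rightarrow> nat \<Rightarrow> state \<Rightarrow> bool" where
  "out_inv a c b \<sigma> \<longleftrightarrow> frame \<sigma> \<and> fst \<sigma> ''a'' 0 0 = a \<and> snd \<sigma> ''acc'' = acc_final \<and>
     snd \<sigma> ''out'' = (\<lambda>a' c'. if c' < N ''d'' \<and> a' < a \<or> a' = a \<and> c' < c then dot (N ''m'') a' c'
        else if a' = a \<and> c' = c then dot b a' c' else 0)"

lemma gauss_entry_correct:
  "hoare_cost (\<lambda>\<sigma>. out_inv a c 0 \<sigma> \<and> fst \<sigma> ''c'' 0 0 = c \<and> fst \<sigma> ''b'' 0 0 = 0) gauss_entry (1 + N ''m'' * 3)
     (\<lambda>\<sigma>. out_inv a c (N ''m'') \<sigma> \<and> fst \<sigma> ''c'' 0 0 = c \<and> fst \<sigma> ''b'' 0 0 = N ''m'')"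
proof -
  let ?I = "\<lambda>b \<sigma>. out_inv a c b \<sigma> \<and> fst \<sigma> ''c'' 0 0 = c \<and> fst \<sigma> ''b'' 0 0 = b"
  have "hoare_cost (?I 0) gauss_entry (1 + N ''m'' * (1 + (1 + 1))) (?I (N ''m''))"
    unfolding gauss_entry_def
  proof (rule hoare_cost_For, rule hoare_cost_Seq)
    fix b
    show "hoare_cost (?I b) (RStore ''out'' (scalar ''a'') (scalar ''c'')
          (RAdd (RLoad ''out'' (scalar ''a'') (scalar ''c''))
            (RMul (RLoad ''gauss'' (scalar ''a'') (scalar ''b'')) (RLoad ''acc'' (scalar ''b'') (scalar ''c''))))) 1
          (\<lambda>\<sigma>. out_inv a c (Suc b) \<sigma> \<and> fst \<sigma> ''c'' 0 0 = c \<and> fst \<sigma> ''b'' 0 0 = b)"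
    proof (rule hoare_cost_RStore)
      fix \<sigma> assume *: "?I b \<sigma>"
      then have "snd \<sigma> ''gauss'' = \<rho> ''gauss''" by (auto simp: out_inv_def frame_def)
      then show "out_inv a c (Suc b) (fst \<sigma>, store (snd \<sigma>) ''out'' (nval (scalar ''a'') (fst \<sigma>)) (nval (scalar ''c'') (fst \<sigma>))
          (rval (RAdd (RLoad ''out'' (scalar ''a'') (scalar ''c''))
            (RMul (RLoad ''gauss'' (scalar ''a'') (scalar ''b'')) (RLoad ''acc'' (scalar ''b'') (scalar ''c'')))) \<sigma>)) \<and>
          fst (fst \<sigma>, store (snd \<sigma>) ''out'' (nval (scalar ''a'') (fst \<sigma>)) (nval (scalar ''c'') (fst \<sigma>))
          (rval (RAdd (RLoad ''out'' (scalar ''a'') (scalar ''c''))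
            (RMul (RLoad ''gauss'' (scalar ''a'') (scalar ''b'')) (RLoad ''acc'' (scalar ''b'') (scalar ''c'')))) \<sigma>)) ''c'' 0 0 = c \<and>
          fst (fst \<sigma>, store (snd \<sigma>) ''out'' (nval (scalar ''a'') (fst \<sigma>)) (nval (scalar ''c'') (fst \<sigma>))
          (rval (RAdd (RLoad ''out'' (scalar ''a'') (scalar ''c''))
            (RMul (RLoad ''gauss'' (scalar ''a'') (scalar ''b'')) (RLoad ''acc'' (scalar ''b'') (scalar ''c'')))) \<sigma>)) ''b'' 0 0 = b"
        using * by (auto simp: out_inv_def store_def frame_def dot_def fun_eq_iff)
    qed
    show "hoare_cost (\<lambda>\<sigma>. out_inv a c (Suc b) \<sigma> \<and> fst \<sigma> ''c'' 0 0 = c \<and> fst \<sigma> ''b'' 0 0 = b) (increment ''b'') 1 (?I (Suc b))"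
      by (rule hoare_cost_NStore) (auto simp: out_inv_def store_def frame_def scratch_def)
    show "bval (NLess (scalar ''b'') (scalar ''m'')) \<sigma> \<longleftrightarrow> b < N ''m''" if "?I b \<sigma>" for \<sigma>
      using that by (auto simp: out_inv_def frame_def scratch_def)
  qed
  then show ?thesis by (rule hoare_cost_conseq) (simp_all add: algebra_simps)
qed

lemma gauss_row_correct:
  "hoare_cost (\<lambda>\<sigma>. out_inv a 0 0 \<sigma> \<and> fst \<sigma> ''c'' 0 0 = 0) gauss_row (1 + N ''d'' * (4 + N ''m'' * 3))
     (\<lambda>\<sigma>. out_inv a (N ''d'') 0 \<sigma> \<and> fst \<sigma> ''c'' 0 0 = N ''d'')"
proof -
  let ?I = "\<lambda>c \<sigma>. out_inv a c 0 \<sigma> \<and> fst \<sigma> ''c'' 0 0 = c"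
  have "hoare_cost (?I 0) gauss_row (1 + N ''d'' * (1 + (1 + ((1 + N ''m'' * 3) + 1)))) (?I (N ''d''))"
    unfolding gauss_row_def
  proof (rule hoare_cost_For, intro hoare_cost_Seq)
    fix c
    show "hoare_cost (?I c) (set_scalar ''b'' (NConst 0)) 1 (\<lambda>\<sigma>. out_inv a c 0 \<sigma> \<and> fst \<sigma> ''c'' 0 0 = c \<and> fst \<sigma> ''b'' 0 0 = 0)"
      by (rule hoare_cost_NStore) (auto simp: out_inv_def store_def frame_def scratch_def)
    show "hoare_cost (\<lambda>\<sigma>. out_inv a c 0 \<sigma> \<and> fst \<sigma> ''c'' 0 0 = c \<and> fst \<sigma> ''b'' 0 0 = 0) gauss_entry (1 + N ''m'' * 3)
     (\<lambda>\<sigma>. out_inv a c (N ''m'') \<sigma> \<and> fst \<sigma> ''c'' 0 0 = c \<and> fst \<sigma> ''b'' 0 0 = N ''m'')"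
      by (rule gauss_entry_correct)
    show "hoare_cost (\<lambda>\<sigma>. out_inv a c (N ''m'') \<sigma> \<and> fst \<sigma> ''c'' 0 0 = c \<and> fst \<sigma> ''b'' 0 0 = N ''m'') (increment ''c'') 1 (?I (Suc c))"
      by (rule hoare_cost_NStore) (auto simp: out_inv_def store_def frame_def scratch_def fun_eq_iff dot_def less_Suc_eq)
    show "bval (NLess (scalar ''c'') (scalar ''d'')) \<sigma> \<longleftrightarrow> c < N ''d''" if "?I c \<sigma>" for \<sigma>
      using that by (auto simp: out_inv_def frame_def scratch_def)
  qed
  then show ?thesis by (rule hoare_cost_conseq) (simp_all add: algebra_simps)
qed

lemma gauss_all_correct:
  "hoare_cost (out_inv 0 0 0) gauss_all (1 + N ''m1'' * (4 + N ''d'' * (4 + N ''m'' * 3))) (out_inv (N ''m1'') 0 0)"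
proof -
  have "hoare_cost (out_inv 0 0 0) gauss_all (1 + N ''m1'' * (1 + (1 + ((1 + N ''d'' * (4 + N ''m'' * 3)) + 1)))) (out_inv (N ''m1'') 0 0)"
    unfolding gauss_all_def
  proof (rule hoare_cost_For, intro hoare_cost_Seq)
    fix a
    show "hoare_cost (out_inv a 0 0) (set_scalar ''c'' (NConst 0)) 1 (\<lambda>\<sigma>. out_inv a 0 0 \<sigma> \<and> fst \<sigma> ''c'' 0 0 = 0)"
      by (rule hoare_cost_NStore) (auto simp: out_inv_def store_def frame_def scratch_def)
    show "hoare_cost (\<lambda>\<sigma>. out_inv a 0 0 \<sigma> \<and> fst \<sigma> ''c'' 0 0 = 0) gauss_row (1 + N ''d'' * (4 + N ''m'' * 3))
     (\<lambda>\<sigma>. out_inv a (N ''d'') 0 \<sigma> \<and> fst \<sigma> ''c'' 0 0 = N ''d'')"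
      by (rule gauss_row_correct)
    show "hoare_cost (\<lambda>\<sigma>. out_inv a (N ''d'') 0 \<sigma> \<and> fst \<sigma> ''c'' 0 0 = N ''d'') (increment ''a'') 1 (out_inv (Suc a) 0 0)"
      by (rule hoare_cost_NStore) (auto simp: out_inv_def store_def frame_def scratch_def fun_eq_iff dot_def less_Suc_eq)
    show "bval (NLess (scalar ''a'') (scalar ''m1'')) \<sigma> \<longleftrightarrow> a < N ''m1''" if "out_inv a 0 0 \<sigma>" for \<sigma>
      using that by (auto simp: out_inv_def frame_def scratch_def)
  qed
  then show ?thesis by (rule hoare_cost_conseq) (simp_all add: algebra_simps)
qed

lemma sketch_prog_correct:
  "\<exists>\<sigma> k. exec sketch_prog (\<mu>, \<rho>) k \<sigma> \<and>
     k \<le> 2 + N ''nnz'' * (5 + Suc (N ''t'') * 5) + N ''m1'' * (4 + N ''d'' * (4 + N ''m'' * 3)) \<and>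
     (\<forall>a<N ''m1''. \<forall>c<N ''d''. snd \<sigma> ''out'' a c = (\<Sum>b<N ''m''. \<rho> ''gauss'' a b * acc_final b c))"
proof -
  have "hoare_cost (acc_inv 0 0) sketch_prog
     ((1 + N ''nnz'' * (5 + Suc (N ''t'') * 5)) + (1 + N ''m1'' * (4 + N ''d'' * (4 + N ''m'' * 3)))) (out_inv (N ''m1'') 0 0)"
    unfolding sketch_prog_def
    by (rule hoare_cost_Seq[OF scatter_correct hoare_cost_conseq[OF gauss_all_correct]])
      (auto simp: acc_inv_def out_inv_def acc_final_def dot_def fun_eq_iff)
  moreover have "acc_inv 0 0 (\<mu>, \<rho>)"
    using acc0 out0 scratch0 by (simp add: acc_inv_def frame_def scratch_def)
  ultimately obtain \<sigma> k where "exec sketch_prog (\<mu>, \<rho>) k \<sigma>"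
    "k \<le> (1 + N ''nnz'' * (5 + Suc (N ''t'') * 5)) + (1 + N ''m1'' * (4 + N ''d'' * (4 + N ''m'' * 3)))"
    "out_inv (N ''m1'') 0 0 \<sigma>"
    unfolding hoare_cost_def by blast
  then show ?thesis by (intro exI[of _ \<sigma>] exI[of _ k]) (auto simp: out_inv_def dot_def)
qed

end

section \<open>Uniform measure on the sphere\<close>

text \<open>The infimum of the points with distribution function at least \<open>1 / 2\<close>
  works: right continuity gives one half, the left limit the other. Existence matters because
  \<open>sphere_median\<close> is an arbitrary choice, of which something is known only if a median
  exists.\<close>

lemma is_median_exists:
  assumes "prob_space M" and X: "X \<in> borel_measurable M"
  shows "\<exists>c. is_median M X c"
proof -
  interpret prob_space M by fact
  interpret D: real_distribution "distr M borel X" using X by simp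
  let ?D = "distr M borel X"
  let ?F = "cdf ?D"
  define S where "S = {x. 1 / 2 \<le> ?F x}"
  have "\<forall>\<^sub>F x in at_top. 1 / 2 < ?F x"
    using D.cdf_lim_at_top_prob by (rule order_tendstoD) simp
  then obtain x1 where "1 / 2 < ?F x1" by (meson eventually_at_top_linorder order_refl)
  then have ne: "S \<noteq> {}" by (auto simp: S_def intro: less_imp_le)
  have "\<forall>\<^sub>F x in at_bot. ?F x < 1 / 2"
    using D.cdf_lim_at_bot by (rule order_tendstoD) simp
  then obtain x0 where "?F x0 < 1 / 2" by (meson eventually_at_bot_linorder order_refl)
  then have "x0 \<le> x" if "x \<in> S" for x
    using that D.cdf_nondecreasing[of x x0] by (force simp: S_def)
  then have bdd: "bdd_below S" by (auto simp: bdd_below_def)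
  define c where "c = Inf S"
  have above: "1 / 2 \<le> ?F x" if cx: "c < x" for x
  proof -
    obtain y where "y \<in> S" "y < x" using cx cInf_less_iff[OF ne bdd] unfolding c_def by blast
    then show ?thesis using D.cdf_nondecreasing[of y x] by (simp add: S_def)
  qed
  have below: "?F x < 1 / 2" if "x < c" for x
    using cInf_lower[OF _ bdd, of x] that by (force simp: S_def c_def)
  have "(?F \<longlongrightarrow> ?F c) (at_right c)"
    using D.cdf_is_right_cont[of c] by (simp add: continuous_within)
  moreover have "\<forall>\<^sub>F x in at_right c. 1 / 2 \<le> ?F x"
    using above by (auto simp: eventually_at_right_field intro!: exI[of _ "c + 1"])
  ultimately have 1: "1 / 2 \<le> ?F c"
    by (intro tendsto_lowerbound[of ?F "?F c" "at_right c"]) auto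
  have 2: "measure ?D {..<c} \<le> 1 / 2"
    using D.cdf_at_left[of c] below
    by (intro tendsto_upperbound[of ?F _ "at_left c"])
      (auto simp: eventually_at_left_field intro!: exI[of _ "c - 1"] less_imp_le)
  have e1: "measure M {\<omega> \<in> space M. X \<omega> \<le> c} = ?F c"
    unfolding cdf_def2 using X by (subst measure_distr) (auto intro!: arg_cong[of _ _ "measure M"])
  have e2: "measure M {\<omega> \<in> space M. X \<omega> < c} = measure ?D {..<c}"
    using X by (subst measure_distr) (auto intro!: arg_cong[of _ _ "measure M"])
  have [measurable]: "X \<in> borel_measurable M" by (rule X)
  have "measure M {\<omega> \<in> space M. X \<omega> \<ge> c} = 1 - measure M {\<omega> \<in> space M. X \<omega> < c}"
    by (subst prob_compl[symmetric]) (auto intro!: arg_cong[of _ _ "measure M"])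
  then show ?thesis using 1 2 e1 e2 unfolding is_median_def by (intro exI[of _ c]) auto
qed

section \<open>Lebesgue volume of balls and of cones over spherical caps\<close>

abbreviation lborel_pow :: "nat \<Rightarrow> (nat \<Rightarrow> real) measure" where
  "lborel_pow k \<equiv> Pi\<^sub>M {..<k} (\<lambda>_. lborel)"

text \<open>The rescaled push-forward agrees with the product measure on boxes, by the
  one-dimensional law, and uniqueness of product measures does the rest.\<close>

lemma emeasure_lborel_pow_affine:
  assumes c: "c > 0" and A: "A \<in> sets (lborel_pow k)"
  shows "emeasure (lborel_pow k) A =
    ennreal c ^ k * emeasure (lborel_pow k) {x \<in> space (lborel_pow k). (\<lambda>i\<in>{..<k}. t i + c * x i) \<in> A}"
proof -
  interpret product_sigma_finite "\<lambda>_::nat. lborel :: real measure"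
    by standard
  let ?P = "lborel_pow k"
  let ?f = "\<lambda>x. \<lambda>i\<in>{..<k}. t i + c * x i"
  have f[measurable]: "?f \<in> ?P \<rightarrow>\<^sub>M ?P"
    by (intro measurable_restrict) measurable
  have "scale_measure (ennreal c ^ k) (distr ?P ?P ?f) = ?P"
  proof (rule PiM_eqI)
    fix A assume A: "\<And>i. i \<in> {..<k} \<Longrightarrow> A i \<in> sets (lborel :: real measure)"
    have PA: "Pi\<^sub>E {..<k} A \<in> sets ?P" using A by (intro sets_PiM_I_finite) auto
    have "emeasure (scale_measure (ennreal c ^ k) (distr ?P ?P ?f)) (Pi\<^sub>E {..<k} A) =
        ennreal c ^ k * emeasure ?P (?f -` Pi\<^sub>E {..<k} A \<inter> space ?P)"
      using PA by (simp add: emeasure_distr)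
    also have "?f -` Pi\<^sub>E {..<k} A \<inter> space ?P = Pi\<^sub>E {..<k} (\<lambda>i. (\<lambda>x. t i + c * x) -` A i)"
      by (auto simp: space_PiM PiE_iff)
    also have "emeasure ?P \<dots> = (\<Prod>i<k. emeasure lborel ((\<lambda>x. t i + c * x) -` A i))"
    proof (rule emeasure_PiM)
      fix i assume i: "i \<in> {..<k}"
      have "(\<lambda>x. t i + c * x) \<in> borel_measurable (borel :: real measure)" by measurable
      from measurable_sets[OF this, of "A i"] A[OF i]
      show "(\<lambda>x. t i + c * x) -` A i \<in> sets lborel" by simp
    qed simp
    also have "ennreal c ^ k * \<dots> = (\<Prod>i<k. ennreal c * emeasure lborel ((\<lambda>x. t i + c * x) -` A i))"
      by (simp add: prod.distrib)
    also have "\<dots> = (\<Prod>i\<in>{..<k}. emeasure lborel (A i))"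
    proof (rule prod.cong[OF refl])
      fix i assume i: "i \<in> {..<k}"
      have Ai: "A i \<in> sets borel" using A[OF i] by simp
      have "emeasure lborel (A i) = emeasure (density (distr lborel borel (\<lambda>x. t i + c * x)) (\<lambda>_. ennreal \<bar>c\<bar>)) (A i)"
        using lborel_real_affine[of c "t i"] c by simp
      also have "\<dots> = ennreal c * emeasure (distr lborel borel (\<lambda>x. t i + c * x)) (A i)"
        using Ai c by (subst emeasure_density_const) auto
      also have "\<dots> = ennreal c * emeasure lborel ((\<lambda>x. t i + c * x) -` A i)"
        using Ai by (subst emeasure_distr) auto
      finally show "ennreal c * emeasure lborel ((\<lambda>x. t i + c * x) -` A i) = emeasure lborel (A i)" ..
    qed
    finally show "emeasure (scale_measure (ennreal c ^ k) (distr ?P ?P ?f)) (Pi\<^sub>E {..<k} A) = (\<Prod>i\<in>{..<k}. emeasure lborel (A i))" .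
  qed simp_all
  then have "emeasure ?P A = emeasure (scale_measure (ennreal c ^ k) (distr ?P ?P ?f)) A" by simp
  also have "\<dots> = ennreal c ^ k * emeasure ?P (?f -` A \<inter> space ?P)"
    using A by (simp add: emeasure_distr)
  also have "?f -` A \<inter> space ?P = {x \<in> space ?P. ?f x \<in> A}" by auto
  finally show ?thesis .
qed

definition unit_ball :: "nat \<Rightarrow> (nat \<Rightarrow> real) set" where
  "unit_ball k = {x \<in> {..<k} \<rightarrow>\<^sub>E UNIV. (\<Sum>i<k. (x i)\<^sup>2) \<le> 1}"

lemma unit_ball_sets [measurable]: "unit_ball k \<in> sets (lborel_pow k)"
proof -
  have "{x \<in> space (lborel_pow k). (\<Sum>i<k. (x i)\<^sup>2) \<le> 1} \<in> sets (lborel_pow k)"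
    by measurable
  then show ?thesis by (simp add: unit_ball_def space_PiM)
qed

text \<open>The ball lies between the cubes of half side \<open>1 / k\<close> and \<open>1\<close>.
  Both facts are used to make the uniform measure on the ball a probability.\<close>

lemma emeasure_unit_ball:
  assumes "k \<ge> 1"
  shows "emeasure (lborel_pow k) (unit_ball k) \<noteq> 0" "emeasure (lborel_pow k) (unit_ball k) \<noteq> \<infinity>"
proof -
  interpret product_sigma_finite "\<lambda>_::nat. lborel :: real measure"
    by standard
  have sub1: "Pi\<^sub>E {..<k} (\<lambda>_. {-1 / real k..1 / real k}) \<subseteq> unit_ball k"
  proof
    fix x assume x: "x \<in> Pi\<^sub>E {..<k} (\<lambda>_. {-1 / real k..1 / real k})"
    have "(\<Sum>i<k. (x i)\<^sup>2) \<le> (\<Sum>i<k. 1 / real k)"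
    proof (rule sum_mono)
      fix i assume "i \<in> {..<k}"
      then have "- (1 / real k) \<le> x i \<and> x i \<le> 1 / real k" using x by (auto simp: PiE_iff)
      then have "\<bar>x i\<bar> \<le> 1 / real k" by linarith
      from power_mono[OF this, of 2] have "(x i)\<^sup>2 \<le> (1 / real k)\<^sup>2" by simp
      also have "\<dots> \<le> 1 / real k" using assms by (simp add: power2_eq_square divide_simps)
      finally show "(x i)\<^sup>2 \<le> 1 / real k" .
    qed
    also have "\<dots> = 1" using assms by simp
    finally show "x \<in> unit_ball k" using x by (auto simp: unit_ball_def PiE_iff)
  qed
  have sub2: "unit_ball k \<subseteq> Pi\<^sub>E {..<k} (\<lambda>_. {-1..1})"
  proof
    fix x assume x: "x \<in> unit_ball k"
    have "\<bar>x i\<bar> \<le> 1" if "i < k" for i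
    proof -
      have "(x i)\<^sup>2 \<le> (\<Sum>i<k. (x i)\<^sup>2)" using that by (intro member_le_sum) auto
      also have "\<dots> \<le> 1" using x by (simp add: unit_ball_def)
      finally show ?thesis by (simp add: abs_square_le_1)
    qed
    then show "x \<in> Pi\<^sub>E {..<k} (\<lambda>_. {-1..1})" using x by (auto simp: unit_ball_def PiE_iff abs_le_iff)
  qed
  have "0 < (\<Prod>i<k. emeasure lborel {-1 / real k..1 / real k})"
    using assms by (simp add: zero_less_iff_neq_zero)
  also have "\<dots> = emeasure (lborel_pow k) (Pi\<^sub>E {..<k} (\<lambda>_. {-1 / real k..1 / real k}))"
    by (subst emeasure_PiM) auto
  also have "\<dots> \<le> emeasure (lborel_pow k) (unit_ball k)"
    by (rule emeasure_mono[OF sub1]) measurable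
  finally show "emeasure (lborel_pow k) (unit_ball k) \<noteq> 0" by simp
  have "emeasure (lborel_pow k) (unit_ball k) \<le> emeasure (lborel_pow k) (Pi\<^sub>E {..<k} (\<lambda>_. {-1..1}))"
    by (rule emeasure_mono[OF sub2]) (intro sets_PiM_I_finite, auto)
  also have "\<dots> = (\<Prod>i<k. emeasure lborel {-1..1::real})"
    by (subst emeasure_PiM) auto
  also have "\<dots> < \<infinity>" by (simp add: ennreal_power flip: ennreal_numeral)
  finally show "emeasure (lborel_pow k) (unit_ball k) \<noteq> \<infinity>" by simp
qed

text \<open>The cone over a spherical cap lies in a ball of radius \<open>sqrt (1 - \<tau>\<^sup>2)\<close> around \<open>\<tau>\<close> times
  the axis of the cap.\<close>

lemma emeasure_cone_le:
  assumes i: "i < k" and \<tau>: "0 < \<tau>" "\<tau>\<^sup>2 \<le> 1 / 2" and s: "s \<in> {-1, 1::real}"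
  shows "emeasure (lborel_pow k) {x \<in> unit_ball k. \<tau> * sqrt (\<Sum>j<k. (x j)\<^sup>2) \<le> s * x i} \<le>
    ennreal (sqrt (1 - \<tau>\<^sup>2)) ^ k * emeasure (lborel_pow k) (unit_ball k)"
proof -
  define \<rho> where "\<rho> = sqrt (1 - \<tau>\<^sup>2)"
  have \<rho>: "\<rho> > 0" "\<rho>\<^sup>2 = 1 - \<tau>\<^sup>2" using \<tau> by (auto simp: \<rho>_def)
  define t where "t j = (if j = i then s * \<tau> else 0)" for j
  define B where "B = {x \<in> space (lborel_pow k). (\<Sum>j<k. (x j - t j)\<^sup>2) \<le> \<rho>\<^sup>2}"
  have B: "B \<in> sets (lborel_pow k)" unfolding B_def by measurable
  have ss: "s * s = 1" using s by auto
  have sub: "{x \<in> unit_ball k. \<tau> * sqrt (\<Sum>j<k. (x j)\<^sup>2) \<le> s * x i} \<subseteq> B"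
  proof
    fix x assume x: "x \<in> {x \<in> unit_ball k. \<tau> * sqrt (\<Sum>j<k. (x j)\<^sup>2) \<le> s * x i}"
    define r where "r = sqrt (\<Sum>j<k. (x j)\<^sup>2)"
    have r: "0 \<le> r" "r\<^sup>2 = (\<Sum>j<k. (x j)\<^sup>2)" "\<tau> * r \<le> s * x i"
      using x by (auto simp: r_def sum_nonneg)
    have r1: "r \<le> 1" using x by (simp add: r_def unit_ball_def)
    have "(\<Sum>j<k. (x j - t j)\<^sup>2) = (\<Sum>j<k. (x j)\<^sup>2 + (if j = i then \<tau>\<^sup>2 - 2 * s * \<tau> * x i else 0))"
    proof (intro sum.cong refl)
      fix j
      have "(x i - s * \<tau>)\<^sup>2 = (x i)\<^sup>2 + (s * s) * \<tau>\<^sup>2 - 2 * s * \<tau> * x i"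
        by (simp add: power2_eq_square algebra_simps)
      then show "(x j - t j)\<^sup>2 = (x j)\<^sup>2 + (if j = i then \<tau>\<^sup>2 - 2 * s * \<tau> * x i else 0)"
        using ss by (simp add: t_def)
    qed
    also have "\<dots> = r\<^sup>2 + \<tau>\<^sup>2 - 2 * \<tau> * (s * x i)" using i r by (simp add: sum.distrib)
    also have "\<dots> \<le> r\<^sup>2 + \<tau>\<^sup>2 - 2 * \<tau> * (\<tau> * r)" using r(3) \<tau> by simp
    also have "\<dots> \<le> 1 - \<tau>\<^sup>2"
    proof -
      \<comment> \<open>Here \<open>\<tau>\<^sup>2 <= 1 / 2\<close> enters: it makes the second
        factor at least \<open>r\<close>, so the bound over the cone is worst at radius one.\<close>
      have "0 \<le> (1 - r) * (1 + r - 2 * \<tau>\<^sup>2)" using r r1 \<tau> by (intro mult_nonneg_nonneg) auto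
      then show ?thesis by (simp add: power2_eq_square algebra_simps)
    qed
    finally show "x \<in> B" using x \<rho> by (simp add: B_def unit_ball_def space_PiM)
  qed
  have "emeasure (lborel_pow k) {x \<in> unit_ball k. \<tau> * sqrt (\<Sum>j<k. (x j)\<^sup>2) \<le> s * x i} \<le> emeasure (lborel_pow k) B"
    by (rule emeasure_mono[OF sub B])
  also have "\<dots> = ennreal \<rho> ^ k * emeasure (lborel_pow k) {x \<in> space (lborel_pow k). (\<lambda>i\<in>{..<k}. t i + \<rho> * x i) \<in> B}"
    by (rule emeasure_lborel_pow_affine[OF \<rho>(1) B])
  also have "{x \<in> space (lborel_pow k). (\<lambda>i\<in>{..<k}. t i + \<rho> * x i) \<in> B} = unit_ball k"
  proof -
    have "(\<Sum>j<k. (\<rho> * x j)\<^sup>2) \<le> \<rho>\<^sup>2 \<longleftrightarrow> (\<Sum>j<k. (x j)\<^sup>2) \<le> 1" for x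
      using \<rho>(1) by (simp add: power_mult_distrib flip: sum_distrib_left)
    then show ?thesis by (auto simp: B_def unit_ball_def space_PiM)
  qed
  finally show ?thesis by (simp add: \<rho>_def)
qed

section \<open>From cone volumes to probabilities on the sphere\<close>

definition direction :: "nat \<Rightarrow> (nat \<Rightarrow> real) \<Rightarrow> nat \<Rightarrow> real" where
  "direction k x = (\<lambda>i\<in>{..<k}. x i / sqrt (\<Sum>j<k. (x j)\<^sup>2))"

lemma direction_measurable [measurable]: "direction k \<in> lborel_pow k \<rightarrow>\<^sub>M Pi\<^sub>M {..<k} (\<lambda>_. borel)"
  unfolding direction_def by (intro measurable_restrict) measurable

lemma sphere_uniform_eq:
  "sphere_uniform k = distr (uniform_measure (lborel_pow k) (unit_ball k)) (Pi\<^sub>M {..<k} (\<lambda>_. borel)) (direction k)"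
  by (simp add: sphere_uniform_def unit_ball_def direction_def [abs_def])

lemma prob_space_sphere_uniform:
  assumes "k \<ge> 1"
  shows "prob_space (sphere_uniform k)"
proof -
  interpret prob_space "uniform_measure (lborel_pow k) (unit_ball k)"
    using emeasure_unit_ball[OF assms] by (rule prob_space_uniform_measure)
  show ?thesis unfolding sphere_uniform_eq
    by (rule prob_space_distr) (simp add: measurable_def[of "uniform_measure _ _"] direction_measurable[unfolded measurable_def, simplified])
qed

lemma emeasure_sphere_uniform:
  assumes "k \<ge> 1" and S: "S \<in> sets (Pi\<^sub>M {..<k} (\<lambda>_. borel))"
  shows "emeasure (sphere_uniform k) S =
    emeasure (lborel_pow k) {x \<in> unit_ball k. direction k x \<in> S} / emeasure (lborel_pow k) (unit_ball k)"
proof -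
  have m: "direction k \<in> uniform_measure (lborel_pow k) (unit_ball k) \<rightarrow>\<^sub>M Pi\<^sub>M {..<k} (\<lambda>_. borel)"
    using direction_measurable by (simp add: measurable_def)
  have d: "direction k -` S \<inter> space (lborel_pow k) \<in> sets (lborel_pow k)"
    using S direction_measurable by (rule measurable_sets[rotated])
  have "unit_ball k \<inter> (direction k -` S \<inter> space (lborel_pow k)) = {x \<in> unit_ball k. direction k x \<in> S}"
    using sets.sets_into_space[OF unit_ball_sets] by auto
  then show ?thesis
    unfolding sphere_uniform_eq using S d by (subst emeasure_distr[OF m S]) simp
qed

text \<open>Union bound over \<open>2 k\<close> caps, one for each coordinate and sign; the
  probability of a cap is the volume of its cone relative to the ball.\<close>

lemma prob_sphere_coord_ge:
  assumes k: "k \<ge> 1" and \<tau>: "0 < \<tau>" "\<tau>\<^sup>2 \<le> 1 / 2"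
  shows "measure (sphere_uniform k) {x \<in> space (sphere_uniform k). \<exists>i<k. \<tau> \<le> \<bar>x i\<bar>} \<le> 2 * real k * sqrt (1 - \<tau>\<^sup>2) ^ k"
proof -
  interpret prob_space "sphere_uniform k" using k by (rule prob_space_sphere_uniform)
  let ?B = "unit_ball k"
  let ?P = "lborel_pow k"
  let ?n = "\<lambda>x. sqrt (\<Sum>j<k. (x j)\<^sup>2)"
  have sp: "space (sphere_uniform k) = {..<k} \<rightarrow>\<^sub>E UNIV" by (simp add: sphere_uniform_eq space_PiM)
  have "{x \<in> space (Pi\<^sub>M {..<k} (\<lambda>_. borel :: real measure)). \<exists>i\<in>{..<k}. \<tau> \<le> \<bar>x i\<bar>} \<in> sets (Pi\<^sub>M {..<k} (\<lambda>_. borel))"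
    by measurable
  then have S: "{x \<in> space (sphere_uniform k). \<exists>i<k. \<tau> \<le> \<bar>x i\<bar>} \<in> sets (Pi\<^sub>M {..<k} (\<lambda>_. borel))"
    by (simp add: sp space_PiM Bex_def)
  define C where "C i s = {x \<in> ?B. \<tau> * ?n x \<le> s * x i}" for i and s :: real
  have Cs: "C i s \<in> sets ?P" if "i < k" for i s
  proof -
    have "(\<lambda>x. x i) \<in> borel_measurable ?P"
      using that measurable_component_singleton[of i "{..<k}" "\<lambda>_. lborel"] by simp
    then have m1: "(\<lambda>x. s * x i) \<in> borel_measurable ?P" by (rule borel_measurable_times[OF borel_measurable_const])
    have m2: "(\<lambda>x. \<tau> * ?n x) \<in> borel_measurable ?P" by measurable
    have "{x \<in> space ?P. \<tau> * ?n x \<le> s * x i} \<in> sets ?P"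
      by (rule borel_measurable_le[OF m2 m1])
    then have "?B \<inter> {x \<in> space ?P. \<tau> * ?n x \<le> s * x i} \<in> sets ?P" by (intro sets.Int unit_ball_sets)
    moreover have "?B \<inter> {x \<in> space ?P. \<tau> * ?n x \<le> s * x i} = C i s"
      using sets.sets_into_space[OF unit_ball_sets[of k]] by (auto simp: C_def)
    ultimately show ?thesis by simp
  qed
  have "{x \<in> ?B. direction k x \<in> {x \<in> space (sphere_uniform k). \<exists>i<k. \<tau> \<le> \<bar>x i\<bar>}} \<subseteq> (\<Union>i\<in>{..<k}. \<Union>s\<in>{-1, 1}. C i s)"
  proof
    fix x assume "x \<in> {x \<in> ?B. direction k x \<in> {x \<in> space (sphere_uniform k). \<exists>i<k. \<tau> \<le> \<bar>x i\<bar>}}"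
    then obtain i where i: "i < k" "\<tau> \<le> \<bar>x i / ?n x\<bar>" and xB: "x \<in> ?B" by (auto simp: direction_def)
    \<comment> \<open>The direction of the origin is zero by the convention for division by zero, so
      the origin meets no cap.\<close>
    have "?n x \<noteq> 0" using i \<tau> by auto
    then have "?n x > 0" by (simp add: sum_nonneg order.strict_iff_order)
    then have "\<tau> * ?n x \<le> \<bar>x i\<bar>" using i(2) by (simp add: abs_divide pos_le_divide_eq)
    then have "\<tau> * ?n x \<le> 1 * x i \<or> \<tau> * ?n x \<le> (-1) * x i" by (auto simp: abs_if split: if_splits)
    then show "x \<in> (\<Union>i\<in>{..<k}. \<Union>s\<in>{-1, 1}. C i s)" using i(1) xB by (auto simp: C_def)
  qed
  then have "emeasure ?P {x \<in> ?B. direction k x \<in> {x \<in> space (sphere_uniform k). \<exists>i<k. \<tau> \<le> \<bar>x i\<bar>}} \<le>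
      emeasure ?P (\<Union>i\<in>{..<k}. \<Union>s\<in>{-1, 1}. C i s)"
    using Cs by (intro emeasure_mono) auto
  also have "\<dots> \<le> (\<Sum>i<k. emeasure ?P (\<Union>s\<in>{-1, 1}. C i s))"
    using Cs by (intro emeasure_subadditive_finite) auto
  also have "\<dots> \<le> (\<Sum>i<k. \<Sum>s\<in>{-1, 1}. emeasure ?P (C i s))"
    using Cs by (intro sum_mono emeasure_subadditive_finite) auto
  also have "\<dots> \<le> (\<Sum>i<k. \<Sum>s\<in>{-1, 1::real}. ennreal (sqrt (1 - \<tau>\<^sup>2)) ^ k * emeasure ?P ?B)"
    unfolding C_def using \<tau> by (intro sum_mono emeasure_cone_le) auto
  also have "\<dots> = ennreal (2 * real k * sqrt (1 - \<tau>\<^sup>2) ^ k) * emeasure ?P ?B"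
    using \<tau> by (simp add: ennreal_mult ennreal_power ennreal_of_nat_eq_real_of_nat mult_ac)
  finally have "emeasure (sphere_uniform k) {x \<in> space (sphere_uniform k). \<exists>i<k. \<tau> \<le> \<bar>x i\<bar>} \<le>
      ennreal (2 * real k * sqrt (1 - \<tau>\<^sup>2) ^ k) * emeasure ?P ?B / emeasure ?P ?B"
    unfolding emeasure_sphere_uniform[OF k S] by (rule divide_right_mono_ennreal)
  also have "\<dots> = ennreal (2 * real k * sqrt (1 - \<tau>\<^sup>2) ^ k)"
    using emeasure_unit_ball[OF k] by (simp add: ennreal_mult_divide_eq)
  finally show ?thesis using \<tau> by (simp add: emeasure_eq_measure)
qed

text \<open>Only the origin has a direction that is not a unit vector, and a single point is null
  because \<open>k >= 1\<close>.\<close>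

lemma sphere_uniform_AE:
  assumes k: "k \<ge> 1"
  shows "AE x in sphere_uniform k. (\<Sum>i<k. (x i)\<^sup>2) = 1"
proof -
  interpret product_sigma_finite "\<lambda>_::nat. lborel :: real measure"
    by standard
  let ?U = "uniform_measure (lborel_pow k) (unit_ball k)"
  have m: "direction k \<in> ?U \<rightarrow>\<^sub>M Pi\<^sub>M {..<k} (\<lambda>_. borel)"
    using direction_measurable by (simp add: measurable_def)
  have eq: "{\<lambda>i\<in>{..<k}. 0::real} = Pi\<^sub>E {..<k} (\<lambda>_. {0})"
    by (auto simp: PiE_iff extensional_def fun_eq_iff)
  then have "emeasure (lborel_pow k) {\<lambda>i\<in>{..<k}. 0} = (\<Prod>i<k. emeasure lborel {0::real})"
    by (simp only:) (subst emeasure_PiM, auto)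
  also have "\<dots> = 0" using k by simp
  finally have 0: "emeasure (lborel_pow k) {\<lambda>i\<in>{..<k}. 0} = 0" .
  have "{\<lambda>i\<in>{..<k}. 0} \<in> sets (lborel_pow k)"
    unfolding eq by (rule sets_PiM_I_finite) auto
  with 0 have null: "{\<lambda>i\<in>{..<k}. 0} \<in> null_sets (lborel_pow k)"
    by (rule null_setsI)
  have "AE x in lborel_pow k. (\<Sum>i<k. (direction k x i)\<^sup>2) = 1"
    using AE_not_in[OF null] AE_space
  proof eventually_elim
    case (elim x)
    have "(\<Sum>j<k. (x j)\<^sup>2) \<noteq> 0"
    proof
      assume "(\<Sum>j<k. (x j)\<^sup>2) = 0"
      then have "\<forall>j<k. x j = 0" by (simp add: sum_nonneg_eq_0_iff)
      then have "x = (\<lambda>i\<in>{..<k}. 0)" using elim(2) by (auto simp: space_PiM PiE_iff extensional_def fun_eq_iff)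
      then show False using elim(1) by simp
    qed
    moreover have "(\<Sum>j<k. (x j)\<^sup>2) \<ge> 0" by (simp add: sum_nonneg)
    ultimately show ?case by (simp add: direction_def power_divide flip: sum_divide_distrib)
  qed
  then have "AE x in ?U. (\<Sum>i<k. (direction k x i)\<^sup>2) = 1"
    by (intro AE_uniform_measureI) auto
  then show ?thesis unfolding sphere_uniform_eq
    by (subst AE_distr_iff[OF m]) measurable
qed

section \<open>The median of a symmetric norm on the sphere\<close>

context sym_norm
begin

text \<open>Lipschitz continuity in finitely many coordinates, read in the product topology. It
  makes \<open>L\<close> measurable here and the distortion event measurable later.\<close>

lemma continuous: "continuous_on UNIV L"
proof -
  have "isCont L x" for x
  proof -
    have "((\<lambda>y. L y) \<longlongrightarrow> L x) (at x)"
    proof (rule Lim_null_comparison[of "\<lambda>y. L y - L x" "\<lambda>y. (\<Sum>j<n. \<bar>y j - x j\<bar>) * W 1", THEN LIM_zero_cancel])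
      have diff: "\<bar>L y - L x\<bar> \<le> L (\<lambda>i. y i - x i)" for y
      proof -
        have "L y \<le> L x + L (\<lambda>i. y i - x i)" using triangle[of x "\<lambda>i. y i - x i"] by simp
        moreover have "L x \<le> L y + L (\<lambda>i. x i - y i)" using triangle[of y "\<lambda>i. x i - y i"] by simp
        moreover have "L (\<lambda>i. x i - y i) = L (\<lambda>i. y i - x i)" using minus[of "\<lambda>i. y i - x i"] by simp
        ultimately show ?thesis by linarith
      qed
      show "\<forall>\<^sub>F y in at x. norm (L y - L x) \<le> (\<Sum>j<n. \<bar>y j - x j\<bar>) * W 1"
        using order_trans[OF diff le_sum_abs] by (intro always_eventually allI) simp
      have "((\<lambda>y. (\<Sum>j<n. \<bar>y j - x j\<bar>) * W 1) \<longlongrightarrow> (\<Sum>j<n. \<bar>x j - x j\<bar>) * W 1) (at x)"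
      proof (intro tendsto_intros)
        fix j
        have "continuous_on UNIV (\<lambda>y::nat \<Rightarrow> real. y j)" by simp
        then have "isCont (\<lambda>y. y j) x" using continuous_on_eq_continuous_at[OF open_UNIV] by blast
        then show "((\<lambda>y. y j) \<longlongrightarrow> x j) (at x)" by (simp add: isCont_def)
      qed
      then show "((\<lambda>y. (\<Sum>j<n. \<bar>y j - x j\<bar>) * W 1) \<longlongrightarrow> 0) (at x)" by simp
    qed
    then show ?thesis by (simp add: isCont_def)
  qed
  then show ?thesis by (simp add: continuous_at_imp_continuous_on)
qed

lemma borel_measurable_L:
  assumes "\<And>i. i < n \<Longrightarrow> (\<lambda>\<omega>. f \<omega> i) \<in> borel_measurable M"
  shows "(\<lambda>\<omega>. L (f \<omega>)) \<in> borel_measurable M"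
proof -
  have "(\<lambda>\<omega>. (\<lambda>i. if i < n then f \<omega> i else 0)) \<in> borel_measurable M"
  proof (rule measurable_coordinatewise_then_product)
    fix i show "(\<lambda>\<omega>. if i < n then f \<omega> i else 0) \<in> borel_measurable M"
      using assms by (cases "i < n") auto
  qed
  then have "(\<lambda>\<omega>. L (\<lambda>i. if i < n then f \<omega> i else 0)) \<in> borel_measurable M"
    using borel_measurable_continuous_onI[OF continuous] measurable_compose by fast
  moreover have "(\<lambda>\<omega>. L (\<lambda>i. if i < n then f \<omega> i else 0)) = (\<lambda>\<omega>. L (f \<omega>))"
    by (intro ext cong) simp
  ultimately show ?thesis by simp
qed

definition pad :: "nat \<Rightarrow> (nat \<Rightarrow> real) \<Rightarrow> nat \<Rightarrow> real" where
  "pad k x = (\<lambda>i. if i < k then x i else 0)"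

lemma pad_le_W:
  assumes "\<And>i. i < k \<Longrightarrow> \<bar>x i\<bar> \<le> a" "0 \<le> a"
  shows "L (pad k x) \<le> a * W k"
proof -
  have "L (pad k x) \<le> L (\<lambda>i. a * (if i < k then 1 else 0))"
    using assms by (intro mono) (auto simp: pad_def)
  also have "\<dots> = a * W k" using assms(2) by (simp add: scale W_def)
  finally show ?thesis .
qed

lemma unit_coord_le_1:
  fixes x :: "nat \<Rightarrow> real"
  assumes "(\<Sum>i<k. (x i)\<^sup>2) = (1::real)" "i < k"
  shows "\<bar>x i\<bar> \<le> 1"
proof -
  have "(x i)\<^sup>2 \<le> (\<Sum>i<k. (x i)\<^sup>2)" using assms(2) by (intro member_le_sum[of i "{..<k}" "\<lambda>i. (x i)\<^sup>2"]) auto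
  then show ?thesis using assms(1) by (simp add: abs_square_le_1)
qed

lemma pad_pos:
  assumes "(\<Sum>i<k. (x i)\<^sup>2) = 1" "k \<le> n"
  shows "L (pad k x) > 0"
proof -
  have "L (pad k x) \<noteq> 0"
  proof
    assume "L (pad k x) = 0"
    then have "\<forall>i<k. x i = 0" using assms(2) by (auto simp: zero_iff pad_def dest: order.strict_trans2)
    then show False using assms(1) by simp
  qed
  then show ?thesis using nonneg[of "pad k x"] by simp
qed

text \<open>Upper bound: with probability above \<open>1 / 2\<close> all coordinates of a random
  unit vector are below a multiple of \<open>sqrt (ln k / k)\<close>, and then monotonicity compares
  it with a flat vector. Positivity: \<open>L\<close> does not vanish on the sphere.\<close>

lemma median_bounds:
  assumes k: "1 \<le> k" "k \<le> n" and c: "is_median (sphere_uniform k) (\<lambda>x. L (pad k x)) c"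
  shows "0 < c" "c\<^sup>2 \<le> 4 * ln (8 * real k) / real k * (W k)\<^sup>2"
proof -
  let ?M = "sphere_uniform k"
  let ?X = "\<lambda>x. L (pad k x)"
  interpret prob_space ?M using k by (intro prob_space_sphere_uniform)
  have st: "sets ?M = sets (Pi\<^sub>M {..<k} (\<lambda>_. borel :: real measure))" by (simp add: sphere_uniform_eq)
  have comp: "(\<lambda>x. x i) \<in> borel_measurable ?M" if "i < k" for i
    using that measurable_component_singleton[of i "{..<k}" "\<lambda>_. borel"]
    by (simp cong: measurable_cong_sets add: measurable_cong_sets[OF st refl])
  have X[measurable]: "?X \<in> borel_measurable ?M"
  proof (rule borel_measurable_L)
    fix i show "(\<lambda>x. pad k x i) \<in> borel_measurable ?M"
      using comp by (cases "i < k") (auto simp: pad_def)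
  qed
  have med: "measure ?M {x \<in> space ?M. ?X x \<le> c} \<ge> 1 / 2" "measure ?M {x \<in> space ?M. ?X x \<ge> c} \<ge> 1 / 2"
    using c by (auto simp: is_median_def)
  have AE1: "AE x in ?M. (\<Sum>i<k. (x i)\<^sup>2) = 1" using k by (intro sphere_uniform_AE)
  show cpos: "0 < c"
  proof (rule ccontr)
    assume "\<not> 0 < c"
    have "AE x in ?M. \<not> ?X x \<le> c"
      using AE1 by eventually_elim (use pad_pos[OF _ k(2)] \<open>\<not> 0 < c\<close> in fastforce)
    then have "measure ?M {x \<in> space ?M. ?X x \<le> c} = 0"
      by (subst prob_eq_0) auto
    then show False using med(1) by simp
  qed
  \<comment> \<open>Chosen so that \<open>2 * k * exp (- a * k / 2)\<close> equals
    \<open>1 / 4\<close>, below the \<open>1 / 2\<close> that a median requires.\<close>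
  define a where "a = 2 * ln (8 * real k) / real k"
  have lnpos: "ln (8 * real k) > 0" using k by simp
  have apos: "a > 0" using lnpos k by (simp add: a_def)
  have "c \<le> sqrt (2 * a) * W k"
  proof (rule ccontr)
    assume "\<not> c \<le> sqrt (2 * a) * W k"
    then have big: "sqrt (2 * a) * W k < c" by simp
    show False
    proof (cases "a \<le> 1 / 2")
      case True
      let ?\<tau> = "sqrt a"
      have "?\<tau> * W k \<le> sqrt (2 * a) * W k" using W_nonneg apos by (intro mult_right_mono) auto
      then have bg: "?\<tau> * W k < c" using big by simp
      have "{x \<in> space ?M. ?X x \<ge> c} \<subseteq> {x \<in> space ?M. \<exists>i<k. ?\<tau> \<le> \<bar>x i\<bar>}"
      proof (intro Collect_mono impI, elim conjE, intro conjI)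
        fix x assume x: "c \<le> ?X x"
        show "\<exists>i<k. ?\<tau> \<le> \<bar>x i\<bar>"
        proof (rule ccontr)
          assume "\<not> (\<exists>i<k. ?\<tau> \<le> \<bar>x i\<bar>)"
          then have "?X x \<le> ?\<tau> * W k" using apos by (intro pad_le_W) auto
          then show False using x bg by simp
        qed
      qed
      moreover have "{x \<in> space ?M. \<exists>i\<in>{..<k}. ?\<tau> \<le> \<bar>x i\<bar>} \<in> sets ?M"
        using comp by (intro sets.sets_Collect_finite_Ex borel_measurable_le) auto
      then have "{x \<in> space ?M. \<exists>i<k. ?\<tau> \<le> \<bar>x i\<bar>} \<in> sets ?M" by (simp only: Bex_def lessThan_iff)
      ultimately have "measure ?M {x \<in> space ?M. ?X x \<ge> c} \<le> measure ?M {x \<in> space ?M. \<exists>i<k. ?\<tau> \<le> \<bar>x i\<bar>}"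
        by (intro finite_measure_mono)
      also have "\<dots> \<le> 2 * real k * sqrt (1 - ?\<tau>\<^sup>2) ^ k"
        using k apos True by (intro prob_sphere_coord_ge) auto
      also have "sqrt (1 - ?\<tau>\<^sup>2) ^ k \<le> 1 / (8 * real k)"
      proof -
        have "exp (- a / 2) ^ 2 = exp (of_nat 2 * (- a / 2))" by (rule exp_of_nat_mult [symmetric])
        then have "1 - ?\<tau>\<^sup>2 \<le> exp (- a / 2) ^ 2" using apos exp_ge_add_one_self[of "-a"] by simp
        then have "sqrt (1 - ?\<tau>\<^sup>2) \<le> exp (- a / 2)" by (intro real_le_lsqrt) auto
        then have "sqrt (1 - ?\<tau>\<^sup>2) ^ k \<le> exp (- a / 2) ^ k" using True apos by (intro power_mono) auto
        also have "\<dots> = exp (of_nat k * (- a / 2))" by (rule exp_of_nat_mult [symmetric])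
        also have "of_nat k * (- a / 2) = - ln (8 * real k)" using k by (simp add: a_def)
        also have "exp (- ln (8 * real k)) = 1 / (8 * real k)" using k by (simp add: exp_minus divide_simps)
        finally show ?thesis .
      qed
      then have "2 * real k * sqrt (1 - ?\<tau>\<^sup>2) ^ k \<le> 2 * real k * (1 / (8 * real k))"
        by (intro mult_left_mono) auto
      also have "\<dots> = 1 / 4" using k by simp
      finally show False using med(2) by simp
    next
      case False
      \<comment> \<open>The cap estimate does not apply here, but now \<open>2 * a > 1\<close>, so
        the trivial bound \<open>1\<close> on the coordinates of a unit vector is good enough. This
        is why the claim has \<open>2 * a\<close> under the root and not \<open>a\<close>.\<close>
      have "AE x in ?M. \<not> ?X x \<ge> c"
        using AE1
      proof eventually_elim
        case (elim x)
        have "?X x \<le> 1 * W k" by (intro pad_le_W unit_coord_le_1[OF elim]) auto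
        also have "1 * W k \<le> sqrt (2 * a) * W k" using False W_nonneg by (intro mult_right_mono) auto
        finally show ?case using big by simp
      qed
      then have "measure ?M {x \<in> space ?M. ?X x \<ge> c} = 0" by (subst prob_eq_0) auto
      then show False using med(2) by simp
    qed
  qed
  then have "c\<^sup>2 \<le> (sqrt (2 * a) * W k)\<^sup>2" using cpos by (intro power_mono) auto
  also have "\<dots> = 4 * ln (8 * real k) / real k * (W k)\<^sup>2" using apos by (simp add: power_mult_distrib a_def)
  finally show "c\<^sup>2 \<le> 4 * ln (8 * real k) / real k * (W k)\<^sup>2" .
qed

end

text \<open>\<open>mmc\<close> is tested on the unit vector with \<open>s\<close> equal coordinates
  in dimension \<open>k\<close>: its norm \<open>W s / sqrt s\<close> is at most \<open>mmc\<close>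
  times the median, and \<open>median_bounds\<close> compares the median with
  \<open>W k / sqrt k\<close>.\<close>

lemma W_le_mmc:
  fixes n :: nat and l :: "real vec \<Rightarrow> real"
  assumes S: "symmetric_norm n l" and sk: "1 \<le> s" "s \<le> k" "k \<le> n"
  shows "(sym_norm.W (\<lambda>x. l (vec n x)) s)\<^sup>2 / real s \<le>
      (mmc n l)\<^sup>2 * (4 * ln (8 * real k) / real k * (sym_norm.W (\<lambda>x. l (vec n x)) k)\<^sup>2)"
    and "mmc n l > 0"
proof -
  interpret sym_norm n "\<lambda>x. l (vec n x)"
    using S sk by (intro symmetric_norm_sym_norm) auto
  let ?L = "\<lambda>x. l (vec n x)"
  have pv: "l (pad_vec n k x) = ?L (pad k x)" for k x
    by (simp add: pad_vec_def pad_def)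
  have med: "is_median (sphere_uniform k) (\<lambda>x. ?L (pad k x)) (sphere_median n l k)" if "1 \<le> k" "k \<le> n" for k
  proof -
    have st: "sets (sphere_uniform k) = sets (Pi\<^sub>M {..<k} (\<lambda>_. borel :: real measure))" by (simp add: sphere_uniform_eq)
    have comp: "(\<lambda>x. x i) \<in> borel_measurable (sphere_uniform k)" if "i < k" for i
      using that measurable_component_singleton[of i "{..<k}" "\<lambda>_. borel"]
      by (simp add: measurable_cong_sets[OF st refl])
    have "(\<lambda>x. ?L (pad k x)) \<in> borel_measurable (sphere_uniform k)"
    proof (rule borel_measurable_L)
      fix i show "(\<lambda>x. pad k x i) \<in> borel_measurable (sphere_uniform k)"
        using comp by (cases "i < k") (auto simp: pad_def)
    qed
    then have "\<exists>c. is_median (sphere_uniform k) (\<lambda>x. ?L (pad k x)) c"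
      using that by (intro is_median_exists prob_space_sphere_uniform) auto
    then show ?thesis unfolding sphere_median_def pv by (rule someI_ex)
  qed
  let ?m = "sphere_median n l k"
  have k1: "1 \<le> k" using sk by simp
  note mb = median_bounds[OF k1 sk(3) med[OF k1 sk(3)]]
  have ratio: "?L (pad k x) / ?m \<le> mmc n l" if x: "x \<in> unit_sphere k" for x
  proof -
    \<comment> \<open>Without boundedness the real supremum inside \<open>mmc\<close> would say
      nothing about its members.\<close>
    have "bdd_above ((\<lambda>x. ?L (pad k x) / ?m) ` unit_sphere k)"
    proof (rule bdd_aboveI2)
      fix x assume "x \<in> unit_sphere k"
      then have "?L (pad k x) \<le> 1 * W k"
        by (intro pad_le_W unit_coord_le_1[where k = k]) (auto simp: unit_sphere_def)
      then show "?L (pad k x) / ?m \<le> W k / ?m" using mb(1) by (simp add: divide_right_mono)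
    qed
    then have "?L (pad k x) / ?m \<le> (SUP x\<in>unit_sphere k. l (pad_vec n k x) / ?m)"
      unfolding pv using x by (rule cSUP_upper2[rotated 2, OF order_refl])
    also have "\<dots> \<le> mmc n l" unfolding mmc_def using sk by (intro Max_ge) auto
    finally show ?thesis .
  qed
  define x where "x = (\<lambda>i\<in>{..<k}. if i < s then 1 / sqrt (real s) else 0)"
  have "(\<Sum>i<k. (x i)\<^sup>2) = (\<Sum>i<k. if i < s then 1 / real s else 0)"
    unfolding x_def by (intro sum.cong) (auto simp: power_divide)
  also have "\<dots> = (\<Sum>i<s. 1 / real s)" using sk by (intro sum.mono_neutral_cong_right) auto
  also have "\<dots> = 1" using sk by simp
  finally have xs: "x \<in> unit_sphere k" by (simp add: unit_sphere_def x_def)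
  have "?L (pad k x) = ?L (\<lambda>i. (1 / sqrt (real s)) * (if i < s then 1 else 0))"
    using sk by (intro cong) (auto simp: pad_def x_def)
  also have "\<dots> = W s / sqrt (real s)" unfolding scale by (simp add: W_def)
  finally have Lx: "?L (pad k x) = W s / sqrt (real s)" .
  have Wpos: "W s > 0" using sk by (intro W_pos)
  have 1: "W s / sqrt (real s) \<le> mmc n l * ?m"
    using ratio[OF xs] unfolding Lx pos_divide_le_eq[OF mb(1)] .
  have "0 < W s / sqrt (real s)" using Wpos sk by simp
  then have "0 < mmc n l * ?m" using 1 by linarith
  then show "mmc n l > 0" using mb(1) by (simp add: zero_less_mult_iff)
  have "(W s)\<^sup>2 / real s = (W s / sqrt (real s))\<^sup>2" by (simp add: power_divide)
  also have "\<dots> \<le> (mmc n l * ?m)\<^sup>2" using 1 Wpos by (intro power_mono) auto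
  also have "\<dots> \<le> (mmc n l)\<^sup>2 * (4 * ln (8 * real k) / real k * (W k)\<^sup>2)"
    unfolding power_mult_distrib by (intro mult_left_mono mb(2)) auto
  finally show "(W s)\<^sup>2 / real s \<le> (mmc n l)\<^sup>2 * (4 * ln (8 * real k) / real k * (W k)\<^sup>2)" .
qed

section \<open>CountSketch\<close>

lemma pmf_markov:
  assumes "(\<integral>\<^sup>+x. ennreal (f x) \<partial>measure_pmf p) \<le> ennreal B" "B \<ge> 0" "c > 0"
  shows "measure_pmf.prob p {x. c \<le> f x} \<le> B / c"
proof -
  have "{x. c \<le> f x} = {x \<in> UNIV. 1 \<le> ennreal (1 / c) * ennreal (f x)}"
  proof (intro Collect_eqI iffI)
    fix x
    show "x \<in> UNIV \<and> 1 \<le> ennreal (1 / c) * ennreal (f x)" if "c \<le> f x"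
      using that assms(3) by (simp add: ennreal_mult'[symmetric])
    assume "x \<in> UNIV \<and> 1 \<le> ennreal (1 / c) * ennreal (f x)"
    then have "1 \<le> ennreal (f x / c)" using assms(3) by (simp add: ennreal_mult'[symmetric])
    then have "1 \<le> f x / c" by (simp add: ennreal_le_iff2 flip: ennreal_1)
    then show "c \<le> f x" using assms(3) by simp
  qed
  then have "emeasure (measure_pmf p) {x. c \<le> f x} \<le>
      ennreal (1 / c) * (\<integral>\<^sup>+x. ennreal (f x) * indicator UNIV x \<partial>measure_pmf p)"
    by (simp only:) (rule nn_integral_Markov_inequality, auto)
  also have "\<dots> \<le> ennreal (1 / c) * ennreal B"
    using assms(1) by (intro mult_left_mono) auto
  also have "\<dots> = ennreal (B / c)" using assms by (simp add: ennreal_mult'[symmetric])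
  finally show ?thesis using assms by (simp add: measure_pmf.emeasure_eq_measure)
qed

section \<open>Moments of products of random signs\<close>

definition rademacher :: "nat \<Rightarrow> (nat \<Rightarrow> real) pmf" where
  "rademacher N = Pi_pmf {..<N} 1 (\<lambda>_. pmf_of_set {-1, 1})"

lemma finite_set_rademacher: "finite (set_pmf (rademacher N))"
  unfolding rademacher_def by (subst set_Pi_pmf) (auto intro!: finite_PiE_dflt)

text \<open>The default value \<open>1\<close> outside \<open>{..<N}\<close> makes every coordinate
  a sign, also those beyond \<open>N\<close>.\<close>

lemma set_rademacher: "s \<in> set_pmf (rademacher N) \<Longrightarrow> s j = 1 \<or> s j = -1"
  unfolding rademacher_def by (cases "j < N") (auto simp: set_Pi_pmf PiE_dflt_def)

text \<open>By independence: odd powers of a sign average to zero, even powers are constantly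
  one.\<close>

lemma expectation_rademacher_monomial:
  "measure_pmf.expectation (rademacher N) (\<lambda>s. \<Prod>j<N. s j ^ e j) = (\<Prod>j<N. of_bool (even (e j)))"
proof -
  let ?p = "rademacher N"
  have "prob_space.indep_vars (measure_pmf (rademacher N)) (\<lambda>_. borel) (\<lambda>j s. (\<lambda>x. x ^ e j) (s j)) {..<N}"
    unfolding rademacher_def
    by (rule prob_space.indep_vars_compose2[OF measure_pmf.prob_space_axioms indep_vars_Pi_pmf]) auto
  then have "measure_pmf.expectation ?p (\<lambda>s. \<Prod>j<N. s j ^ e j) = (\<Prod>j<N. measure_pmf.expectation ?p (\<lambda>s. s j ^ e j))"
    by (intro prob_space.indep_vars_lebesgue_integral measure_pmf.prob_space_axioms)
      (auto intro!: integrable_measure_pmf_finite finite_set_rademacher)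
  also have "\<dots> = (\<Prod>j<N. of_bool (even (e j)))"
  proof (rule prod.cong[OF refl])
    fix j assume j: "j \<in> {..<N}"
    have "measure_pmf.expectation ?p (\<lambda>s. s j ^ e j) = measure_pmf.expectation (map_pmf (\<lambda>s. s j) ?p) (\<lambda>x. x ^ e j)"
      by simp
    also have "map_pmf (\<lambda>s. s j) ?p = pmf_of_set {-1, 1}"
      using j unfolding rademacher_def by (subst Pi_pmf_component) auto
    also have "measure_pmf.expectation (pmf_of_set {-1, 1::real}) (\<lambda>x. x ^ e j) = of_bool (even (e j))"
      by (subst integral_pmf_of_set) auto
    finally show "measure_pmf.expectation ?p (\<lambda>s. s j ^ e j) = of_bool (even (e j))" .
  qed
  finally show ?thesis .
qed

text \<open>The terms for \<open>(j, k)\<close> and \<open>(k, j)\<close> carry the same product of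
  signs; merging them leaves products that are pairwise uncorrelated.\<close>

definition ordered_pairs :: "nat \<Rightarrow> (nat \<times> nat) set" where
  "ordered_pairs N = {(j, k). j < k \<and> k < N}"

lemma ordered_pairs_disjoint:
  "ordered_pairs N \<inter> prod.swap ` ordered_pairs N = {}"
  "(\<lambda>j. (j, j)) ` {..<N} \<inter> (ordered_pairs N \<union> prod.swap ` ordered_pairs N) = {}"
  by (auto simp: ordered_pairs_def)

lemma finite_ordered_pairs [simp]: "finite (ordered_pairs N)"
  by (rule finite_subset[of _ "{..<N} \<times> {..<N}"]) (auto simp: ordered_pairs_def)

lemma expectation_rademacher_pairs:
  assumes "p \<in> ordered_pairs N" "q \<in> ordered_pairs N"
  shows "measure_pmf.expectation (rademacher N) (\<lambda>s. (s (fst p) * s (snd p)) * (s (fst q) * s (snd q))) = of_bool (p = q)"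
proof -
  obtain a b c d where pq: "p = (a, b)" "q = (c, d)" by (metis surj_pair)
  then have ab: "a < b" "b < N" "c < d" "d < N" using assms by (auto simp: ordered_pairs_def)
  define e :: "nat \<Rightarrow> nat" where "e j = of_bool (j = a) + of_bool (j = b) + of_bool (j = c) + of_bool (j = d)" for j
  have single: "(\<Prod>j<N. s j ^ of_bool (j = i)) = s i" if "i < N" for i and s :: "nat \<Rightarrow> real"
  proof -
    have "(\<Prod>j<N. s j ^ of_bool (j = i)) = (\<Prod>j<N. if j = i then s j else 1)"
      by (intro prod.cong) auto
    then show ?thesis using that by simp
  qed
  have "(s a * s b) * (s c * s d) = (\<Prod>j<N. s j ^ e j)" for s :: "nat \<Rightarrow> real"
    using ab by (simp add: e_def power_add prod.distrib single)
  then have "measure_pmf.expectation (rademacher N) (\<lambda>s. (s a * s b) * (s c * s d)) = (\<Prod>j<N. of_bool (even (e j)))"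
    by (simp only: expectation_rademacher_monomial)
  also have "\<dots> = of_bool (p = q)"
  proof (cases "p = q")
    case True
    then have "even (e j)" for j by (auto simp: pq e_def)
    then show ?thesis using True by simp
  next
    case False
    obtain j where "j < N" "odd (e j)"
    \<comment> \<open>An index occurring once has odd exponent. If the distinct pairs share
      \<open>a\<close>, then \<open>b\<close> occurs once; otherwise \<open>a\<close> does.\<close>
    proof (cases "a = c \<or> a = d")
      case True
      then have "b \<noteq> c \<and> b \<noteq> d" using False ab by (auto simp: pq)
      then show ?thesis using that[of b] ab by (simp add: e_def)
    next
      case False
      then show ?thesis using that[of a] ab by (simp add: e_def)
    qed
    then show ?thesis using False by (auto intro!: prod_zero)
  qed
  finally show ?thesis by (simp add: pq)
qed

text \<open>The sign products are orthonormal, so the cross terms vanish.\<close>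

lemma expectation_rademacher_chaos:
  fixes w :: "nat \<times> nat \<Rightarrow> real"
  shows "measure_pmf.expectation (rademacher N) (\<lambda>s. (\<Sum>p\<in>ordered_pairs N. s (fst p) * s (snd p) * w p)\<^sup>2) =
    (\<Sum>p\<in>ordered_pairs N. (w p)\<^sup>2)"
proof -
  let ?P = "ordered_pairs N"
  have I: "integrable (measure_pmf (rademacher N)) f" for f :: "_ \<Rightarrow> real"
    by (rule integrable_measure_pmf_finite[OF finite_set_rademacher])
  have "(\<lambda>s. (\<Sum>p\<in>?P. s (fst p) * s (snd p) * w p)\<^sup>2) =
      (\<lambda>s. \<Sum>p\<in>?P. \<Sum>q\<in>?P. (w p * w q) * ((s (fst p) * s (snd p)) * (s (fst q) * s (snd q))))"
    by (simp add: power2_eq_square sum_product mult_ac fun_eq_iff)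
  then have "measure_pmf.expectation (rademacher N) (\<lambda>s. (\<Sum>p\<in>?P. s (fst p) * s (snd p) * w p)\<^sup>2) =
      (\<Sum>p\<in>?P. \<Sum>q\<in>?P. (w p * w q) * measure_pmf.expectation (rademacher N) (\<lambda>s. (s (fst p) * s (snd p)) * (s (fst q) * s (snd q))))"
    by (simp only:) (simp add: I Bochner_Integration.integral_sum)
  also have "\<dots> = (\<Sum>p\<in>?P. \<Sum>q\<in>?P. (w p * w q) * of_bool (p = q))"
    by (intro sum.cong refl arg_cong2[of _ _ _ _ "(*)"] expectation_rademacher_pairs)
  also have "\<dots> = (\<Sum>p\<in>?P. (w p)\<^sup>2)"
    by (intro sum.cong refl) (simp add: of_bool_def if_distrib power2_eq_square cong: if_cong)
  finally show ?thesis .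
qed

definition hash_pmf :: "nat \<Rightarrow> nat \<Rightarrow> (nat \<Rightarrow> nat) pmf" where
  "hash_pmf N m = pmf_of_set ({..<N} \<rightarrow>\<^sub>E {..<m})"

lemma hash_space:
  fixes m N :: nat
  assumes "m \<ge> 1"
  shows "({..<N} \<rightarrow>\<^sub>E {..<m}) \<noteq> {}" "finite ({..<N} \<rightarrow>\<^sub>E {..<m})"
proof -
  have "{..<m} \<noteq> {}" using assms by (metis Suc_le_eq One_nat_def empty_iff lessThan_iff)
  then show "({..<N} \<rightarrow>\<^sub>E {..<m}) \<noteq> {}" by (simp add: PiE_eq_empty_iff)
qed (auto intro!: finite_PiE)

text \<open>Counting: \<open>m\<close> common values and \<open>m ^ (N - 2)\<close> choices for the
  other indices, out of \<open>m ^ N\<close> maps.\<close>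

lemma prob_hash_collision:
  assumes m: "m \<ge> 1" and jk: "j < N" "k < N" "j \<noteq> k"
  shows "measure_pmf.prob (hash_pmf N m) {h. h j = h k} = 1 / real m"
proof -
  let ?S = "{..<N} \<rightarrow>\<^sub>E {..<m}"
  define C where "C c = Pi\<^sub>E {..<N} (\<lambda>i. if i \<in> {j, k} then {c} else {..<m})" for c
  have C_iff: "h \<in> C c \<longleftrightarrow> h \<in> ?S \<and> h j = c \<and> h k = c" if "c < m" for h c
  proof
    assume h: "h \<in> C c"
    have v: "h i \<in> (if i \<in> {j, k} then {c} else {..<m})" if "i < N" for i
      using h that unfolding C_def by (intro PiE_mem[of h "{..<N}"]) auto
    have "h i < m" if "i < N" for i using v[OF that] \<open>c < m\<close> by (auto split: if_splits)
    moreover have "h j = c" "h k = c" using v jk by force+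
    ultimately show "h \<in> ?S \<and> h j = c \<and> h k = c" using h by (auto simp: C_def PiE_iff)
  next
    assume "h \<in> ?S \<and> h j = c \<and> h k = c"
    then show "h \<in> C c" by (auto simp: C_def PiE_iff)
  qed
  have "h j < m" if "h \<in> ?S" for h using PiE_mem[OF that, of j] jk by simp
  then have "?S \<inter> {h. h j = h k} = (\<Union>c\<in>{..<m}. C c)"
    using C_iff by (intro equalityI subsetI) (auto, metis)
  also have "card \<dots> = (\<Sum>c<m. card (C c))"
  proof (rule card_UN_disjoint)
    show "\<forall>i\<in>{..<m}. finite (C i)" by (auto simp: C_def intro!: finite_PiE)
    show "\<forall>i\<in>{..<m}. \<forall>j\<in>{..<m}. i \<noteq> j \<longrightarrow> C i \<inter> C j = {}"
      using C_iff by auto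
  qed simp
  also have "\<dots> = (\<Sum>c<m. m ^ (N - 2))"
  proof (rule sum.cong[OF refl])
    fix c
    have "card (C c) = (\<Prod>i<N. if i \<in> {j, k} then 1 else m)"
      unfolding C_def by (subst card_PiE) (auto intro!: prod.cong)
    also have "\<dots> = (\<Prod>i\<in>{..<N} - {j, k}. m)" by (intro prod.mono_neutral_cong_right) auto
    also have "\<dots> = m ^ (N - 2)" using jk by (simp add: card_Diff_subset numeral_2_eq_2)
    finally show "card (C c) = m ^ (N - 2)" .
  qed
  finally have c: "card (?S \<inter> {h. h j = h k}) = m * m ^ (N - 2)" by simp
  have "N = Suc (Suc (N - 2))" using jk by auto
  then have "m ^ N = m * (m * m ^ (N - 2))" by (metis power_Suc)
  then show ?thesis
    unfolding hash_pmf_def using hash_space[OF m] m c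
    by (subst measure_pmf_of_set) (auto simp: card_PiE)
qed

section \<open>Gram matrices after CountSketch\<close>

definition bucket :: "nat \<Rightarrow> (nat \<Rightarrow> nat) \<Rightarrow> (nat \<Rightarrow> real) \<Rightarrow> (nat \<Rightarrow> real) \<Rightarrow> nat \<Rightarrow> real" where
  "bucket N h s y b = (\<Sum>j<N. of_bool (h j = b) * (s j * y j))"

text \<open>Squares of signs are one, so the diagonal reproduces the inner product; the off-diagonal
  terms are grouped by unordered pairs of colliding indices.\<close>

lemma inner_bucket:
  assumes h: "\<And>j. j < N \<Longrightarrow> h j < m" and s: "\<And>j. s j = 1 \<or> s j = -1"
  shows "inner_n m (bucket N h s u) (bucket N h s v) = inner_n N u v +
    (\<Sum>p\<in>ordered_pairs N. s (fst p) * s (snd p) *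
      (of_bool (h (fst p) = h (snd p)) * (u (fst p) * v (snd p) + u (snd p) * v (fst p))))"
proof -
  let ?t = "\<lambda>j k. of_bool (h j = h k) * (s j * u j * (s k * v k))"
  have "inner_n m (bucket N h s u) (bucket N h s v) =
      (\<Sum>b<m. \<Sum>j<N. \<Sum>k<N. of_bool (h j = b) * of_bool (h k = b) * (s j * u j * (s k * v k)))"
    unfolding inner_n_def bucket_def sum_product by (intro sum.cong refl) simp
  also have "\<dots> = (\<Sum>j<N. \<Sum>k<N. \<Sum>b<m. of_bool (h j = b) * of_bool (h k = b) * (s j * u j * (s k * v k)))"
    by (subst sum.swap, rule sum.cong[OF refl], rule sum.swap)
  also have "\<dots> = (\<Sum>j<N. \<Sum>k<N. ?t j k)"
  proof (intro sum.cong refl)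
    fix j k assume j: "j \<in> {..<N}" "k \<in> {..<N}"
    have "(\<Sum>b<m. of_bool (h j = b) * of_bool (h k = b) * (s j * u j * (s k * v k))) =
        (\<Sum>b<m. if b = h j then ?t j k else 0)"
      by (intro sum.cong refl) auto
    then show "(\<Sum>b<m. of_bool (h j = b) * of_bool (h k = b) * (s j * u j * (s k * v k))) = ?t j k"
      using h j by simp
  qed
  also have "\<dots> = (\<Sum>(j, k)\<in>{..<N} \<times> {..<N}. ?t j k)" by (rule sum.cartesian_product)
  also have "{..<N} \<times> {..<N} = (\<lambda>j. (j, j)) ` {..<N} \<union> (ordered_pairs N \<union> prod.swap ` ordered_pairs N)"
    unfolding ordered_pairs_def by (auto simp: image_iff)
  also have "(\<Sum>(j, k)\<in>\<dots>. ?t j k) = (\<Sum>(j, k)\<in>(\<lambda>j. (j, j)) ` {..<N}. ?t j k) +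
      ((\<Sum>(j, k)\<in>ordered_pairs N. ?t j k) + (\<Sum>(j, k)\<in>prod.swap ` ordered_pairs N. ?t j k))"
    by (simp add: sum.union_disjoint ordered_pairs_disjoint)
  also have "(\<Sum>(j, k)\<in>(\<lambda>j. (j, j)) ` {..<N}. ?t j k) = (\<Sum>j<N. ?t j j)"
    by (subst sum.reindex) (auto simp: inj_on_def)
  also have "\<dots> = inner_n N u v"
    unfolding inner_n_def
  proof (rule sum.cong[OF refl])
    fix j show "?t j j = u j * v j" using s[of j] by auto
  qed
  also have "(\<Sum>(j, k)\<in>prod.swap ` ordered_pairs N. ?t j k) = (\<Sum>(j, k)\<in>ordered_pairs N. ?t k j)"
    by (subst sum.reindex) (auto simp: inj_on_def case_prod_beta)
  also have "(\<Sum>(j, k)\<in>ordered_pairs N. ?t j k) + (\<Sum>(j, k)\<in>ordered_pairs N. ?t k j) =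
    (\<Sum>p\<in>ordered_pairs N. s (fst p) * s (snd p) *
      (of_bool (h (fst p) = h (snd p)) * (u (fst p) * v (snd p) + u (snd p) * v (fst p))))"
    unfolding sum.distrib[symmetric] by (intro sum.cong refl) (auto simp: algebra_simps)
  finally show ?thesis .
qed

text \<open>Bounding the square of a sum by twice the sum of squares splits a pair into its two
  orders, and all of these terms occur in the expanded product of the two sums.\<close>

lemma sum_ordered_pairs_le:
  "(\<Sum>p\<in>ordered_pairs N. (u (fst p) * v (snd p) + u (snd p) * v (fst p))\<^sup>2) \<le> 2 * (sqn N u * sqn N v)"
proof -
  let ?f = "\<lambda>j k. (u j)\<^sup>2 * (v k)\<^sup>2"
  have "(\<Sum>p\<in>ordered_pairs N. (u (fst p) * v (snd p) + u (snd p) * v (fst p))\<^sup>2) \<le>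
      (\<Sum>p\<in>ordered_pairs N. 2 * (?f (fst p) (snd p) + ?f (snd p) (fst p)))"
  proof (rule sum_mono)
    fix p
    have "0 \<le> (u (fst p) * v (snd p) - u (snd p) * v (fst p))\<^sup>2" by simp
    then show "(u (fst p) * v (snd p) + u (snd p) * v (fst p))\<^sup>2 \<le> 2 * (?f (fst p) (snd p) + ?f (snd p) (fst p))"
      by (simp add: power2_eq_square algebra_simps)
  qed
  also have "\<dots> = 2 * ((\<Sum>(j, k)\<in>ordered_pairs N. ?f j k) + (\<Sum>(j, k)\<in>prod.swap ` ordered_pairs N. ?f j k))"
    by (subst sum.reindex) (auto simp: inj_on_def case_prod_beta sum.distrib simp flip: sum_distrib_left)
  also have "(\<Sum>(j, k)\<in>ordered_pairs N. ?f j k) + (\<Sum>(j, k)\<in>prod.swap ` ordered_pairs N. ?f j k) =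
      (\<Sum>(j, k)\<in>ordered_pairs N \<union> prod.swap ` ordered_pairs N. ?f j k)"
    by (simp add: sum.union_disjoint ordered_pairs_disjoint)
  also have "\<dots> \<le> (\<Sum>(j, k)\<in>{..<N} \<times> {..<N}. ?f j k)"
    by (intro sum_mono2) (auto simp: ordered_pairs_def)
  also have "\<dots> = sqn N u * sqn N v"
    unfolding sqn_def sum_product by (rule sum.cartesian_product[symmetric])
  finally show ?thesis by simp
qed

definition count_sketch_pmf :: "nat \<Rightarrow> nat \<Rightarrow> ((nat \<Rightarrow> nat) \<times> (nat \<Rightarrow> real)) pmf" where
  "count_sketch_pmf N m = pair_pmf (hash_pmf N m) (rademacher N)"

definition gram_error :: "nat \<Rightarrow> nat \<Rightarrow> (nat \<Rightarrow> nat) \<times> (nat \<Rightarrow> real) \<Rightarrow> (nat \<Rightarrow> real) \<Rightarrow> (nat \<Rightarrow> real) \<Rightarrow> real" where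
  "gram_error N m hs u v = inner_n m (bucket N (fst hs) (snd hs) u) (bucket N (fst hs) (snd hs) v) - inner_n N u v"

text \<open>For a fixed hash map the average over the signs leaves the squares over colliding pairs;
  the average over the hash map then weights every pair by \<open>1 / m\<close>.\<close>

lemma gram_error_second_moment:
  assumes m: "m \<ge> 1"
  shows "(\<integral>\<^sup>+hs. ennreal ((gram_error N m hs u v)\<^sup>2) \<partial>count_sketch_pmf N m) \<le> ennreal (2 * (sqn N u * sqn N v) / real m)"
proof -
  let ?c = "\<lambda>p. u (fst p) * v (snd p) + u (snd p) * v (fst p)"
  let ?P = "ordered_pairs N"
  have inner: "(\<integral>\<^sup>+s. ennreal ((gram_error N m (h, s) u v)\<^sup>2) \<partial>rademacher N) =
      (\<Sum>p\<in>?P. ennreal ((?c p)\<^sup>2) * indicator {h. h (fst p) = h (snd p)} h)"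
    if h: "h \<in> set_pmf (hash_pmf N m)" for h
  proof -
    have hm: "\<And>j. j < N \<Longrightarrow> h j < m"
      using h hash_space[OF m] unfolding hash_pmf_def by (subst (asm) set_pmf_of_set) (auto simp: PiE_iff)
    let ?w = "\<lambda>p. of_bool (h (fst p) = h (snd p)) * ?c p"
    have "(\<integral>\<^sup>+s. ennreal ((gram_error N m (h, s) u v)\<^sup>2) \<partial>rademacher N) =
        (\<integral>\<^sup>+s. ennreal ((\<Sum>p\<in>?P. s (fst p) * s (snd p) * ?w p)\<^sup>2) \<partial>rademacher N)"
    proof (rule nn_integral_cong_AE, rule AE_pmfI)
      fix s assume "s \<in> set_pmf (rademacher N)"
      then have "\<And>j. s j = 1 \<or> s j = -1" by (rule set_rademacher)
      from inner_bucket[where u = u and v = v, OF hm this]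
      show "ennreal ((gram_error N m (h, s) u v)\<^sup>2) = ennreal ((\<Sum>p\<in>?P. s (fst p) * s (snd p) * ?w p)\<^sup>2)"
        by (simp add: gram_error_def)
    qed
    also have "\<dots> = ennreal (measure_pmf.expectation (rademacher N) (\<lambda>s. (\<Sum>p\<in>?P. s (fst p) * s (snd p) * ?w p)\<^sup>2))"
      by (rule nn_integral_eq_integral) (auto intro!: integrable_measure_pmf_finite finite_set_rademacher)
    also have "\<dots> = ennreal (\<Sum>p\<in>?P. (?w p)\<^sup>2)" by (simp only: expectation_rademacher_chaos)
    also have "\<dots> = (\<Sum>p\<in>?P. ennreal ((?w p)\<^sup>2))" by (rule sum_ennreal[symmetric]) simp
    also have "\<dots> = (\<Sum>p\<in>?P. ennreal ((?c p)\<^sup>2) * indicator {h. h (fst p) = h (snd p)} h)"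
      by (intro sum.cong refl) (auto simp: indicator_def)
    finally show ?thesis .
  qed
  have "(\<integral>\<^sup>+hs. ennreal ((gram_error N m hs u v)\<^sup>2) \<partial>count_sketch_pmf N m) =
      (\<integral>\<^sup>+h. (\<Sum>p\<in>?P. ennreal ((?c p)\<^sup>2) * indicator {h. h (fst p) = h (snd p)} h) \<partial>hash_pmf N m)"
    unfolding count_sketch_pmf_def nn_integral_pair_pmf'
    by (intro nn_integral_cong_AE AE_pmfI inner)
  also have "\<dots> = (\<Sum>p\<in>?P. ennreal ((?c p)\<^sup>2) * emeasure (hash_pmf N m) {h. h (fst p) = h (snd p)})"
    by (subst nn_integral_sum) (auto simp: nn_integral_cmult)
  also have "\<dots> = (\<Sum>p\<in>?P. ennreal ((?c p)\<^sup>2 / real m))"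
  proof (intro sum.cong refl)
    fix p assume "p \<in> ?P"
    then have "measure_pmf.prob (hash_pmf N m) {h. h (fst p) = h (snd p)} = 1 / real m"
      by (intro prob_hash_collision m) (auto simp: ordered_pairs_def)
    then show "ennreal ((?c p)\<^sup>2) * emeasure (hash_pmf N m) {h. h (fst p) = h (snd p)} = ennreal ((?c p)\<^sup>2 / real m)"
      by (simp add: measure_pmf.emeasure_eq_measure ennreal_mult'[symmetric])
  qed
  also have "\<dots> = ennreal ((\<Sum>p\<in>?P. (?c p)\<^sup>2) / real m)"
    by (simp add: sum_ennreal sum_divide_distrib)
  also have "\<dots> \<le> ennreal (2 * (sqn N u * sqn N v) / real m)"
    by (intro ennreal_leI divide_right_mono sum_ordered_pairs_le) simp
  finally show ?thesis .
qed

lemma bucket_lincomb: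
  "bucket N h s (lincomb_n r q e) = lincomb_n r (\<lambda>a. bucket N h s (q a)) e"
proof
  fix b
  have "bucket N h s (lincomb_n r q e) b = (\<Sum>j<N. \<Sum>a<r. e a * (of_bool (h j = b) * (s j * q a j)))"
    unfolding bucket_def lincomb_n_def sum_distrib_left by (intro sum.cong refl) (simp only: mult_ac)
  also have "\<dots> = (\<Sum>a<r. \<Sum>j<N. e a * (of_bool (h j = b) * (s j * q a j)))" by (rule sum.swap)
  finally show "bucket N h s (lincomb_n r q e) b = lincomb_n r (\<lambda>a. bucket N h s (q a)) e b"
    by (simp only: bucket_def lincomb_n_def sum_distrib_left)
qed

lemma bucket_cong: "(\<And>j. j < N \<Longrightarrow> x j = y j) \<Longrightarrow> bucket N h s x = bucket N h s y"
  unfolding bucket_def by (intro ext sum.cong) auto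

lemma sqn_cong: "(\<And>j. j < N \<Longrightarrow> x j = y j) \<Longrightarrow> sqn N x = sqn N y"
  unfolding sqn_def by (intro sum.cong) auto

text \<open>With \<open>m >= 800 d\<^sup>2\<close> the squared Frobenius error has mean at most
  \<open>1 / 400\<close>, so it reaches \<open>1 / 4\<close> with probability at most
  \<open>1 / 100\<close>. Below that, Cauchy-Schwarz bounds the error of the quadratic form by half
  the squared norm, for all \<open>c\<close> at once and without a net.\<close>

lemma count_sketch_embedding:
  assumes m: "800 * (real d)\<^sup>2 \<le> real m" "d \<ge> 1"
  shows "measure_pmf.prob (count_sketch_pmf N m)
    {hs. \<forall>c. sqn N (lincomb_n d v c) / 2 \<le> sqn m (bucket N (fst hs) (snd hs) (lincomb_n d v c)) \<and>
      sqn m (bucket N (fst hs) (snd hs) (lincomb_n d v c)) \<le> 3 / 2 * sqn N (lincomb_n d v c)} \<ge> 0.99"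
proof -
  have m1: "m \<ge> 1"
  proof -
    have "1 \<le> (real d)\<^sup>2" using m(2) by simp
    then show ?thesis using m(1) by linarith
  qed
  obtain r q where r: "r \<le> d" and on: "\<And>a b. a < r \<Longrightarrow> b < r \<Longrightarrow> inner_n N (q a) (q b) = of_bool (a = b)"
    and cov: "\<And>c. \<exists>e. \<forall>i<N. lincomb_n d v c i = lincomb_n r q e i"
    using orthonormal_basis_exists[of d N v] by metis
  define F where "F hs = (\<Sum>a<r. \<Sum>b<r. (gram_error N m hs (q a) (q b))\<^sup>2)" for hs
  have "(\<integral>\<^sup>+hs. ennreal (F hs) \<partial>count_sketch_pmf N m) =
      (\<Sum>a<r. \<Sum>b<r. \<integral>\<^sup>+hs. ennreal ((gram_error N m hs (q a) (q b))\<^sup>2) \<partial>count_sketch_pmf N m)"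
    by (simp add: F_def sum_ennreal[symmetric] sum_nonneg nn_integral_sum del: sum_ennreal)
  also have "\<dots> \<le> (\<Sum>a<r. \<Sum>b<r. ennreal (2 / real m))"
  proof (intro sum_mono)
    fix a b assume "a \<in> {..<r}" "b \<in> {..<r}"
    then have "sqn N (q a) = 1" "sqn N (q b) = 1" using on by (simp_all flip: inner_n_self)
    then show "(\<integral>\<^sup>+hs. ennreal ((gram_error N m hs (q a) (q b))\<^sup>2) \<partial>count_sketch_pmf N m) \<le> ennreal (2 / real m)"
      using gram_error_second_moment[OF m1, of N "q a" "q b"] by simp
  qed
  also have "\<dots> = ennreal (\<Sum>a<r. \<Sum>b<r. 2 / real m)"
    by (simp add: sum_ennreal sum_nonneg del: sum_constant)
  also have "(\<Sum>a<r. \<Sum>b<r. 2 / real m) = real r * real r * (2 / real m)" by simp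
  also have "\<dots> \<le> ennreal (1 / 400)"
  proof (rule ennreal_leI)
    have "real r * real r * 2 \<le> (real d)\<^sup>2 * 2" using r by (simp add: power2_eq_square mult_mono)
    also have "\<dots> \<le> real m / 400" using m(1) by simp
    finally show "real r * real r * (2 / real m) \<le> 1 / 400" using m1 by (simp add: field_simps)
  qed
  finally have "measure_pmf.prob (count_sketch_pmf N m) {hs. 1 / 4 \<le> F hs} \<le> (1 / 400) / (1 / 4)"
    by (rule pmf_markov) auto
  moreover have "measure_pmf.prob (count_sketch_pmf N m) {hs. \<not> 1 / 4 \<le> F hs} = 1 - measure_pmf.prob (count_sketch_pmf N m) {hs. 1 / 4 \<le> F hs}"
    by (subst measure_pmf.prob_compl[symmetric]) (auto intro!: arg_cong[of _ _ "measure _"])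
  ultimately have "0.99 \<le> measure_pmf.prob (count_sketch_pmf N m) {hs. \<not> 1 / 4 \<le> F hs}" by simp
  also have "\<dots> \<le> measure_pmf.prob (count_sketch_pmf N m)
    {hs. \<forall>c. sqn N (lincomb_n d v c) / 2 \<le> sqn m (bucket N (fst hs) (snd hs) (lincomb_n d v c)) \<and>
      sqn m (bucket N (fst hs) (snd hs) (lincomb_n d v c)) \<le> 3 / 2 * sqn N (lincomb_n d v c)}"
  proof (intro measure_pmf.finite_measure_mono Collect_mono impI allI)
    fix hs c assume "\<not> 1 / 4 \<le> F hs"
    then have F: "F hs \<le> (1 / 2)\<^sup>2" by (simp add: power2_eq_square)
    let ?B = "bucket N (fst hs) (snd hs)"
    obtain e where e: "\<And>i. i < N \<Longrightarrow> lincomb_n d v c i = lincomb_n r q e i" using cov by blast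
    let ?y = "lincomb_n r q e"
    have s1: "sqn N (lincomb_n d v c) = sqn r e"
      using sqn_cong[OF e, of N] sqn_lincomb_orthonormal[OF on, of r e] by simp
    have s2: "?B (lincomb_n d v c) = ?B ?y" by (rule bucket_cong[OF e])
    define D where "D = (\<Sum>(a, b)\<in>{..<r} \<times> {..<r}. (e a * e b) * gram_error N m hs (q a) (q b))"
    have "sqn m (?B ?y) = (\<Sum>a<r. \<Sum>b<r. (e a * e b) * inner_n m (?B (q a)) (?B (q b)))"
      unfolding bucket_lincomb inner_n_self[symmetric] inner_n_lincomb
      by (subst inner_n_commute, subst inner_n_lincomb) (simp add: sum_distrib_left mult_ac inner_n_commute)
    also have "\<dots> = (\<Sum>a<r. \<Sum>b<r. (e a * e b) * of_bool (a = b)) + D"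
      unfolding D_def sum.cartesian_product[symmetric] sum.distrib[symmetric]
      by (intro sum.cong refl) (simp add: gram_error_def on algebra_simps)
    also have "(\<Sum>a<r. \<Sum>b<r. (e a * e b) * of_bool (a = b)) = sqn r e"
      unfolding sqn_def by (intro sum.cong refl) (simp add: of_bool_def if_distrib power2_eq_square cong: if_cong)
    finally have s3: "sqn m (?B (lincomb_n d v c)) = sqn r e + D" by (simp add: s2)
    have "D\<^sup>2 \<le> (\<Sum>(a, b)\<in>{..<r} \<times> {..<r}. (e a * e b)\<^sup>2) * (\<Sum>(a, b)\<in>{..<r} \<times> {..<r}. (gram_error N m hs (q a) (q b))\<^sup>2)"
      unfolding D_def case_prod_beta by (rule Cauchy_Schwarz_ineq_sum)
    also have "(\<Sum>(a, b)\<in>{..<r} \<times> {..<r}. (e a * e b)\<^sup>2) = (sqn r e)\<^sup>2"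
      unfolding sum.cartesian_product[symmetric] sqn_def power2_eq_square[of "\<Sum>i<r. (e i)\<^sup>2"] sum_product
      by (simp only: power_mult_distrib)
    also have "(\<Sum>(a, b)\<in>{..<r} \<times> {..<r}. (gram_error N m hs (q a) (q b))\<^sup>2) = F hs"
      unfolding F_def by (rule sum.cartesian_product[symmetric])
    also have "(sqn r e)\<^sup>2 * F hs \<le> (sqn r e)\<^sup>2 * (1 / 2)\<^sup>2" using F by (intro mult_left_mono) auto
    finally have "D\<^sup>2 \<le> (sqn r e / 2)\<^sup>2" by (simp add: power_divide)
    then have "\<bar>D\<bar> \<le> sqn r e / 2" using abs_le_square_iff[of D "sqn r e / 2"] by simp
    then show "sqn N (lincomb_n d v c) / 2 \<le> sqn m (?B (lincomb_n d v c)) \<and>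
      sqn m (?B (lincomb_n d v c)) \<le> 3 / 2 * sqn N (lincomb_n d v c)"
      unfolding s1 s3 by (auto simp: abs_le_iff)
  qed auto
  finally show ?thesis .
qed

section \<open>Gaussian sketches\<close>

definition gauss_measure :: "nat \<Rightarrow> nat \<Rightarrow> (nat \<times> nat \<Rightarrow> real) measure" where
  "gauss_measure k m = Pi\<^sub>M ({..<k} \<times> {..<m}) (\<lambda>_. density lborel (\<lambda>x. ennreal (std_normal_density x)))"

definition gauss_apply :: "nat \<Rightarrow> (nat \<times> nat \<Rightarrow> real) \<Rightarrow> (nat \<Rightarrow> real) \<Rightarrow> nat \<Rightarrow> real" where
  "gauss_apply m g v a = (\<Sum>b<m. v b * g (a, b))"

section \<open>Independence of the Gaussian entries and the law of a Gaussian image\<close>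

lemma prob_space_std_normal: "prob_space (density lborel (\<lambda>x. ennreal (std_normal_density x)))"
  by (rule prob_space_normal_density) simp

lemma prob_space_gauss_measure: "prob_space (gauss_measure k m)"
  unfolding gauss_measure_def by (intro prob_space_PiM prob_space_std_normal)

lemma sets_gauss_measure: "sets (gauss_measure k m) = sets (Pi\<^sub>M ({..<k} \<times> {..<m}) (\<lambda>_. borel))"
  unfolding gauss_measure_def by (intro sets_PiM_cong) auto

lemma measurable_gauss_coord: "p \<in> {..<k} \<times> {..<m} \<Longrightarrow> (\<lambda>g. g p) \<in> borel_measurable (gauss_measure k m)"
  using measurable_component_singleton[of p "{..<k} \<times> {..<m}" "\<lambda>_. borel"]
  by (simp add: measurable_cong_sets[OF sets_gauss_measure refl])

lemma measurable_gauss_apply: "a < k \<Longrightarrow> (\<lambda>g. gauss_apply m g v a) \<in> borel_measurable (gauss_measure k m)"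
  unfolding gauss_apply_def
  by (intro borel_measurable_sum borel_measurable_times measurable_gauss_coord borel_measurable_const) auto

lemma measurable_sqn_gauss_apply: "(\<lambda>g. sqn k (gauss_apply m g v)) \<in> borel_measurable (gauss_measure k m)"
  unfolding sqn_def by (intro borel_measurable_sum borel_measurable_power measurable_gauss_apply) auto

lemma indep_vars_gauss:
  "prob_space.indep_vars (gauss_measure k m) (\<lambda>_. borel) (\<lambda>p g. g p) ({..<k} \<times> {..<m})"
proof (cases "{..<k} \<times> {..<m} = {}")
  case True
  interpret prob_space "gauss_measure k m" by (rule prob_space_gauss_measure)
  show ?thesis unfolding True by (simp add: indep_vars_def indep_sets_def)
next
  case False
  interpret prob_space "gauss_measure k m" by (rule prob_space_gauss_measure)
  let ?I = "{..<k} \<times> {..<m}"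
  let ?N = "density lborel (\<lambda>x. ennreal (std_normal_density x))"
  show ?thesis
  proof (subst indep_vars_iff_distr_eq_PiM'[OF False measurable_gauss_coord])
    have comp: "distr (gauss_measure k m) borel (\<lambda>g. g p) = ?N" if "p \<in> ?I" for p
    proof -
      have "distr (gauss_measure k m) borel (\<lambda>g. g p) = distr (Pi\<^sub>M ?I (\<lambda>_. ?N)) ?N (\<lambda>g. g p)"
        unfolding gauss_measure_def by (intro distr_cong) auto
      also have "\<dots> = ?N" using that by (intro distr_PiM_component prob_space_std_normal) auto
      finally show ?thesis .
    qed
    have "distr (gauss_measure k m) (Pi\<^sub>M ?I (\<lambda>_. borel)) (\<lambda>x. restrict x ?I) =
        distr (gauss_measure k m) (gauss_measure k m) (\<lambda>x. x)"
      by (rule distr_cong[OF refl sets_gauss_measure[symmetric]])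
        (auto simp: gauss_measure_def space_PiM PiE_iff extensional_restrict)
    also have "\<dots> = gauss_measure k m" by simp
    also have "\<dots> = Pi\<^sub>M ?I (\<lambda>p. distr (gauss_measure k m) borel (\<lambda>g. g p))"
      unfolding gauss_measure_def[of k m, symmetric] by (subst gauss_measure_def, intro PiM_cong refl comp[symmetric])
    finally show "distr (gauss_measure k m) (Pi\<^sub>M ?I (\<lambda>_. borel)) (\<lambda>x. restrict x ?I) =
        Pi\<^sub>M ?I (\<lambda>p. distr (gauss_measure k m) borel (\<lambda>g. g p))" .
  qed
qed

lemma distributed_gauss_coord:
  assumes "p \<in> {..<k} \<times> {..<m}"
  shows "distributed (gauss_measure k m) lborel (\<lambda>g. g p) (\<lambda>x. ennreal (std_normal_density x))"
proof -
  let ?I = "{..<k} \<times> {..<m}"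
  let ?N = "density lborel (\<lambda>x. ennreal (std_normal_density x))"
  have "distr (gauss_measure k m) lborel (\<lambda>g. g p) = distr (Pi\<^sub>M ?I (\<lambda>_. ?N)) ?N (\<lambda>g. g p)"
    unfolding gauss_measure_def by (intro distr_cong) auto
  also have "\<dots> = ?N" using assms by (intro distr_PiM_component prob_space_std_normal) auto
  finally show ?thesis using measurable_gauss_coord[OF assms]
    by (simp add: distributed_def)
qed

lemma distributed_gauss_apply:
  assumes a: "a < k" and v: "sqn m v > 0"
  shows "distributed (gauss_measure k m) lborel (\<lambda>g. gauss_apply m g v a) (\<lambda>x. ennreal (normal_density 0 (sqrt (sqn m v)) x))"
proof -
  interpret prob_space "gauss_measure k m" by (rule prob_space_gauss_measure)
  \<comment> \<open>Vanishing coefficients are dropped because the sum rule for normal variables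
    asks for positive standard deviations.\<close>
  define S where "S = {b. b < m \<and> v b \<noteq> 0}"
  have fin: "finite S" by (simp add: S_def)
  have sqS: "sqn m v = (\<Sum>b\<in>S. (v b)\<^sup>2)"
    unfolding sqn_def S_def by (intro sum.mono_neutral_cong_right) auto
  have ne: "S \<noteq> {}" using v sqS by auto
  have "indep_vars (\<lambda>_. borel) (\<lambda>p g. g p) (Pair a ` S)"
    by (rule indep_vars_subset[OF indep_vars_gauss]) (use a in \<open>auto simp: S_def\<close>)
  then have ind: "indep_vars (\<lambda>_. borel) (\<lambda>p g. v (snd p) * g p) (Pair a ` S)"
    by (rule indep_vars_compose2) auto
  have "distributed (gauss_measure k m) lborel (\<lambda>g. \<Sum>p\<in>Pair a ` S. v (snd p) * g p)
      (\<lambda>x. ennreal (normal_density (\<Sum>p\<in>Pair a ` S. 0) (sqrt (\<Sum>p\<in>Pair a ` S. \<bar>v (snd p)\<bar>\<^sup>2)) x))"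
  proof (rule sum_indep_normal[OF _ _ ind])
    fix p assume p: "p \<in> Pair a ` S"
    then show "0 < \<bar>v (snd p)\<bar>" by (auto simp: S_def)
    have "distributed (gauss_measure k m) lborel (\<lambda>g. 0 + v (snd p) * g p)
        (\<lambda>x. ennreal (normal_density (0 + v (snd p) * 0) (\<bar>v (snd p)\<bar> * 1) x))"
      using a p by (intro normal_density_affine distributed_gauss_coord) (auto simp: S_def)
    then show "distributed (gauss_measure k m) lborel (\<lambda>g. v (snd p) * g p) (\<lambda>x. ennreal (normal_density 0 \<bar>v (snd p)\<bar> x))"
      by simp
  qed (use fin ne in auto)
  moreover have "(\<Sum>p\<in>Pair a ` S. v (snd p) * g p) = gauss_apply m g v a" for g
  proof -
    have "(\<Sum>p\<in>Pair a ` S. v (snd p) * g p) = (\<Sum>b\<in>S. v b * g (a, b))"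
      by (subst sum.reindex) (auto simp: inj_on_def)
    also have "\<dots> = gauss_apply m g v a"
      unfolding gauss_apply_def S_def by (intro sum.mono_neutral_cong_left) auto
    finally show ?thesis .
  qed
  moreover have "(\<Sum>p\<in>Pair a ` S. \<bar>v (snd p)\<bar>\<^sup>2) = (\<Sum>b\<in>S. (v b)\<^sup>2)"
    by (subst sum.reindex) (auto simp: inj_on_def)
  ultimately show ?thesis by (simp add: sqS)
qed

lemma nn_integral_normal_exp_square:
  assumes \<sigma>: "\<sigma> > 0" and \<theta>: "1 + 2 * \<theta> > 0"
  shows "(\<integral>\<^sup>+x. ennreal (normal_density 0 \<sigma> x) * ennreal (exp (- \<theta> * (x\<^sup>2 / \<sigma>\<^sup>2))) \<partial>lborel) = ennreal (1 / sqrt (1 + 2 * \<theta>))"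
proof -
  let ?c = "sqrt (1 + 2 * \<theta>)"
  have c: "?c > 0" "?c\<^sup>2 = 1 + 2 * \<theta>" using \<theta> by auto
  have "normal_density 0 \<sigma> x * exp (- \<theta> * (x\<^sup>2 / \<sigma>\<^sup>2)) = 1 / ?c * normal_density 0 (\<sigma> / ?c) x" for x
  proof -
    have "exp (- x\<^sup>2 / (2 * \<sigma>\<^sup>2)) * exp (- \<theta> * (x\<^sup>2 / \<sigma>\<^sup>2)) = exp (- x\<^sup>2 / (2 * (\<sigma> / ?c)\<^sup>2))"
      unfolding exp_add[symmetric] power_divide c(2) using \<sigma> \<theta> by (simp add: field_simps)
    moreover have "sqrt (2 * pi * (\<sigma> / ?c)\<^sup>2) = sqrt (2 * pi * \<sigma>\<^sup>2) / ?c"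
      using c by (simp add: real_sqrt_mult real_sqrt_divide power_divide)
    ultimately show ?thesis using c by (simp add: normal_density_def mult.assoc)
  qed
  then have "(\<integral>\<^sup>+x. ennreal (normal_density 0 \<sigma> x) * ennreal (exp (- \<theta> * (x\<^sup>2 / \<sigma>\<^sup>2))) \<partial>lborel) =
      (\<integral>\<^sup>+x. ennreal (1 / ?c * normal_density 0 (\<sigma> / ?c) x) \<partial>lborel)"
    by (simp only: ennreal_mult[symmetric, OF normal_density_nonneg exp_ge_zero])
  also have "\<dots> = ennreal (\<integral>x. 1 / ?c * normal_density 0 (\<sigma> / ?c) x \<partial>lborel)"
    using \<sigma> c by (intro nn_integral_eq_integral integrable_mult_right integrable_normal_density) auto
  also have "(\<integral>x. 1 / ?c * normal_density 0 (\<sigma> / ?c) x \<partial>lborel) = 1 / ?c"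
    using \<sigma> c by (subst integral_mult_right_zero, subst integral_normal_density) auto
  finally show ?thesis .
qed

text \<open>This is the moment generating function of a chi-square variable with \<open>k\<close>
  degrees of freedom: the rows are independent and contribute one factor each.\<close>

lemma nn_integral_gauss_exp:
  assumes v: "sqn m v > 0" and \<theta>: "1 + 2 * \<theta> > 0"
  shows "(\<integral>\<^sup>+g. ennreal (exp (- \<theta> * (sqn k (gauss_apply m g v) / sqn m v))) \<partial>gauss_measure k m) = ennreal ((1 / sqrt (1 + 2 * \<theta>)) ^ k)"
proof -
  interpret prob_space "gauss_measure k m" by (rule prob_space_gauss_measure)
  let ?M = "gauss_measure k m"
  let ?\<sigma> = "sqrt (sqn m v)"
  have \<sigma>: "?\<sigma> > 0" "?\<sigma>\<^sup>2 = sqn m v" using v by auto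
  let ?Y = "\<lambda>a g. ennreal (exp (- \<theta> * ((gauss_apply m g v a)\<^sup>2 / ?\<sigma>\<^sup>2)))"
  \<comment> \<open>Coordinate \<open>a\<close> of the image reads only row \<open>a\<close> of the
    matrix, so grouping the independent entries by rows makes the coordinates independent.\<close>
  have "indep_vars (\<lambda>a. Pi\<^sub>M ({a} \<times> {..<m}) (\<lambda>_. borel)) (\<lambda>a g. restrict (\<lambda>p. g p) ({a} \<times> {..<m})) {..<k}"
    by (rule indep_vars_restrict[OF indep_vars_gauss]) (auto simp: disjoint_family_on_def)
  then have "indep_vars (\<lambda>_. borel) (\<lambda>a g. ennreal (exp (- \<theta> * ((gauss_apply m (restrict (\<lambda>p. g p) ({a} \<times> {..<m})) v a)\<^sup>2 / ?\<sigma>\<^sup>2)))) {..<k}"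
  proof (rule indep_vars_compose2)
    fix a
    have "(\<lambda>g. gauss_apply m g v a) \<in> borel_measurable (Pi\<^sub>M ({a} \<times> {..<m}) (\<lambda>_. borel))"
      unfolding gauss_apply_def
      by (intro borel_measurable_sum borel_measurable_times borel_measurable_const measurable_component_singleton) auto
    then show "(\<lambda>g. ennreal (exp (- \<theta> * ((gauss_apply m g v a)\<^sup>2 / ?\<sigma>\<^sup>2)))) \<in> borel_measurable (Pi\<^sub>M ({a} \<times> {..<m}) (\<lambda>_. borel))"
      by measurable
  qed
  moreover have "gauss_apply m (restrict (\<lambda>p. g p) ({a} \<times> {..<m})) v a = gauss_apply m g v a" for a g
    by (simp add: gauss_apply_def)
  ultimately have ind: "indep_vars (\<lambda>_. borel) ?Y {..<k}" by simp
  have "ennreal (exp (- \<theta> * (sqn k (gauss_apply m g v) / sqn m v))) = (\<Prod>a<k. ?Y a g)" for g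
  proof -
    have "- \<theta> * (sqn k (gauss_apply m g v) / sqn m v) = (\<Sum>a<k. - \<theta> * ((gauss_apply m g v a)\<^sup>2 / ?\<sigma>\<^sup>2))"
      unfolding \<sigma>(2) sqn_def[of k] by (simp only: sum_divide_distrib sum_distrib_left)
    then show ?thesis by (simp only: exp_sum[OF finite_lessThan] prod_ennreal exp_ge_zero)
  qed
  then have "(\<integral>\<^sup>+g. ennreal (exp (- \<theta> * (sqn k (gauss_apply m g v) / sqn m v))) \<partial>?M) = (\<integral>\<^sup>+g. (\<Prod>a<k. ?Y a g) \<partial>?M)"
    by simp
  also have "\<dots> = (\<Prod>a<k. \<integral>\<^sup>+g. ?Y a g \<partial>?M)" by (rule indep_vars_nn_integral[OF _ ind]) auto
  also have "\<dots> = (\<Prod>a<k. ennreal (1 / sqrt (1 + 2 * \<theta>)))"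
  proof (rule prod.cong[OF refl])
    fix a assume a: "a \<in> {..<k}"
    have "(\<integral>\<^sup>+g. ?Y a g \<partial>?M) = (\<integral>\<^sup>+x. ennreal (normal_density 0 ?\<sigma> x) * ennreal (exp (- \<theta> * (x\<^sup>2 / ?\<sigma>\<^sup>2))) \<partial>lborel)"
      by (rule distributed_nn_integral[symmetric, OF distributed_gauss_apply]) (use a v in auto)
    also have "\<dots> = ennreal (1 / sqrt (1 + 2 * \<theta>))" by (rule nn_integral_normal_exp_square[OF \<sigma>(1) \<theta>])
    finally show "(\<integral>\<^sup>+g. ?Y a g \<partial>?M) = ennreal (1 / sqrt (1 + 2 * \<theta>))" .
  qed
  also have "\<dots> = ennreal ((1 / sqrt (1 + 2 * \<theta>)) ^ k)" using \<theta> by (simp add: ennreal_power)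
  finally show ?thesis .
qed

text \<open>Chernoff bound for both tails: the sign of \<open>\<theta>\<close> decides the direction
  of the inequality inside the event.\<close>

lemma gauss_exp_tail:
  assumes v: "sqn m v > 0" and \<theta>: "1 + 2 * \<theta> > 0"
  shows "measure (gauss_measure k m) {g \<in> space (gauss_measure k m). 0 \<le> \<tau> - \<theta> * (sqn k (gauss_apply m g v) / sqn m v)} \<le>
    exp \<tau> * (1 / sqrt (1 + 2 * \<theta>)) ^ k"
proof -
  interpret prob_space "gauss_measure k m" by (rule prob_space_gauss_measure)
  let ?M = "gauss_measure k m"
  let ?f = "\<lambda>g. ennreal (exp (- \<theta> * (sqn k (gauss_apply m g v) / sqn m v)))"
  have [measurable]: "(\<lambda>g. sqn k (gauss_apply m g v)) \<in> borel_measurable ?M" by (rule measurable_sqn_gauss_apply)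
  have "0 \<le> \<tau> - \<theta> * y \<longleftrightarrow> 1 \<le> ennreal (exp \<tau>) * ennreal (exp (- \<theta> * y))" for y
    by (simp add: ennreal_mult'[symmetric] exp_add[symmetric] ennreal_le_iff2 flip: ennreal_1)
  then have "emeasure ?M {g \<in> space ?M. 0 \<le> \<tau> - \<theta> * (sqn k (gauss_apply m g v) / sqn m v)} \<le>
      ennreal (exp \<tau>) * (\<integral>\<^sup>+g. ?f g * indicator (space ?M) g \<partial>?M)"
    by (simp only:) (rule nn_integral_Markov_inequality, measurable)
  also have "(\<integral>\<^sup>+g. ?f g * indicator (space ?M) g \<partial>?M) = (\<integral>\<^sup>+g. ?f g \<partial>?M)"
    by (intro nn_integral_cong) simp
  also have "\<dots> = ennreal ((1 / sqrt (1 + 2 * \<theta>)) ^ k)" by (rule nn_integral_gauss_exp[OF v \<theta>])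
  also have "ennreal (exp \<tau>) * \<dots> = ennreal (exp \<tau> * (1 / sqrt (1 + 2 * \<theta>)) ^ k)"
    by (simp add: ennreal_mult')
  finally show ?thesis using \<theta> by (simp add: emeasure_eq_measure)
qed

text \<open>\<open>\<theta> = 4\<close> makes the square root equal to 3, and
  \<open>exp (1 / 2) <= 9 / 5\<close> bounds the base by \<open>3 / 5\<close>.\<close>

lemma gauss_lower_tail:
  assumes v: "sqn m v > 0"
  shows "measure (gauss_measure k m) {g \<in> space (gauss_measure k m). sqn k (gauss_apply m g v) \<le> real k / 8 * sqn m v} \<le> (3 / 5) ^ k"
proof -
  have "{g \<in> space (gauss_measure k m). sqn k (gauss_apply m g v) \<le> real k / 8 * sqn m v} =
      {g \<in> space (gauss_measure k m). 0 \<le> real k / 2 - 4 * (sqn k (gauss_apply m g v) / sqn m v)}"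
    using v by (intro Collect_cong) (auto simp: field_simps)
  also have "measure (gauss_measure k m) \<dots> \<le> exp (real k / 2) * (1 / sqrt (1 + 2 * 4)) ^ k"
    using v by (intro gauss_exp_tail) auto
  also have "exp (real k / 2) * (1 / sqrt (1 + 2 * 4)) ^ k = (exp (1 / 2) / 3) ^ k"
  proof -
    have "sqrt (1 + 2 * 4) = (3::real)" by (rule real_sqrt_unique) auto
    moreover have "exp (real k / 2) = exp (1 / 2) ^ k" by (simp flip: exp_of_nat_mult)
    ultimately show ?thesis by (simp add: power_divide)
  qed
  also have "\<dots> \<le> (3 / 5) ^ k"
  proof (rule power_mono)
    have "(exp (1 / 2))\<^sup>2 = exp (1::real)" by (simp flip: exp_of_nat_mult)
    also have "\<dots> \<le> (9 / 5)\<^sup>2" using e_less_272 by (simp add: power2_eq_square)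
    finally have "exp (1 / 2) \<le> (9 / 5::real)" by (rule power2_le_imp_le) simp
    then show "exp (1 / 2) / 3 \<le> (3 / 5::real)" by simp
  qed simp
  finally show ?thesis .
qed

text \<open>\<open>\<theta> = - 3 / 8\<close> makes \<open>1 + 2 * \<theta>\<close> equal to
  \<open>1 / 4\<close>; the base is then \<open>2 * exp (- 3 / 2)\<close>, again at most
  \<open>3 / 5\<close>.\<close>

lemma gauss_upper_tail:
  assumes v: "sqn m v > 0"
  shows "measure (gauss_measure k m) {g \<in> space (gauss_measure k m). 4 * real k * sqn m v \<le> sqn k (gauss_apply m g v)} \<le> (3 / 5) ^ k"
proof -
  have "{g \<in> space (gauss_measure k m). 4 * real k * sqn m v \<le> sqn k (gauss_apply m g v)} =
      {g \<in> space (gauss_measure k m). 0 \<le> - (3 / 2 * real k) - (- 3 / 8) * (sqn k (gauss_apply m g v) / sqn m v)}"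
    using v by (intro Collect_cong) (auto simp: field_simps)
  also have "measure (gauss_measure k m) \<dots> \<le> exp (- (3 / 2 * real k)) * (1 / sqrt (1 + 2 * (- 3 / 8))) ^ k"
    using v by (intro gauss_exp_tail) auto
  also have "\<dots> = (exp (- 3 / 2) * 2) ^ k"
  proof -
    have eq: "1 / sqrt (1 + 2 * (- 3 / 8)) = (2::real)" by (simp add: real_sqrt_divide)
    have "exp (- (3 / 2 * real k)) = exp (- 3 / 2) ^ k" by (simp flip: exp_of_nat_mult add: mult.commute)
    then show ?thesis unfolding eq by (simp add: power_mult_distrib)
  qed
  also have "\<dots> \<le> (3 / 5) ^ k"
  proof (rule power_mono)
    have "1 + 3 / 2 + (3 / 2)\<^sup>2 / 2 \<le> exp (3 / 2 :: real)" by (rule exp_lower_Taylor_quadratic) simp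
    then have "10 / 3 \<le> exp (3 / 2 :: real)" by (simp add: power2_eq_square)
    then show "exp (- 3 / 2) * 2 \<le> (3 / 5 :: real)" by (simp add: exp_minus field_simps)
  qed simp
  finally show ?thesis .
qed

section \<open>A lattice net of the Euclidean ball\<close>

lemma sqrt_sqn: "sqrt (sqn N x) = L2_set x {..<N}"
  by (simp add: sqn_def L2_set_def)

lemma sqrt_sqn_triangle: "sqrt (sqn N (\<lambda>i. x i + y i)) \<le> sqrt (sqn N x) + sqrt (sqn N y)"
  unfolding sqrt_sqn by (rule L2_set_triangle_ineq)

lemma sqn_scale: "sqn N (\<lambda>i. c * x i) = c\<^sup>2 * sqn N x"
  by (simp add: sqn_def power_mult_distrib sum_distrib_left)

text \<open>Since \<open>k\<^sup>2 >= \<bar>k\<bar>\<close> and \<open>exp (- 1) <= 1 / 2\<close>,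
  the sum is dominated by the two-sided geometric series, whose value is 3.\<close>

lemma sum_exp_neg_square_le:
  "(\<Sum>k\<in>{- int R..int R}. exp (- (real_of_int k)\<^sup>2)) \<le> 3"
proof -
  have pow: "exp (- (real_of_int k)\<^sup>2) \<le> (1 / 2) ^ nat \<bar>k\<bar>" for k
  proof -
    have "real_of_int \<bar>k\<bar> * 1 \<le> real_of_int \<bar>k\<bar> * real_of_int \<bar>k\<bar>"
    proof (cases "k = 0")
      case False
      then show ?thesis by (intro mult_left_mono) (auto simp flip: of_int_abs)
    qed simp
    then have "- (real_of_int k)\<^sup>2 \<le> real (nat \<bar>k\<bar>) * (- 1)"
      by (simp add: power2_eq_square abs_mult[symmetric])
    then have "exp (- (real_of_int k)\<^sup>2) \<le> exp (real (nat \<bar>k\<bar>) * (- 1))" by simp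
    also have "\<dots> = exp (-1) ^ nat \<bar>k\<bar>" by (rule exp_of_nat_mult)
    also have "\<dots> \<le> (1 / 2) ^ nat \<bar>k\<bar>"
    proof (rule power_mono)
      have "2 \<le> exp (1::real)" using exp_ge_add_one_self[of 1] by simp
      then show "exp (-1) \<le> (1 / 2 :: real)" by (simp add: exp_minus field_simps)
    qed simp
    finally show ?thesis .
  qed
  have geo: "(\<Sum>k\<in>{- int R..int R}. (1 / 2 :: real) ^ nat \<bar>k\<bar>) = 3 - 2 * (1 / 2) ^ R"
  proof (induction R)
    case (Suc R)
    have "{- int (Suc R)..int (Suc R)} = insert (- int (Suc R)) (insert (int (Suc R)) {- int R..int R})" by auto
    moreover have notin: "- int (Suc R) \<notin> insert (int (Suc R)) {- int R..int R}" "int (Suc R) \<notin> {- int R..int R}"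
      and nat: "nat \<bar>- int (Suc R)\<bar> = Suc R" "nat \<bar>int (Suc R)\<bar> = Suc R"
      by auto
    ultimately have "(\<Sum>k\<in>{- int (Suc R)..int (Suc R)}. (1 / 2 :: real) ^ nat \<bar>k\<bar>) =
        (1 / 2) ^ Suc R + ((1 / 2) ^ Suc R + (\<Sum>k\<in>{- int R..int R}. (1 / 2) ^ nat \<bar>k\<bar>))"
      by (simp only: sum.insert[OF _ notin(1)] sum.insert[OF _ notin(2)] finite_insert finite_atLeastAtMost_int nat)
    then show ?case using Suc by simp
  qed simp
  have "(\<Sum>k\<in>{- int R..int R}. exp (- (real_of_int k)\<^sup>2)) \<le> (\<Sum>k\<in>{- int R..int R}. (1 / 2) ^ nat \<bar>k\<bar>)"
    by (intro sum_mono pow)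
  also have "\<dots> \<le> 3" unfolding geo by simp
  finally show ?thesis .
qed

text \<open>Divided by \<open>20 * sqrt r\<close>, these points form a \<open>1 / 20\<close>-net of
  the unit ball; \<open>400 * r\<close> is the square of that scale. The surrounding box makes the
  set finite and gives the counting argument a product to sum over.\<close>

definition int_points :: "nat \<Rightarrow> (nat \<Rightarrow> int) set" where
  "int_points r = {z \<in> {..<r} \<rightarrow>\<^sub>E {- int (20 * r)..int (20 * r)}. sqn r (\<lambda>a. real_of_int (z a)) \<le> 400 * real r}"

lemma finite_int_points: "finite (int_points r)"
  by (rule finite_subset[of _ "{..<r} \<rightarrow>\<^sub>E {- int (20 * r)..int (20 * r)}"])
    (auto simp: int_points_def intro!: finite_PiE)

text \<open>Lattice points in a ball are counted by comparing their number with the sum of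
  \<open>exp (400 r - |z|\<^sup>2)\<close> over all of them, which factorises over the coordinates.\<close>

lemma card_int_points_le: "real (card (int_points r)) \<le> exp (400 * real r) * 3 ^ r"
proof -
  let ?B = "{- int (20 * r)..int (20 * r)}"
  have "real (card (int_points r)) = (\<Sum>z\<in>int_points r. 1)" by simp
  also have "\<dots> \<le> (\<Sum>z\<in>int_points r. exp (400 * real r - sqn r (\<lambda>a. real_of_int (z a))))"
    by (intro sum_mono) (auto simp: int_points_def)
  also have "\<dots> \<le> (\<Sum>z\<in>{..<r} \<rightarrow>\<^sub>E ?B. exp (400 * real r - sqn r (\<lambda>a. real_of_int (z a))))"
    by (intro sum_mono2) (auto simp: int_points_def intro!: finite_PiE)
  also have "\<dots> = exp (400 * real r) * (\<Sum>z\<in>{..<r} \<rightarrow>\<^sub>E ?B. \<Prod>a<r. exp (- (real_of_int (z a))\<^sup>2))"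
    unfolding sum_distrib_left
  proof (intro sum.cong refl)
    fix z :: "nat \<Rightarrow> int"
    show "exp (400 * real r - sqn r (\<lambda>a. real_of_int (z a))) = exp (400 * real r) * (\<Prod>a<r. exp (- (real_of_int (z a))\<^sup>2))"
      unfolding sqn_def by (simp only: diff_conv_add_uminus exp_add sum_negf[symmetric] exp_sum[OF finite_lessThan])
  qed
  also have "(\<Sum>z\<in>{..<r} \<rightarrow>\<^sub>E ?B. \<Prod>a<r. exp (- (real_of_int (z a))\<^sup>2)) =
      (\<Prod>a<r. \<Sum>k\<in>?B. exp (- (real_of_int k)\<^sup>2))"
    by (rule prod_sum_PiE[symmetric]) auto
  also have "\<dots> \<le> (\<Prod>a<r. 3)"
    by (intro prod_mono conjI sum_nonneg sum_exp_neg_square_le) auto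
  finally show ?thesis by simp
qed

text \<open>Rounds towards zero, so that a rounded point leaves neither the ball nor the
  box.\<close>

definition trunc_real :: "real \<Rightarrow> int" where
  "trunc_real x = (if 0 \<le> x then \<lfloor>x\<rfloor> else \<lceil>x\<rceil>)"

lemma trunc_real: "\<bar>real_of_int (trunc_real x)\<bar> \<le> \<bar>x\<bar>" "\<bar>x - real_of_int (trunc_real x)\<bar> \<le> 1"
proof -
  have b: "real_of_int \<lfloor>x\<rfloor> \<le> x" "x < real_of_int \<lfloor>x\<rfloor> + 1" "x \<le> real_of_int \<lceil>x\<rceil>" "real_of_int \<lceil>x\<rceil> < x + 1"
    by linarith+
  have "\<bar>real_of_int (trunc_real x)\<bar> \<le> \<bar>x\<bar> \<and> \<bar>x - real_of_int (trunc_real x)\<bar> \<le> 1"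
  proof (cases "0 \<le> x")
    case True
    then have "trunc_real x = \<lfloor>x\<rfloor>" "0 \<le> real_of_int \<lfloor>x\<rfloor>" by (simp_all add: trunc_real_def)
    then show ?thesis using True b by linarith
  next
    case False
    then have "trunc_real x = \<lceil>x\<rceil>" "real_of_int \<lceil>x\<rceil> \<le> 0" by (simp_all add: trunc_real_def ceiling_le_iff)
    then show ?thesis using False b by linarith
  qed
  then show "\<bar>real_of_int (trunc_real x)\<bar> \<le> \<bar>x\<bar>" "\<bar>x - real_of_int (trunc_real x)\<bar> \<le> 1" by blast+
qed

text \<open>Each coordinate is off by at most \<open>1 / (20 * sqrt r)\<close>, hence the whole
  vector by at most \<open>1 / 20\<close>.\<close>

lemma int_points_net:
  assumes e: "sqn r e \<le> 1" and r: "r \<ge> 1"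
  shows "\<exists>z\<in>int_points r. sqn r (\<lambda>a. real_of_int (z a) / (20 * sqrt (real r))) \<le> 1 \<and>
    sqn r (\<lambda>a. e a - real_of_int (z a) / (20 * sqrt (real r))) \<le> (1 / 20)\<^sup>2"
proof -
  let ?s = "20 * sqrt (real r)"
  have s: "?s > 0" "?s\<^sup>2 = 400 * real r" using r by (auto simp: power_mult_distrib)
  define z where "z = (\<lambda>a\<in>{..<r}. trunc_real (?s * e a))"
  have za: "\<bar>real_of_int (z a)\<bar> \<le> ?s * \<bar>e a\<bar>" "\<bar>?s * e a - real_of_int (z a)\<bar> \<le> 1" if "a < r" for a
    using trunc_real[of "?s * e a"] that s by (auto simp: z_def abs_mult)
  have "sqn r (\<lambda>a. real_of_int (z a)) \<le> ?s\<^sup>2 * sqn r e"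
    unfolding sqn_def sum_distrib_left
  proof (rule sum_mono)
    fix a assume "a \<in> {..<r}"
    then have "\<bar>real_of_int (z a)\<bar>\<^sup>2 \<le> (?s * \<bar>e a\<bar>)\<^sup>2" using za by (intro power_mono) auto
    then show "(real_of_int (z a))\<^sup>2 \<le> ?s\<^sup>2 * (e a)\<^sup>2" by (simp add: power_mult_distrib)
  qed
  also have "\<dots> \<le> ?s\<^sup>2 * 1" using e by (intro mult_left_mono) auto
  finally have sq1: "sqn r (\<lambda>a. real_of_int (z a)) \<le> ?s\<^sup>2" by simp
  have "z \<in> int_points r"
  proof -
    have "z a \<in> {- int (20 * r)..int (20 * r)}" if a: "a < r" for a
    proof -
      have "(e a)\<^sup>2 \<le> sqn r e" unfolding sqn_def using a by (intro member_le_sum[of a "{..<r}" "\<lambda>a. (e a)\<^sup>2"]) auto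
      then have "(e a)\<^sup>2 \<le> 1" using e by linarith
      then have "\<bar>e a\<bar> \<le> 1" by (simp add: abs_square_le_1)
      then have "?s * \<bar>e a\<bar> \<le> ?s * 1" using s by (intro mult_left_mono) auto
      also have "sqrt (real r) \<le> real r" using r by (intro real_le_lsqrt) (auto simp: power2_eq_square)
      then have "?s * 1 \<le> 20 * real r" by simp
      finally have "\<bar>real_of_int (z a)\<bar> \<le> 20 * real r" using za(1)[OF a] by linarith
      then have "real_of_int \<bar>z a\<bar> \<le> real_of_int (int (20 * r))" by simp
      then have "\<bar>z a\<bar> \<le> int (20 * r)" by (simp only: of_int_le_iff)
      then show ?thesis by auto
    qed
    then show ?thesis using sq1 s by (auto simp: int_points_def z_def)
  qed
  moreover have "sqn r (\<lambda>a. real_of_int (z a) / ?s) \<le> 1"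
  proof -
    have "sqn r (\<lambda>a. real_of_int (z a) / ?s) = sqn r (\<lambda>a. real_of_int (z a)) / ?s\<^sup>2"
      by (simp only: sqn_def power_divide sum_divide_distrib)
    then show ?thesis using sq1 s by (simp add: divide_le_eq_1)
  qed
  moreover have "sqn r (\<lambda>a. e a - real_of_int (z a) / ?s) \<le> (1 / 20)\<^sup>2"
  proof -
    have "sqn r (\<lambda>a. e a - real_of_int (z a) / ?s) \<le> (\<Sum>a<r. 1 / ?s\<^sup>2)"
      unfolding sqn_def
    proof (rule sum_mono)
      fix a assume "a \<in> {..<r}"
      then have "\<bar>(?s * e a - real_of_int (z a)) / ?s\<bar>\<^sup>2 \<le> (1 / ?s)\<^sup>2"
        using za(2) s by (intro power_mono) (auto simp: abs_divide divide_right_mono)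
      moreover have "(?s * e a - real_of_int (z a)) / ?s = e a - real_of_int (z a) / ?s"
        using s(1) by (simp add: diff_divide_distrib)
      ultimately show "(e a - real_of_int (z a) / ?s)\<^sup>2 \<le> 1 / ?s\<^sup>2" by (simp only: power2_abs power_divide power_one)
    qed
    also have "\<dots> = (1 / 20)\<^sup>2" unfolding s(2) using r by (simp add: power2_eq_square)
    finally show ?thesis .
  qed
  ultimately show ?thesis by blast
qed

text \<open>The net bounds first the norm of the map, by absorbing the error term into the supremum, and
  then its lower bound.\<close>

lemma seminorm_bounds_from_net:
  fixes p :: "(nat \<Rightarrow> real) \<Rightarrow> real"
  assumes r: "r \<ge> 1"
    and tri: "\<And>x y. p (\<lambda>i. x i + y i) \<le> p x + p y"
    and hom: "\<And>c x. p (\<lambda>i. c * x i) = \<bar>c\<bar> * p x"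
    and bd: "\<And>x. sqn r x \<le> 1 \<Longrightarrow> p x \<le> B"
    and lo: "\<And>z. z \<in> int_points r \<Longrightarrow> sqrt (1 / 8) * sqrt (sqn r (\<lambda>a. real_of_int (z a))) \<le> p (\<lambda>a. real_of_int (z a))"
    and up: "\<And>z. z \<in> int_points r \<Longrightarrow> p (\<lambda>a. real_of_int (z a)) \<le> 2 * sqrt (sqn r (\<lambda>a. real_of_int (z a)))"
    and e: "sqn r e = 1"
  shows "1 / 5 \<le> p e" "p e \<le> 5 / 2"
proof -
  define S where "S = (SUP x\<in>{x. sqn r x \<le> 1}. p x)"
  have bdd: "bdd_above (p ` {x. sqn r x \<le> 1})" using bd by (auto simp: bdd_above_def)
  have pS: "p x \<le> S" if "sqn r x \<le> 1" for x unfolding S_def using that by (intro cSUP_upper bdd) auto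
  have small: "p x \<le> S / 20" if "sqn r x \<le> (1 / 20)\<^sup>2" for x
  proof -
    have "p (\<lambda>i. 20 * x i) \<le> S" using that by (intro pS) (simp add: sqn_scale power2_eq_square)
    then show ?thesis using hom[of 20 x] by simp
  qed
  let ?s = "20 * sqrt (real r)"
  have s: "?s > 0" using r by simp
  have sc: "p (\<lambda>a. real_of_int (z a) / ?s) = p (\<lambda>a. real_of_int (z a)) / ?s"
    "sqrt (sqn r (\<lambda>a. real_of_int (z a) / ?s)) = sqrt (sqn r (\<lambda>a. real_of_int (z a))) / ?s" for z
    using hom[of "1 / ?s" "\<lambda>a. real_of_int (z a)"] sqn_scale[of r "1 / ?s" "\<lambda>a. real_of_int (z a)"] s
    by (simp_all add: real_sqrt_mult real_sqrt_divide power_divide)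
  have step: "\<exists>y. sqn r y \<le> 1 \<and> sqn r (\<lambda>a. x a - y a) \<le> (1 / 20)\<^sup>2 \<and>
      sqrt (1 / 8) * sqrt (sqn r y) \<le> p y \<and> p y \<le> 2 * sqrt (sqn r y)" if x: "sqn r x \<le> 1" for x
  proof -
    obtain z where z: "z \<in> int_points r" "sqn r (\<lambda>a. real_of_int (z a) / ?s) \<le> 1"
      "sqn r (\<lambda>a. x a - real_of_int (z a) / ?s) \<le> (1 / 20)\<^sup>2"
      using int_points_net[OF x r] by blast
    have "sqrt (1 / 8) * sqrt (sqn r (\<lambda>a. real_of_int (z a) / ?s)) \<le> p (\<lambda>a. real_of_int (z a) / ?s)"
      unfolding sc using divide_right_mono[OF lo[OF z(1)], of ?s] s by simp
    moreover have "p (\<lambda>a. real_of_int (z a) / ?s) \<le> 2 * sqrt (sqn r (\<lambda>a. real_of_int (z a) / ?s))"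
      unfolding sc using divide_right_mono[OF up[OF z(1)], of ?s] s by simp
    ultimately show ?thesis using z by (intro exI[of _ "\<lambda>a. real_of_int (z a) / ?s"]) simp
  qed
  \<comment> \<open>\<open>bd\<close> makes the supremum finite, so this inequality can be solved
    for \<open>S\<close>.\<close>
  have "S \<le> 2 + S / 20"
    unfolding S_def
  proof (rule cSUP_least)
    have "sqn r (\<lambda>_. 0) \<le> 1" by (simp add: sqn_def)
    then show "{x. sqn r x \<le> 1} \<noteq> {}" by blast
    fix x assume "x \<in> {x. sqn r x \<le> 1}"
    then obtain y where y: "sqn r y \<le> 1" "sqn r (\<lambda>a. x a - y a) \<le> (1 / 20)\<^sup>2" "p y \<le> 2 * sqrt (sqn r y)"
      using step by blast
    have "p x \<le> p y + p (\<lambda>a. x a - y a)" using tri[of y "\<lambda>a. x a - y a"] by simp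
    also have "\<dots> \<le> 2 * 1 + S / 20"
      using y small[of "\<lambda>a. x a - y a"] by (intro add_mono order_trans[OF y(3)] mult_left_mono) auto
    finally show "p x \<le> 2 + (SUP x\<in>{x. sqn r x \<le> 1}. p x) / 20" by (simp add: S_def)
  qed
  then have S: "S \<le> 40 / 19" by simp
  then show "p e \<le> 5 / 2" using pS[of e] e by simp
  obtain y where y: "sqn r (\<lambda>a. e a - y a) \<le> (1 / 20)\<^sup>2" "sqrt (1 / 8) * sqrt (sqn r y) \<le> p y"
    using step[of e] e by auto
  have d: "sqrt (sqn r (\<lambda>a. e a - y a)) \<le> 1 / 20" using y(1) by (intro real_le_lsqrt) auto
  have "sqrt (sqn r e) \<le> sqrt (sqn r y) + sqrt (sqn r (\<lambda>a. e a - y a))"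
    using sqrt_sqn_triangle[of r y "\<lambda>a. e a - y a"] by simp
  then have ny: "19 / 20 \<le> sqrt (sqn r y)" using d e by simp
  \<comment> \<open>The final margin: \<open>(7 / 20) * (19 / 20)\<close> minus
    \<open>S / 20 <= 2 / 19\<close> still exceeds \<open>1 / 5\<close>.\<close>
  have s8: "7 / 20 \<le> sqrt (1 / 8 :: real)" by (rule real_le_rsqrt) (simp add: power2_eq_square)
  have "(7 / 20) * (19 / 20) \<le> sqrt (1 / 8) * sqrt (sqn r y)" by (rule mult_mono[OF s8 ny]) auto
  also have "\<dots> \<le> p y" by (rule y(2))
  also have "p y \<le> p e + p (\<lambda>a. y a - e a)" using tri[of e "\<lambda>a. y a - e a"] by simp
  also have "p (\<lambda>a. y a - e a) = p (\<lambda>a. e a - y a)" using hom[of "-1" "\<lambda>a. e a - y a"] by simp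
  also have "p (\<lambda>a. e a - y a) \<le> S / 20" by (rule small[OF y(1)])
  finally show "1 / 5 \<le> p e" using S by simp
qed

section \<open>Uniform Gaussian bounds over the column space\<close>

lemma gauss_apply_lincomb:
  "gauss_apply m g (lincomb_n r q e) = lincomb_n r (\<lambda>a. gauss_apply m g (q a)) e"
proof
  fix i
  have "gauss_apply m g (lincomb_n r q e) i = (\<Sum>b<m. \<Sum>a<r. e a * (q a b * g (i, b)))"
    unfolding gauss_apply_def lincomb_n_def sum_distrib_right by (simp only: mult.assoc)
  also have "\<dots> = (\<Sum>a<r. \<Sum>b<m. e a * (q a b * g (i, b)))" by (rule sum.swap)
  finally show "gauss_apply m g (lincomb_n r q e) i = lincomb_n r (\<lambda>a. gauss_apply m g (q a)) e i"
    by (simp only: gauss_apply_def lincomb_n_def sum_distrib_left)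
qed

text \<open>The net has at most \<open>exp (402 * d)\<close> points, while
  \<open>(3 / 5)\<^sup>2 <= exp (- 1)\<close> and \<open>k >= 1000 * d\<close> make each tail at
  most \<open>exp (- 500 * d)\<close>; what remains is \<open>2 * exp (- 98 * d)\<close>.\<close>

lemma three_fifths_power_le:
  assumes "1000 * d \<le> k" "d \<ge> 1" "r \<le> d"
  shows "exp (400 * real r) * 3 ^ r * (2 * (3 / 5) ^ k) \<le> 0.03"
proof -
  have e2: "(3 / 5 :: real) ^ 2 \<le> exp (-1)"
    using e_less_272 by (simp add: exp_minus power2_eq_square divide_simps)
  have e3: "(3 :: real) \<le> exp 2" using exp_ge_add_one_self[of 2] by simp
  have "(3 / 5 :: real) ^ k \<le> (3 / 5) ^ (2 * (500 * d))" using assms by (intro power_decreasing) auto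
  also have "\<dots> = ((3 / 5) ^ 2) ^ (500 * d)" by (simp only: power_mult)
  also have "\<dots> \<le> exp (-1) ^ (500 * d)" by (rule power_mono[OF e2]) simp
  also have "\<dots> = exp (- 500 * real d)" by (simp flip: exp_of_nat_mult)
  finally have 1: "(3 / 5 :: real) ^ k \<le> exp (- 500 * real d)" .
  have "(3 :: real) ^ r \<le> exp 2 ^ r" by (rule power_mono[OF e3]) simp
  also have "\<dots> = exp (real r * 2)" by (rule exp_of_nat_mult[symmetric])
  also have "\<dots> \<le> exp (2 * real d)" using assms by simp
  finally have 2: "(3 :: real) ^ r \<le> exp (2 * real d)" .
  have "exp (400 * real r) * 3 ^ r * (2 * (3 / 5) ^ k) \<le> exp (400 * real d) * exp (2 * real d) * (2 * exp (- 500 * real d))"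
    using 1 2 assms by (intro mult_mono) auto
  also have "\<dots> = 2 * exp (- (98 * real d))" by (simp flip: exp_add)
  also have "\<dots> \<le> 2 * (1 / (1 + 98))"
  proof (rule mult_left_mono)
    have "1 + 98 \<le> 1 + 98 * real d" using assms by simp
    also have "\<dots> \<le> exp (98 * real d)" by (rule exp_ge_add_one_self)
    finally show "exp (- (98 * real d)) \<le> 1 / (1 + 98 :: real)" by (simp add: exp_minus field_simps)
  qed simp
  finally have "exp (400 * real r) * 3 ^ r * (2 * (3 / 5) ^ k) \<le> 2 * (1 / (1 + 98))" .
  then show ?thesis by (rule order_trans) simp
qed

text \<open>In orthonormal coordinates the normalised image is a seminorm on Euclidean space, to
  which \<open>seminorm_bounds_from_net\<close> applies. \<open>E\<close> is the complement of
  finitely many tail events, which settles its measurability although the conclusion quantifies over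
  all \<open>c\<close>.\<close>

lemma gaussian_embedding:
  assumes k: "1000 * d \<le> k" "d \<ge> 1"
  shows "\<exists>E \<in> sets (gauss_measure k m). measure (gauss_measure k m) E \<ge> 0.97 \<and>
    (\<forall>g\<in>E. \<forall>c. real k / 25 * sqn m (lincomb_n d v c) \<le> sqn k (gauss_apply m g (lincomb_n d v c)) \<and>
      sqn k (gauss_apply m g (lincomb_n d v c)) \<le> 25 / 4 * real k * sqn m (lincomb_n d v c))"
proof -
  let ?M = "gauss_measure k m"
  interpret prob_space ?M by (rule prob_space_gauss_measure)
  obtain r q where r: "r \<le> d" and on: "\<And>a b. a < r \<Longrightarrow> b < r \<Longrightarrow> inner_n m (q a) (q b) = of_bool (a = b)"
    and cov: "\<And>c. \<exists>e. \<forall>i<m. lincomb_n d v c i = lincomb_n r q e i"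
    using orthonormal_basis_exists[of d m v] by metis
  let ?v = "\<lambda>z. lincomb_n r q (\<lambda>a. real_of_int (z a))"
  have sv: "sqn m (lincomb_n r q e) = sqn r e" for e by (rule sqn_lincomb_orthonormal[OF on])
  \<comment> \<open>The lattice point zero has no normal law and is left out; there the required
    estimate is trivial.\<close>
  define Z where "Z = {z \<in> int_points r. sqn r (\<lambda>a. real_of_int (z a)) > 0}"
  have finZ: "finite Z" using finite_int_points by (simp add: Z_def)
  define Bl where "Bl z = {g \<in> space ?M. sqn k (gauss_apply m g (?v z)) \<le> real k / 8 * sqn m (?v z)}" for z
  define Bu where "Bu z = {g \<in> space ?M. 4 * real k * sqn m (?v z) \<le> sqn k (gauss_apply m g (?v z))}" for z
  have meas: "Bl z \<in> sets ?M" "Bu z \<in> sets ?M" for z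
    unfolding Bl_def Bu_def by (intro borel_measurable_le measurable_sqn_gauss_apply borel_measurable_const)+
  define bad where "bad = (\<Union>z\<in>Z. Bl z \<union> Bu z)"
  have badm: "bad \<in> sets ?M" unfolding bad_def using finZ meas by auto
  have "measure ?M bad \<le> (\<Sum>z\<in>Z. measure ?M (Bl z \<union> Bu z))"
    unfolding bad_def using finZ meas by (intro finite_measure_subadditive_finite) auto
  also have "\<dots> \<le> (\<Sum>z\<in>Z. 2 * (3 / 5) ^ k)"
  proof (rule sum_mono)
    fix z assume "z \<in> Z"
    then have "sqn m (?v z) > 0" by (simp add: Z_def sv)
    then have "measure ?M (Bl z) \<le> (3 / 5) ^ k" "measure ?M (Bu z) \<le> (3 / 5) ^ k"
      unfolding Bl_def Bu_def by (rule gauss_lower_tail, rule gauss_upper_tail)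
    then show "measure ?M (Bl z \<union> Bu z) \<le> 2 * (3 / 5) ^ k"
      using measure_Un_le[OF meas(1)[of z] meas(2)[of z]] by simp
  qed
  also have "\<dots> = real (card Z) * (2 * (3 / 5) ^ k)" by simp
  also have "\<dots> \<le> exp (400 * real r) * 3 ^ r * (2 * (3 / 5) ^ k)"
  proof (rule mult_right_mono)
    have "real (card Z) \<le> real (card (int_points r))"
      using finite_int_points by (auto simp: Z_def intro!: card_mono)
    then show "real (card Z) \<le> exp (400 * real r) * 3 ^ r" using card_int_points_le[of r] by linarith
  qed simp
  also have "\<dots> \<le> 0.03" by (rule three_fifths_power_le[OF k r])
  finally have "measure ?M (space ?M - bad) \<ge> 0.97" using badm by (simp add: prob_compl)
  moreover have "space ?M - bad \<in> sets ?M" using badm by auto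
  moreover have "real k / 25 * sqn m (lincomb_n d v c) \<le> sqn k (gauss_apply m g (lincomb_n d v c)) \<and>
      sqn k (gauss_apply m g (lincomb_n d v c)) \<le> 25 / 4 * real k * sqn m (lincomb_n d v c)"
    if g: "g \<in> space ?M - bad" for g c
  proof -
    have kpos: "real k > 0" using k by simp
    define p where "p x = sqrt (sqn k (gauss_apply m g (lincomb_n r q x))) / sqrt (real k)" for x
    have sqp: "sqn k (gauss_apply m g (lincomb_n r q x)) = real k * (p x)\<^sup>2" for x
      using kpos by (simp add: p_def power_divide)
    have padd: "p (\<lambda>i. x i + y i) \<le> p x + p y" for x y
    proof -
      have "gauss_apply m g (lincomb_n r q (\<lambda>i. x i + y i)) =
          (\<lambda>a. gauss_apply m g (lincomb_n r q x) a + gauss_apply m g (lincomb_n r q y) a)"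
        unfolding gauss_apply_lincomb unfolding lincomb_n_def by (simp add: distrib_right sum.distrib)
      then show ?thesis
        using sqrt_sqn_triangle[of k "gauss_apply m g (lincomb_n r q x)" "gauss_apply m g (lincomb_n r q y)"]
        by (simp add: p_def divide_right_mono flip: add_divide_distrib)
    qed
    have phom: "p (\<lambda>i. c * x i) = \<bar>c\<bar> * p x" for c x
    proof -
      have "gauss_apply m g (lincomb_n r q (\<lambda>i. c * x i)) = (\<lambda>a. c * gauss_apply m g (lincomb_n r q x) a)"
        unfolding gauss_apply_lincomb unfolding lincomb_n_def by (simp add: sum_distrib_left mult.assoc)
      then show ?thesis by (simp add: p_def sqn_scale real_sqrt_mult)
    qed
    have pnn: "0 \<le> p x" for x by (simp add: p_def)
    \<comment> \<open>Only finiteness of the supremum is at stake: the bound may depend on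
      \<open>g\<close> but not on \<open>x\<close>.\<close>
    have pbd: "p x \<le> (\<Sum>a<r. p (\<lambda>i. of_bool (i = a)))" if x: "sqn r x \<le> 1" for x
    proof -
      have "p (\<lambda>i. \<Sum>a<s. x a * of_bool (i = a)) \<le> (\<Sum>a<s. \<bar>x a\<bar> * p (\<lambda>i. of_bool (i = a)))" for s
      proof (induction s)
        case 0
        show ?case using phom[of 0 "\<lambda>_. 0"] by simp
      next
        case (Suc s)
        then show ?case using padd[of "\<lambda>i. \<Sum>a<s. x a * of_bool (i = a)" "\<lambda>i. x s * of_bool (i = s)"]
            phom[of "x s" "\<lambda>i. of_bool (i = s)"] by simp
      qed
      from this[of r] have "p (\<lambda>i. \<Sum>a<r. x a * of_bool (i = a)) \<le> (\<Sum>a<r. \<bar>x a\<bar> * p (\<lambda>i. of_bool (i = a)))" .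
      also have "p (\<lambda>i. \<Sum>a<r. x a * of_bool (i = a)) = p x"
      proof -
        have "lincomb_n r q (\<lambda>i. \<Sum>a<r. x a * of_bool (i = a)) = lincomb_n r q x"
          unfolding lincomb_n_def by (intro ext sum.cong) (auto simp: of_bool_def if_distrib cong: if_cong)
        then show ?thesis by (simp add: p_def)
      qed
      also have "(\<Sum>a<r. \<bar>x a\<bar> * p (\<lambda>i. of_bool (i = a))) \<le> (\<Sum>a<r. 1 * p (\<lambda>i. of_bool (i = a)))"
      proof (intro sum_mono mult_right_mono pnn)
        fix a assume "a \<in> {..<r}"
        then have "(x a)\<^sup>2 \<le> sqn r x" unfolding sqn_def by (intro member_le_sum[of a "{..<r}" "\<lambda>a. (x a)\<^sup>2"]) auto
        then have "(x a)\<^sup>2 \<le> 1" using x by linarith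
        then show "\<bar>x a\<bar> \<le> 1" by (simp add: abs_square_le_1)
      qed
      finally show ?thesis by simp
    qed
    have lo: "sqrt (1 / 8) * sqrt (sqn r (\<lambda>a. real_of_int (z a))) \<le> p (\<lambda>a. real_of_int (z a))"
      and up: "p (\<lambda>a. real_of_int (z a)) \<le> 2 * sqrt (sqn r (\<lambda>a. real_of_int (z a)))" if z: "z \<in> int_points r" for z
    proof -
      let ?s = "sqn r (\<lambda>a. real_of_int (z a))"
      have "1 / 8 * ?s \<le> (p (\<lambda>a. real_of_int (z a)))\<^sup>2 \<and> (p (\<lambda>a. real_of_int (z a)))\<^sup>2 \<le> 4 * ?s"
      proof (cases "?s > 0")
        case True
        then have "z \<in> Z" using z by (simp add: Z_def)
        then have "g \<notin> Bl z" "g \<notin> Bu z" using g by (auto simp: bad_def)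
        then have "real k * (1 / 8 * ?s) < real k * (p (\<lambda>a. real_of_int (z a)))\<^sup>2"
          "real k * (p (\<lambda>a. real_of_int (z a)))\<^sup>2 < real k * (4 * ?s)"
          using g by (simp_all add: Bl_def Bu_def sv sqp not_le mult_ac)
        then show ?thesis using kpos by simp
      next
        case False
        then have "?s = 0" using sqn_nonneg[of r "\<lambda>a. real_of_int (z a)"] by linarith
        then have "lincomb_n r q (\<lambda>a. real_of_int (z a)) = lincomb_n r q (\<lambda>a. 0)"
          unfolding sqn_zero_iff lincomb_n_def by (intro ext sum.cong) auto
        then have "p (\<lambda>a. real_of_int (z a)) = 0" using phom[of 0 "\<lambda>_. 0"] by (simp add: p_def)
        then show ?thesis using \<open>?s = 0\<close> by simp
      qed
      then show "sqrt (1 / 8) * sqrt ?s \<le> p (\<lambda>a. real_of_int (z a))" "p (\<lambda>a. real_of_int (z a)) \<le> 2 * sqrt ?s"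
        using pnn real_sqrt_le_iff[of "(p (\<lambda>a. real_of_int (z a)))\<^sup>2" "4 * ?s"]
          real_sqrt_le_iff[of "1 / 8 * ?s" "(p (\<lambda>a. real_of_int (z a)))\<^sup>2"]
        by (simp_all only: real_sqrt_mult real_sqrt_abs abs_of_nonneg real_sqrt_four)
    qed
    obtain e where e: "\<And>i. i < m \<Longrightarrow> lincomb_n d v c i = lincomb_n r q e i" using cov by blast
    have ge: "gauss_apply m g (lincomb_n d v c) = gauss_apply m g (lincomb_n r q e)"
      unfolding gauss_apply_def using e by (intro ext sum.cong) auto
    have se: "sqn m (lincomb_n d v c) = sqn r e"
      using sv[of e] e by (simp add: sqn_def)
    have "(sqrt (sqn r e) / 5)\<^sup>2 \<le> (p e)\<^sup>2 \<and> (p e)\<^sup>2 \<le> (5 / 2 * sqrt (sqn r e))\<^sup>2"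
    proof (cases "sqn r e = 0")
      case True
      then have "lincomb_n r q e = lincomb_n r q (\<lambda>a. 0)"
        unfolding sqn_zero_iff lincomb_n_def by (intro ext sum.cong) auto
      then have "p e = 0" using phom[of 0 "\<lambda>_. 0"] by (simp add: p_def)
      then show ?thesis using True by simp
    next
      case False
      define s where "s = sqrt (sqn r e)"
      have s: "s > 0" "s\<^sup>2 = sqn r e" using False sqn_nonneg[of r e] by (auto simp: s_def order.strict_iff_order)
      have r1: "r \<ge> 1" using False by (cases r) (auto simp: sqn_def)
      have u: "sqn r (\<lambda>i. (1 / s) * e i) = 1" unfolding sqn_scale using s False by (simp add: power_divide)
      have "1 / 5 \<le> p (\<lambda>i. (1 / s) * e i)" "p (\<lambda>i. (1 / s) * e i) \<le> 5 / 2"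
        using seminorm_bounds_from_net[OF r1 padd phom pbd lo up u] by auto
      then have "s / 5 \<le> p e" "p e \<le> 5 / 2 * s" unfolding phom using s by (simp_all add: field_simps)
      then show ?thesis unfolding s_def[symmetric] using s(1) pnn[of e] by (intro conjI power_mono) simp_all
    qed
    then have "sqn r e / 25 \<le> (p e)\<^sup>2" "(p e)\<^sup>2 \<le> 25 / 4 * sqn r e"
      by (simp_all add: power_mult_distrib power_divide)
    from this[THEN mult_left_mono, of "real k"] show ?thesis unfolding ge se sqp by simp
  qed
  ultimately show ?thesis by blast
qed

section \<open>The sampling matrices: contraction\<close>

definition stacked :: "nat \<Rightarrow> (nat \<Rightarrow> real) \<Rightarrow> (nat \<times> nat \<Rightarrow> bool) \<Rightarrow> (nat \<Rightarrow> real) \<Rightarrow> nat \<Rightarrow> real" where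
  "stacked n w z y r = w (r div n) * of_bool (z (r div n, r mod n)) * y (r mod n)"

lemma sum_blocks:
  fixes f :: "nat \<Rightarrow> nat \<Rightarrow> real"
  assumes "n \<ge> 1"
  shows "(\<Sum>r<n * T. f (r div n) (r mod n)) = (\<Sum>i<T. \<Sum>j<n. f i j)"
proof -
  have "(\<Sum>r<n * T. f (r div n) (r mod n)) = (\<Sum>i<T. \<Sum>r\<in>{i * n..<i * n + n}. f (r div n) (r mod n))"
    by (simp add: sum.nat_group mult.commute)
  also have "\<dots> = (\<Sum>i<T. \<Sum>j<n. f i j)"
  proof (rule sum.cong[OF refl])
    fix i
    have "(\<Sum>r\<in>{i * n..<i * n + n}. f (r div n) (r mod n)) = (\<Sum>j\<in>{0..<n}. f ((j + i * n) div n) ((j + i * n) mod n))"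
      using sum.shift_bounds_nat_ivl[of "\<lambda>r. f (r div n) (r mod n)" 0 "i * n" n] by (simp add: add.commute)
    also have "\<dots> = (\<Sum>j<n. f i j)" by (intro sum.cong) auto
    finally show "(\<Sum>r\<in>{i * n..<i * n + n}. f (r div n) (r mod n)) = (\<Sum>j<n. f i j)" .
  qed
  finally show ?thesis .
qed

lemma sqn_stacked:
  assumes "n \<ge> 1"
  shows "sqn (n * T) (stacked n w z y) = (\<Sum>i<T. \<Sum>j<n. (w i)\<^sup>2 * of_bool (z (i, j)) * (y j)\<^sup>2)"
proof -
  have "sqn (n * T) (stacked n w z y) =
      (\<Sum>r<n * T. (w (r div n))\<^sup>2 * of_bool (z (r div n, r mod n)) * (y (r mod n))\<^sup>2)"
    unfolding sqn_def stacked_def by (intro sum.cong refl) (simp add: power_mult_distrib)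
  also have "\<dots> = (\<Sum>i<T. \<Sum>j<n. (w i)\<^sup>2 * of_bool (z (i, j)) * (y j)\<^sup>2)"
    by (rule sum_blocks[OF assms])
  finally show ?thesis .
qed

lemma stacked_lincomb: "stacked n w z (lincomb_n d v c) = lincomb_n d (\<lambda>j. stacked n w z (v j)) c"
  by (simp add: stacked_def lincomb_n_def fun_eq_iff sum_distrib_left mult_ac)

lemma stacked_add: "stacked n w z (\<lambda>i. x i + y i) = (\<lambda>r. stacked n w z x r + stacked n w z y r)"
  by (simp add: stacked_def fun_eq_iff distrib_left)

lemma stacked_scale: "stacked n w z (\<lambda>i. c * x i) = (\<lambda>r. c * stacked n w z x r)"
  by (simp add: stacked_def fun_eq_iff)

lemma stacked_cong: "n \<ge> 1 \<Longrightarrow> (\<And>i. i < n \<Longrightarrow> x i = y i) \<Longrightarrow> stacked n w z x = stacked n w z y"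
  by (simp add: stacked_def fun_eq_iff)

section \<open>The sampling variables\<close>

definition sampling_pmf :: "nat \<Rightarrow> nat \<Rightarrow> (nat \<times> nat \<Rightarrow> bool) pmf" where
  "sampling_pmf n t = Pi_pmf ({..t} \<times> {..<n}) False (\<lambda>(i, j). bernoulli_pmf (1 / 2 ^ i))"

lemma finite_set_sampling: "finite (set_pmf (sampling_pmf n t))"
  unfolding sampling_pmf_def by (subst set_Pi_pmf) (auto intro!: finite_PiE_dflt)

lemma sampling_marginal:
  assumes "i \<le> t" "j < n"
  shows "map_pmf (\<lambda>z. z (i, j)) (sampling_pmf n t) = bernoulli_pmf (1 / 2 ^ i)"
  using assms unfolding sampling_pmf_def by (subst Pi_pmf_component) auto

lemma sampling_prob:
  assumes "i \<le> t" "j < n"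
  shows "measure_pmf.prob (sampling_pmf n t) {z. z (i, j)} = 1 / 2 ^ i"
proof -
  have "measure_pmf.prob (sampling_pmf n t) {z. z (i, j)} =
      measure_pmf.prob (map_pmf (\<lambda>z. z (i, j)) (sampling_pmf n t)) {True}"
    by (simp add: vimage_def)
  also have "\<dots> = 1 / 2 ^ i" unfolding sampling_marginal[OF assms] by (simp add: measure_pmf_single)
  finally show ?thesis .
qed

text \<open>The inclusion probability \<open>1 / 2 ^ 0\<close> is one. This deterministic level
  handles sets of large coordinates with at most \<open>2 ^ p\<close> members.\<close>

lemma sampling_level_0:
  assumes "z \<in> set_pmf (sampling_pmf n t)" "j < n"
  shows "z (0, j)"
proof -
  have "z (0, j) \<in> set_pmf (map_pmf (\<lambda>z. z (0, j)) (sampling_pmf n t))" using assms by auto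
  then have "pmf (bernoulli_pmf 1) (z (0, j)) \<noteq> 0" using assms by (simp add: sampling_marginal set_pmf_iff)
  then show ?thesis by (cases "z (0, j)") auto
qed

text \<open>Chernoff's method: the mean of \<open>exp (- hits)\<close> is at most
  \<open>exp (- \<mu> * (1 - exp (- 1))) <= exp (- \<mu> / 2)\<close>, and Markov's inequality at
  \<open>exp (- \<mu> / 4)\<close> leaves the square root of that.\<close>

lemma sampling_few_hits:
  assumes i: "i \<le> t" and J: "J \<subseteq> {..<n}" "real (card J) = 2 ^ i * \<mu>"
  shows "measure_pmf.prob (sampling_pmf n t) {z. real (card {j \<in> J. z (i, j)}) \<le> \<mu> / 4} \<le> exp (- \<mu> / 4)"
proof -
  let ?p = "sampling_pmf n t"
  let ?A = "{..t} \<times> {..<n}"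
  define f where "f a b = (if a \<in> Pair i ` J \<and> b then exp (-1) else 1 :: real)" for a :: "nat \<times> nat" and b
  have sub: "Pair i ` J \<subseteq> ?A" using i J by auto
  have fe: "(\<Prod>a\<in>?A. f a (z a)) = exp (- real (card {j \<in> J. z (i, j)}))" for z
  proof -
    have "(\<Prod>a\<in>?A. f a (z a)) = (\<Prod>a\<in>Pair i ` {j \<in> J. z (i, j)}. exp (-1))"
      using sub by (intro prod.mono_neutral_cong_right) (auto simp: f_def)
    also have "\<dots> = exp (-1) ^ card {j \<in> J. z (i, j)}"
      by (simp add: card_image inj_on_def)
    also have "\<dots> = exp (- real (card {j \<in> J. z (i, j)}))" by (simp flip: exp_of_nat_mult)
    finally show ?thesis .
  qed
  have "measure_pmf.expectation ?p (\<lambda>z. \<Prod>a\<in>?A. f a (z a)) =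
      (\<Prod>a\<in>?A. measure_pmf.expectation ((\<lambda>(i, j). bernoulli_pmf (1 / 2 ^ i)) a) (f a))"
    unfolding sampling_pmf_def
    by (rule expectation_prod_Pi_pmf) (auto intro!: integrable_measure_pmf_finite simp: f_def)
  also have "\<dots> = (\<Prod>a\<in>Pair i ` J. 1 - (1 - exp (-1)) / 2 ^ i)"
    using sub by (intro prod.mono_neutral_cong_right) (auto simp: f_def field_simps)
  also have "\<dots> = (1 - (1 - exp (-1)) / 2 ^ i) ^ card J" by (simp add: card_image inj_on_def)
  also have "\<dots> \<le> exp (- ((1 - exp (-1)) / 2 ^ i)) ^ card J"
  proof (rule power_mono)
    show "1 - (1 - exp (-1)) / 2 ^ i \<le> exp (- ((1 - exp (-1)) / 2 ^ i) :: real)"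
      using exp_ge_add_one_self[of "- ((1 - exp (-1)) / 2 ^ i)"] by simp
    have "1 - exp (-1) \<le> (2 ^ i :: real)" using one_le_power[of "2::real" i] exp_gt_zero[of "-1"] by linarith
    then show "0 \<le> 1 - (1 - exp (-1)) / (2 ^ i :: real)" by simp
  qed
  also have "\<dots> = exp (- (\<mu> * (1 - exp (-1))))"
    unfolding exp_of_nat_mult[symmetric] J(2) by simp
  also have "\<dots> \<le> exp (- \<mu> / 2)"
  proof -
    have "0 \<le> \<mu>" using J(2) by (metis of_nat_0_le_iff zero_le_mult_iff zero_less_power zero_less_numeral less_le_not_le)
    moreover have "exp (-1) \<le> (1 / 2 :: real)"
      using exp_ge_add_one_self[of 1] by (simp add: exp_minus field_simps)
    ultimately have "\<mu> * (1 / 2) \<le> \<mu> * (1 - exp (-1))" by (intro mult_left_mono) auto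
    then show ?thesis by simp
  qed
  finally have E: "measure_pmf.expectation ?p (\<lambda>z. exp (- real (card {j \<in> J. z (i, j)}))) \<le> exp (- \<mu> / 2)"
    by (simp only: fe)
  have "(\<integral>\<^sup>+z. ennreal (exp (- real (card {j \<in> J. z (i, j)}))) \<partial>measure_pmf ?p) \<le> ennreal (exp (- \<mu> / 2))"
    using E by (subst nn_integral_eq_integral) (auto intro!: integrable_measure_pmf_finite finite_set_sampling ennreal_leI)
  then have "measure_pmf.prob ?p {z. exp (- \<mu> / 4) \<le> exp (- real (card {j \<in> J. z (i, j)}))} \<le> exp (- \<mu> / 2) / exp (- \<mu> / 4)"
    by (rule pmf_markov) auto
  also have "exp (- \<mu> / 2) / exp (- \<mu> / 4) = exp (- \<mu> / 4)" by (simp flip: exp_diff)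
  finally show ?thesis by simp
qed

section \<open>Lower bounds for the sampled stack\<close>

context sym_norm
begin

lemma sum_sq_ge_card:
  assumes "J \<subseteq> {..<n}" "\<And>j. j \<in> J \<Longrightarrow> \<alpha> \<le> \<bar>y j\<bar>" "0 \<le> \<alpha>"
  shows "real (card {j \<in> J. P j}) * \<alpha>\<^sup>2 \<le> (\<Sum>j<n. of_bool (P j) * (y j)\<^sup>2)"
proof -
  have "real (card {j \<in> J. P j}) * \<alpha>\<^sup>2 = (\<Sum>j\<in>{j \<in> J. P j}. \<alpha>\<^sup>2)" by simp
  also have "\<dots> \<le> (\<Sum>j\<in>{j \<in> J. P j}. of_bool (P j) * (y j)\<^sup>2)"
  proof (rule sum_mono)
    fix j assume j: "j \<in> {j \<in> J. P j}"
    then have "\<alpha>\<^sup>2 \<le> \<bar>y j\<bar>\<^sup>2" using assms by (intro power_mono) auto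
    then show "\<alpha>\<^sup>2 \<le> of_bool (P j) * (y j)\<^sup>2" using j by simp
  qed
  also have "\<dots> \<le> (\<Sum>j<n. of_bool (P j) * (y j)\<^sup>2)" using assms(1) by (intro sum_mono2) auto
  finally show ?thesis .
qed

text \<open>The number \<open>T\<close> of levels stays a parameter: the net argument runs with
  \<open>T = q <= n\<close>, as its crude error bound requires, and monotonicity in \<open>T\<close>
  passes to all \<open>t + 1\<close> levels.\<close>

abbreviation sketch_sq :: "nat \<Rightarrow> (nat \<times> nat \<Rightarrow> bool) \<Rightarrow> (nat \<Rightarrow> real) \<Rightarrow> real" where
  "sketch_sq T z y \<equiv> sqn (n * T) (stacked n (\<lambda>i. W (2 ^ i)) z y)"

lemma sketch_sq_ge_level:
  assumes "i < T"
  shows "(W (2 ^ i))\<^sup>2 * (\<Sum>j<n. of_bool (z (i, j)) * (y j)\<^sup>2) \<le> sketch_sq T z y"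
proof -
  have "(W (2 ^ i))\<^sup>2 * (\<Sum>j<n. of_bool (z (i, j)) * (y j)\<^sup>2) = (\<Sum>j<n. (W (2 ^ i))\<^sup>2 * of_bool (z (i, j)) * (y j)\<^sup>2)"
    by (simp only: sum_distrib_left mult.assoc)
  also have "\<dots> \<le> sketch_sq T z y" unfolding sqn_stacked[OF dim_pos]
    using assms by (intro member_le_sum[of i "{..<T}" "\<lambda>i. \<Sum>j<n. (W (2 ^ i))\<^sup>2 * of_bool (z (i, j)) * (y j)\<^sup>2"]) (auto intro!: sum_nonneg)
  finally show ?thesis .
qed

lemma W_pow_le: "b \<le> a \<Longrightarrow> W (2 ^ a) \<le> 2 ^ (a - b) * W (2 ^ b)"
  using W_mult[of "2 ^ (a - b)" "2 ^ b"] by (simp flip: power_add)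

text \<open>Moving from level \<open>k\<close> to \<open>k - p\<close> costs at most
  \<open>2 ^ p\<close> in the weight, so \<open>2 ^ (2 * p)\<close> in its square, of which
  \<open>2 ^ p / 4\<close> hits win back all but \<open>4 * 2 ^ p\<close>. If \<open>k <= p\<close>,
  level 0 sees all of \<open>J\<close> and loses only \<open>2 ^ k\<close>.\<close>

lemma sketch_sq_ge_of_hits:
  assumes J: "J \<subseteq> {..<n}" "card J = 2 ^ k" "\<And>j. j \<in> J \<Longrightarrow> \<alpha> \<le> \<bar>x j\<bar>" "0 \<le> \<alpha>" and k: "k < T"
    and hits: "k \<le> p \<and> (\<forall>j<n. z (0, j)) \<or> p < k \<and> 2 ^ p / 4 \<le> real (card {j \<in> J. z (k - p, j)})"
  shows "(\<alpha> * W (2 ^ k))\<^sup>2 \<le> 4 * 2 ^ p * sketch_sq T z x"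
  using hits
proof (elim disjE conjE)
  assume kp: "k \<le> p" and z: "\<forall>j<n. z (0, j)"
  have "(W (2 ^ k))\<^sup>2 \<le> (2 ^ k * W 1)\<^sup>2" using W_pow_le[of 0 k] W_nonneg by (intro power_mono) auto
  then have "(\<alpha> * W (2 ^ k))\<^sup>2 \<le> \<alpha>\<^sup>2 * (2 ^ k * W 1)\<^sup>2"
    unfolding power_mult_distrib[of \<alpha>] by (intro mult_left_mono) auto
  also have "\<dots> = 2 ^ k * ((W (2 ^ 0))\<^sup>2 * (real (card {j \<in> J. z (0, j)}) * \<alpha>\<^sup>2))"
  proof -
    have "{j \<in> J. z (0, j)} = J" using z J by auto
    then show ?thesis using J(2) by (simp add: power2_eq_square)
  qed
  also have "\<dots> \<le> 2 ^ k * ((W (2 ^ 0))\<^sup>2 * (\<Sum>j<n. of_bool (z (0, j)) * (x j)\<^sup>2))"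
    using sum_sq_ge_card[OF J(1,3,4)] by (intro mult_left_mono) auto
  also have "\<dots> \<le> 2 ^ k * sketch_sq T z x" using k by (intro mult_left_mono sketch_sq_ge_level) auto
  also have "\<dots> \<le> (4 * 2 ^ p) * sketch_sq T z x"
  proof (rule mult_right_mono)
    have "(2::real) ^ k \<le> 2 ^ p" using kp by simp
    then show "(2::real) ^ k \<le> 4 * 2 ^ p" using zero_le_power[of "2::real" p] by linarith
  qed simp
  finally show ?thesis .
next
  assume kp: "p < k" and h: "2 ^ p / 4 \<le> real (card {j \<in> J. z (k - p, j)})"
  let ?i = "k - p"
  have "W (2 ^ k) \<le> 2 ^ p * W (2 ^ ?i)" using W_pow_le[of ?i k] kp by simp
  then have "(W (2 ^ k))\<^sup>2 \<le> (2 ^ p * W (2 ^ ?i))\<^sup>2" using W_nonneg by (intro power_mono) auto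
  then have "(\<alpha> * W (2 ^ k))\<^sup>2 \<le> \<alpha>\<^sup>2 * (2 ^ p * W (2 ^ ?i))\<^sup>2"
    unfolding power_mult_distrib[of \<alpha>] by (intro mult_left_mono) auto
  also have "\<dots> = 4 * 2 ^ p * ((W (2 ^ ?i))\<^sup>2 * ((2 ^ p / 4) * \<alpha>\<^sup>2))"
    by (simp add: power_mult_distrib power2_eq_square)
  also have "\<dots> \<le> 4 * 2 ^ p * ((W (2 ^ ?i))\<^sup>2 * (\<Sum>j<n. of_bool (z (?i, j)) * (x j)\<^sup>2))"
    using order_trans[OF mult_right_mono[OF h zero_le_power2] sum_sq_ge_card[OF J(1,3,4)]]
    by (intro mult_left_mono) auto
  also have "\<dots> \<le> 4 * 2 ^ p * sketch_sq T z x" using k kp by (intro mult_left_mono sketch_sq_ge_level) auto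
  finally show ?thesis .
qed

text \<open>When \<open>n\<close> itself is at most \<open>2 ^ p\<close>, level 0 serves all vectors
  at once and no randomness is involved.\<close>

lemma sketch_lower_level_0:
  assumes q: "n < 2 ^ q" "n \<le> 2 ^ p" and T: "q \<le> T" and z: "\<And>j. j < n \<Longrightarrow> z (0, j)"
  shows "(L x)\<^sup>2 \<le> 4 * (real q)\<^sup>2 * 2 ^ p * sketch_sq T z x"
proof -
  obtain k J \<alpha> where J: "2 ^ k \<le> n" "J \<subseteq> {..<n}" "card J = 2 ^ k" "0 \<le> \<alpha>" "\<And>j. j \<in> J \<Longrightarrow> \<alpha> \<le> \<bar>x j\<bar>"
    and Lx: "L x \<le> real q * (\<alpha> * W (2 ^ k))"
    using dyadic_large_set[OF q(1), of x] by blast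
  have "(2::nat) ^ k \<le> 2 ^ p" using J(1) q(2) by linarith
  then have kp: "k \<le> p" by simp
  have "(2::nat) ^ k < 2 ^ q" using J(1) q(1) by linarith
  then have kT: "k < T" using T by simp
  have "(L x)\<^sup>2 \<le> (real q * (\<alpha> * W (2 ^ k)))\<^sup>2" using Lx nonneg by (intro power_mono) auto
  also have "\<dots> = (real q)\<^sup>2 * (\<alpha> * W (2 ^ k))\<^sup>2" by (rule power_mult_distrib)
  also have "\<dots> \<le> (real q)\<^sup>2 * (4 * 2 ^ p * sketch_sq T z x)"
    using sketch_sq_ge_of_hits[where p = p and z = z, OF J(2,3,5,4) kT] kp z by (intro mult_left_mono) auto
  finally show ?thesis by (simp add: mult_ac)
qed

text \<open>Level \<open>k - p\<close> hits \<open>2 ^ p\<close> members of \<open>J\<close> on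
  average and a quarter of these suffices; for \<open>k <= p\<close> the failure event is
  null.\<close>

lemma sketch_lower_single:
  assumes q: "n < 2 ^ q" and T: "q \<le> T" "T \<le> t + 1"
  shows "measure_pmf.prob (sampling_pmf n t) {z. \<not> (L x)\<^sup>2 \<le> 4 * (real q)\<^sup>2 * 2 ^ p * sketch_sq T z x} \<le> exp (- (2 ^ p) / 4)"
proof -
  obtain k J \<alpha> where J: "2 ^ k \<le> n" "J \<subseteq> {..<n}" "card J = 2 ^ k" "0 \<le> \<alpha>" "\<And>j. j \<in> J \<Longrightarrow> \<alpha> \<le> \<bar>x j\<bar>"
    and Lx: "L x \<le> real q * (\<alpha> * W (2 ^ k))"
    using dyadic_large_set[OF q(1), of x] by blast
  have "(2::nat) ^ k < 2 ^ q" using J(1) q(1) by linarith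
  then have kT: "k < T" using T by simp
  let ?i = "k - p"
  have key: "(L x)\<^sup>2 \<le> 4 * (real q)\<^sup>2 * 2 ^ p * sketch_sq T z x"
    if hits: "k \<le> p \<and> (\<forall>j<n. z (0, j)) \<or> p < k \<and> 2 ^ p / 4 \<le> real (card {j \<in> J. z (k - p, j)})" for z
  proof -
    have "(L x)\<^sup>2 \<le> (real q * (\<alpha> * W (2 ^ k)))\<^sup>2" using Lx nonneg by (intro power_mono) auto
    also have "\<dots> = (real q)\<^sup>2 * (\<alpha> * W (2 ^ k))\<^sup>2" by (rule power_mult_distrib)
    also have "\<dots> \<le> (real q)\<^sup>2 * (4 * 2 ^ p * sketch_sq T z x)"
      using sketch_sq_ge_of_hits[OF J(2,3,5,4) kT hits] by (intro mult_left_mono) auto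
    finally show ?thesis by (simp add: mult_ac)
  qed
  show ?thesis
  proof (cases "k \<le> p")
    case True
    have "measure_pmf.prob (sampling_pmf n t) {z. \<not> (L x)\<^sup>2 \<le> 4 * (real q)\<^sup>2 * 2 ^ p * sketch_sq T z x} = 0"
    proof (subst measure_pmf.prob_eq_0)
      show "AE z in sampling_pmf n t. z \<notin> {z. \<not> (L x)\<^sup>2 \<le> 4 * (real q)\<^sup>2 * 2 ^ p * sketch_sq T z x}"
      proof (rule AE_pmfI)
        fix z assume "z \<in> set_pmf (sampling_pmf n t)"
        then have "\<forall>j<n. z (0, j)" using sampling_level_0 by blast
        then show "z \<notin> {z. \<not> (L x)\<^sup>2 \<le> 4 * (real q)\<^sup>2 * 2 ^ p * sketch_sq T z x}"
          using key True by simp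
      qed
    qed auto
    then show ?thesis by simp
  next
    case False
    have "measure_pmf.prob (sampling_pmf n t) {z. \<not> (L x)\<^sup>2 \<le> 4 * (real q)\<^sup>2 * 2 ^ p * sketch_sq T z x} \<le>
        measure_pmf.prob (sampling_pmf n t) {z. real (card {j \<in> J. z (?i, j)}) \<le> 2 ^ p / 4}"
      using key False by (intro measure_pmf.finite_measure_mono) (auto intro: ccontr)
    also have "\<dots> \<le> exp (- (2 ^ p) / 4)"
    proof (rule sampling_few_hits[OF _ J(2)])
      show "?i \<le> t" using kT T by simp
      show "real (card J) = 2 ^ ?i * 2 ^ p" unfolding J(3) power_add[symmetric] using False by simp
    qed
    finally show ?thesis .
  qed
qed

text \<open>Holds for every outcome \<open>z\<close>, so the discretisation error of the net costs
  no probability; the polynomial loss is paid for by the fineness of the net.\<close>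

lemma sketch_sq_crude:
  assumes "T \<le> n"
  shows "sketch_sq T z x \<le> (real n ^ 2 * L x)\<^sup>2"
proof -
  have "sketch_sq T z x \<le> (\<Sum>i<T. \<Sum>j<n. (real n)\<^sup>2 * (L x)\<^sup>2)"
    unfolding sqn_stacked[OF dim_pos]
  proof (intro sum_mono)
    fix i j assume j: "j \<in> {..<n}"
    have "W (2 ^ i) \<le> real n * W 1"
    proof (cases "2 ^ i \<le> n")
      case True
      have "W (2 ^ i) \<le> W n" by (rule W_mono[OF True])
      then show ?thesis using W_mult[of n 1] by simp
    next
      case False
      then show ?thesis using W_ge_dim[of "2 ^ i"] W_mult[of n 1] by simp
    qed
    then have "W (2 ^ i) * \<bar>x j\<bar> \<le> real n * (\<bar>x j\<bar> * W 1)"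
      using mult_right_mono[of "W (2 ^ i)" "real n * W 1" "\<bar>x j\<bar>"] by (simp add: mult_ac)
    also have "\<dots> \<le> real n * L x" using coord_le[of j x] j by (intro mult_left_mono) auto
    finally have "(W (2 ^ i) * \<bar>x j\<bar>)\<^sup>2 \<le> (real n * L x)\<^sup>2" using W_nonneg by (intro power_mono) auto
    moreover have "(W (2 ^ i))\<^sup>2 * of_bool (z (i, j)) * (x j)\<^sup>2 \<le> (W (2 ^ i) * \<bar>x j\<bar>)\<^sup>2"
      by (simp add: power_mult_distrib)
    ultimately show "(W (2 ^ i))\<^sup>2 * of_bool (z (i, j)) * (x j)\<^sup>2 \<le> (real n)\<^sup>2 * (L x)\<^sup>2"
      by (simp add: power_mult_distrib)
  qed
  also have "\<dots> = real T * (real n * ((real n)\<^sup>2 * (L x)\<^sup>2))" by simp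
  also have "\<dots> \<le> real n * (real n * ((real n)\<^sup>2 * (L x)\<^sup>2))" using assms by (intro mult_right_mono) auto
  also have "\<dots> = (real n ^ 2 * L x)\<^sup>2" by (simp add: power2_eq_square)
  finally show ?thesis .
qed

lemma sketch_sq_mono: "T \<le> T' \<Longrightarrow> sketch_sq T z x \<le> sketch_sq T' z x"
  unfolding sqn_stacked[OF dim_pos] by (intro sum_mono2) (auto intro!: sum_nonneg)

lemma sketch_sq_scale: "sketch_sq T z (\<lambda>i. c * x i) = c\<^sup>2 * sketch_sq T z x"
  unfolding stacked_scale sqn_scale ..

lemma sketch_sq_triangle:
  "sqrt (sketch_sq T z (\<lambda>i. x i + y i)) \<le> sqrt (sketch_sq T z x) + sqrt (sketch_sq T z y)"
  unfolding stacked_add by (rule sqrt_sqn_triangle)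

lemma lincomb_le:
  assumes "\<And>k. k < r \<Longrightarrow> L (u k) \<le> 1"
  shows "L (lincomb_n r u e) \<le> (\<Sum>k<r. \<bar>e k\<bar>)"
proof -
  have "L (lincomb_n r u e) \<le> (\<Sum>k<r. L (\<lambda>i. e k * u k i))"
    unfolding lincomb_n_def by (rule sum_le) simp
  also have "\<dots> \<le> (\<Sum>k<r. \<bar>e k\<bar> * 1)"
    unfolding scale using assms by (intro sum_mono mult_left_mono) auto
  finally show ?thesis by simp
qed

text \<open>There are at most \<open>2 ^ (11 * q)\<close> grid values per coordinate, so at most
  \<open>2 ^ (11 * q * d)\<close> net points, against a failure probability of at most
  \<open>2 ^ (- 32 * q * d)\<close>; the constant 128 is four times this 32.\<close>

lemma net_failure_bound:
  assumes n: "n < 2 ^ q" and p: "p < q" "128 * d * q \<le> 2 ^ p" and d: "d \<ge> 1" "r \<le> d"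
  shows "real ((4 * (8 * n ^ 4 * 2 ^ p) + 1) ^ r) * exp (- (2 ^ p) / 4) \<le> 0.01"
proof -
  have q1: "q \<ge> 1" using p by simp
  have pw: "(2::real) ^ a * (1 / 2) ^ (a + b) = (1 / 2) ^ b" for a b :: nat
    by (simp add: power_add power_one_over)
  have "4 * (8 * n ^ 4 * 2 ^ p) + 1 \<le> 2 ^ 6 * (n ^ 4 * 2 ^ p)" using dim_pos by (simp add: Suc_le_eq)
  also have "\<dots> \<le> 2 ^ 6 * ((2 ^ q) ^ 4 * 2 ^ q)"
    using n p by (intro mult_le_mono power_mono power_increasing) auto
  also have "\<dots> = 2 ^ (6 + (q * 4 + q))" by (simp only: power_add power_mult)
  also have "\<dots> \<le> 2 ^ (11 * q)" using q1 by (intro power_increasing) auto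
  finally have "(4 * (8 * n ^ 4 * 2 ^ p) + 1) ^ r \<le> (2 ^ (11 * q)) ^ r" by (rule power_mono) simp
  also have "\<dots> \<le> (2 ^ (11 * q)) ^ d" using d by (intro power_increasing) auto
  finally have 1: "real ((4 * (8 * n ^ 4 * 2 ^ p) + 1) ^ r) \<le> real (2 ^ (11 * q * d))"
    by (simp only: power_mult of_nat_le_iff)
  have "real (128 * d * q) \<le> real (2 ^ p)" using p(2) by (simp only: of_nat_le_iff)
  then have "exp (- (2 ^ p) / 4) \<le> exp (real (32 * d * q) * (- 1) :: real)" by simp
  also have "\<dots> = exp (- 1) ^ (32 * d * q)" by (rule exp_of_nat_mult)
  also have "\<dots> \<le> (1 / 2) ^ (32 * d * q)"
    using exp_ge_add_one_self[of 1] by (intro power_mono) (auto simp: exp_minus field_simps)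
  finally have 2: "exp (- (2 ^ p) / 4) \<le> (1 / 2 :: real) ^ (32 * d * q)" .
  have "real ((4 * (8 * n ^ 4 * 2 ^ p) + 1) ^ r) * exp (- (2 ^ p) / 4) \<le> 2 ^ (11 * q * d) * (1 / 2) ^ (32 * d * q)"
    using 1 2 by (intro mult_mono) auto
  also have "32 * d * q = 11 * q * d + 21 * (q * d)" by simp
  also have "2 ^ (11 * q * d) * (1 / 2 :: real) ^ (11 * q * d + 21 * (q * d)) = (1 / 2) ^ (21 * (q * d))"
    by (rule pw)
  also have "\<dots> \<le> (1 / 2) ^ 21" using q1 d by (intro power_decreasing) auto
  also have "\<dots> \<le> 0.01" by (simp add: power_one_over)
  finally show ?thesis .
qed

text \<open>A grid in the Auerbach coordinates is used, because there a unit vector has coordinates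
  at most 2 and a coordinate error translates directly into an error in \<open>L\<close>.\<close>

lemma sketch_lower_all:
  fixes v :: "nat \<Rightarrow> nat \<Rightarrow> real"
  assumes q: "n < 2 ^ q" "2 ^ q \<le> 2 * n" "q \<le> t + 1" and d: "d \<ge> 1"
  shows "measure_pmf.prob (sampling_pmf n t)
    {z. \<forall>c. (L (lincomb_n d v c))\<^sup>2 \<le> 4096 * real q ^ 3 * real d * sketch_sq (t + 1) z (lincomb_n d v c)} \<ge> 0.99"
    (is "measure_pmf.prob ?P ?G \<ge> _")
proof -
  have q1: "q \<ge> 1" using q(1) dim_pos by (cases q) auto
  have "q - 1 < 2 ^ (q - 1)" by (rule less_exp)
  moreover have "2 * 2 ^ (q - 1) = (2::nat) ^ q" using q1 by (cases q) auto
  ultimately have qn: "q \<le> n" using q(2) by linarith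
  have "1 \<le> 128 * d * q" using d q1 by simp
  \<comment> \<open>\<open>128 * d * q\<close> is what \<open>net_failure_bound\<close> asks for;
    rounding it up to a power of two at most doubles it.\<close>
  from ex_power_ivl1[OF _ this, of 2] obtain p0 where p0: "2 ^ p0 \<le> 128 * d * q" "128 * d * q < 2 ^ (p0 + 1)" by auto
  define p where "p = p0 + 1"
  have p: "128 * d * q \<le> 2 ^ p" "2 ^ p \<le> 256 * d * q" using p0 by (auto simp: p_def)
  have pr: "(2::real) ^ p \<le> 256 * real d * real q"
  proof -
    have "real (2 ^ p) \<le> real (256 * d * q)" using p(2) by (simp only: of_nat_le_iff)
    then show ?thesis by simp
  qed
  show ?thesis
  proof (cases "n \<le> 2 ^ p")
    case True
    have "measure_pmf.prob ?P ?G = 1"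
    proof (subst measure_pmf.prob_eq_1)
      show "AE z in ?P. z \<in> ?G"
      proof (rule AE_pmfI)
        fix z assume "z \<in> set_pmf ?P"
        then have z: "\<And>j. j < n \<Longrightarrow> z (0, j)" by (rule sampling_level_0)
        have "(L x)\<^sup>2 \<le> 4096 * real q ^ 3 * real d * sketch_sq (t + 1) z x" for x
        proof -
          have "(L x)\<^sup>2 \<le> 4 * (real q)\<^sup>2 * 2 ^ p * sketch_sq (t + 1) z x"
            by (rule sketch_lower_level_0[where z = z, OF q(1) True q(3) z])
          also have "\<dots> \<le> 4 * (real q)\<^sup>2 * (256 * real d * real q) * sketch_sq (t + 1) z x"
            using pr by (intro mult_right_mono mult_left_mono) auto
          also have "\<dots> = (1024 * real q ^ 3 * real d) * sketch_sq (t + 1) z x" by (simp add: power2_eq_square power3_eq_cube)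
          also have "\<dots> \<le> (4096 * real q ^ 3 * real d) * sketch_sq (t + 1) z x"
            by (intro mult_right_mono) auto
          finally show ?thesis .
        qed
        then show "z \<in> ?G" by simp
      qed
    qed auto
    then show ?thesis by simp
  next
    case False
    \<comment> \<open>From here on \<open>d\<close> and \<open>2 ^ p\<close> are below
      \<open>n\<close>, so every quantity entering the net size is polynomial in
      \<open>n\<close>.\<close>
    then have pn: "2 ^ p < n" by simp
    have "(2::nat) ^ p < 2 ^ q" using pn q(1) by linarith
    then have pq: "p < q" by simp
    have "d * 1 \<le> d * (128 * q)" using q1 by (intro mult_le_mono) auto
    moreover have "d * (128 * q) = 128 * d * q" by (simp only: mult_ac)
    ultimately have dn: "d < n" using p(1) pn by linarith
    obtain r u where r: "r \<le> d" and u: "\<And>k. k < r \<Longrightarrow> L (u k) \<le> 1"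
      and cov: "\<And>c. \<exists>e. (\<forall>i<n. lincomb_n d v c i = lincomb_n r u e i) \<and> (\<forall>k<r. \<bar>e k\<bar> \<le> 2 * L (lincomb_n d v c))"
      using auerbach_basis[of d v] by metis
    \<comment> \<open>The mesh \<open>1 / M\<close> is so fine that the rounding error, multiplied
      by the crude factor \<open>n\<^sup>2\<close> and by the loss
      \<open>b <= 2 * n * 2 ^ p\<close>, contributes at most \<open>1 / 4\<close>.\<close>
    define M :: nat where "M = 8 * n ^ 4 * 2 ^ p"
    have M: "M \<ge> 1" using dim_pos by (simp add: M_def)
    define Z where "Z = {..<r} \<rightarrow>\<^sub>E {- int (2 * M)..int (2 * M)}"
    have finZ: "finite Z" by (auto simp: Z_def intro!: finite_PiE)
    have cZ: "card Z = (4 * M + 1) ^ r" by (simp add: Z_def card_PiE nat_add_distrib nat_mult_distrib)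
    define y where "y \<zeta> = lincomb_n r u (\<lambda>k. real_of_int (\<zeta> k) / real M)" for \<zeta>
    define B where "B \<zeta> = {z. \<not> (L (y \<zeta>))\<^sup>2 \<le> 4 * (real q)\<^sup>2 * 2 ^ p * sketch_sq q z (y \<zeta>)}" for \<zeta>
    have "measure_pmf.prob ?P (\<Union>\<zeta>\<in>Z. B \<zeta>) \<le> (\<Sum>\<zeta>\<in>Z. measure_pmf.prob ?P (B \<zeta>))"
      by (rule measure_pmf.finite_measure_subadditive_finite[OF finZ]) auto
    also have "\<dots> \<le> (\<Sum>\<zeta>\<in>Z. exp (- (2 ^ p) / 4))"
      unfolding B_def using q by (intro sum_mono sketch_lower_single) auto
    also have "\<dots> = real ((4 * M + 1) ^ r) * exp (- (2 ^ p) / 4)" by (simp add: cZ)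
    also have "\<dots> \<le> 0.01" unfolding M_def by (rule net_failure_bound[OF q(1) pq p(1) d r])
    finally have bad: "measure_pmf.prob ?P (\<Union>\<zeta>\<in>Z. B \<zeta>) \<le> 0.01" .
    have good: "z \<in> ?G" if z: "z \<notin> (\<Union>\<zeta>\<in>Z. B \<zeta>)" for z
    proof -
      have "(L (lincomb_n d v c))\<^sup>2 \<le> 4096 * real q ^ 3 * real d * sketch_sq q z (lincomb_n d v c)" for c
      proof (cases "L (lincomb_n d v c) = 0")
        case False
        define s where "s = L (lincomb_n d v c)"
        have s: "s > 0" using False nonneg by (simp add: s_def order.strict_iff_order)
        obtain e where e: "\<And>i. i < n \<Longrightarrow> lincomb_n d v c i = lincomb_n r u e i" "\<And>k. k < r \<Longrightarrow> \<bar>e k\<bar> \<le> 2 * s"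
          using cov[of c] unfolding s_def by blast
        define x where "x i = (1 / s) * lincomb_n d v c i" for i
        have Lx: "L x = 1" unfolding x_def scale using s by (simp add: s_def)
        define \<zeta> where "\<zeta> = (\<lambda>k\<in>{..<r}. trunc_real (real M * (e k / s)))"
        have \<zeta>k: "\<zeta> k \<in> {- int (2 * M)..int (2 * M)}" "\<bar>e k / s - real_of_int (\<zeta> k) / real M\<bar> \<le> 1 / real M" if k: "k < r" for k
        proof -
          let ?a = "real M * (e k / s)"
          have "\<bar>?a\<bar> = real M * (\<bar>e k\<bar> / s)" using s by (simp add: abs_mult)
          also have "\<dots> \<le> real M * 2" using e(2)[OF k] s by (intro mult_left_mono) (auto simp: pos_divide_le_eq)
          finally have "\<bar>real_of_int (trunc_real ?a)\<bar> \<le> real_of_int (int (2 * M))" using trunc_real(1)[of ?a] by simp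
          then have "\<bar>trunc_real ?a\<bar> \<le> int (2 * M)" by linarith
          then show "\<zeta> k \<in> {- int (2 * M)..int (2 * M)}" using k by (auto simp: \<zeta>_def)
          have "e k / s - real_of_int (\<zeta> k) / real M = (?a - real_of_int (trunc_real ?a)) / real M"
            using k M by (simp add: \<zeta>_def diff_divide_distrib)
          then have "\<bar>e k / s - real_of_int (\<zeta> k) / real M\<bar> = \<bar>?a - real_of_int (trunc_real ?a)\<bar> / real M"
            by (simp only: abs_divide abs_of_nat)
          also have "\<dots> \<le> 1 / real M" by (intro divide_right_mono trunc_real(2)) simp
          finally show "\<bar>e k / s - real_of_int (\<zeta> k) / real M\<bar> \<le> 1 / real M" .
        qed
        have "\<zeta> \<in> Z" using \<zeta>k(1) by (auto simp: Z_def \<zeta>_def)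
        then have By: "(L (y \<zeta>))\<^sup>2 \<le> 4 * (real q)\<^sup>2 * 2 ^ p * sketch_sq q z (y \<zeta>)" using z by (auto simp: B_def)
        \<comment> \<open>The loss of \<open>sketch_lower_single\<close>, after taking square
          roots.\<close>
        define b where "b = 2 * real q * sqrt (2 ^ p)"
        have b2: "b\<^sup>2 = 4 * (real q)\<^sup>2 * 2 ^ p" by (simp add: b_def power_mult_distrib)
        have b0: "b \<ge> 0" by (simp add: b_def)
        have Ly: "L (y \<zeta>) \<le> b * sqrt (sketch_sq q z (y \<zeta>))"
        proof (rule power2_le_imp_le)
          show "(L (y \<zeta>))\<^sup>2 \<le> (b * sqrt (sketch_sq q z (y \<zeta>)))\<^sup>2" using By by (simp add: power_mult_distrib b2)
        qed (use b0 in simp)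
        define w where "w i = y \<zeta> i - x i" for i
        have w: "w i = lincomb_n r u (\<lambda>k. - (e k / s - real_of_int (\<zeta> k) / real M)) i" if "i < n" for i
          unfolding w_def y_def x_def e(1)[OF that]
          by (simp add: lincomb_n_def sum_distrib_left sum_subtractf algebra_simps)
        define \<eta> where "\<eta> = real n / real M"
        have "L w = L (lincomb_n r u (\<lambda>k. - (e k / s - real_of_int (\<zeta> k) / real M)))" by (rule cong[OF w])
        also have "\<dots> \<le> (\<Sum>k<r. \<bar>- (e k / s - real_of_int (\<zeta> k) / real M)\<bar>)" by (rule lincomb_le[OF u])
        also have "\<dots> \<le> (\<Sum>k<r. 1 / real M)" using \<zeta>k(2) by (intro sum_mono) (simp add: abs_minus_commute)
        also have "\<dots> \<le> \<eta>" using r dn by (simp add: \<eta>_def divide_right_mono)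
        finally have Lw: "L w \<le> \<eta>" .
        have n0: "real n \<ge> 1" using dim_pos by simp
        have \<eta>eq: "\<eta> = 1 / (8 * real n ^ 3 * 2 ^ p)"
          using n0 by (simp add: \<eta>_def M_def power3_eq_cube power4_eq_xxxx)
        have one: "1 \<le> real n ^ 3 * 2 ^ p"
          using mult_mono[of 1 "real n ^ 3" 1 "2 ^ p"] n0 by simp
        have \<eta>4: "\<eta> \<le> 1 / 8"
          unfolding \<eta>eq using one by (simp add: divide_simps)
        have "sqrt (2 ^ p) \<le> (2::real) ^ p" by (intro real_le_lsqrt) (auto simp: power2_eq_square)
        then have "b \<le> 2 * real n * 2 ^ p" unfolding b_def using qn by (intro mult_mono) auto
        then have "b * ((real n)\<^sup>2 * \<eta>) \<le> 2 * real n * 2 ^ p * ((real n)\<^sup>2 * \<eta>)" by (intro mult_right_mono) (auto simp: \<eta>_def)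
        also have "\<dots> = 1 / 4" unfolding \<eta>eq using n0 by (simp add: power3_eq_cube power2_eq_square)
        finally have b\<eta>: "b * ((real n)\<^sup>2 * \<eta>) \<le> 1 / 4" .
        have "sqrt (sketch_sq q z w) \<le> (real n)\<^sup>2 * L w"
          using sketch_sq_crude[OF qn, of z w] nonneg by (intro real_le_lsqrt) auto
        also have "\<dots> \<le> (real n)\<^sup>2 * \<eta>" using Lw by (intro mult_left_mono) auto
        finally have Qw: "sqrt (sketch_sq q z w) \<le> (real n)\<^sup>2 * \<eta>" .
        have "L x \<le> L (y \<zeta>) + L w"
          using triangle[of "y \<zeta>" "\<lambda>i. - w i"] minus[of w] by (simp add: w_def)
        then have "1 - \<eta> \<le> L (y \<zeta>)" using Lx Lw by simp
        also have "\<dots> \<le> b * sqrt (sketch_sq q z (y \<zeta>))" by (rule Ly)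
        also have "\<dots> \<le> b * (sqrt (sketch_sq q z x) + sqrt (sketch_sq q z w))"
          using sketch_sq_triangle[of q z x w] b0 by (intro mult_left_mono) (simp_all add: w_def)
        also have "\<dots> \<le> b * (sqrt (sketch_sq q z x) + (real n)\<^sup>2 * \<eta>)"
          using Qw b0 by (intro mult_left_mono) auto
        \<comment> \<open>After both errors \<open>1 - 1 / 8 - 1 / 4\<close> remains, more than
          \<open>1 / 2\<close>.\<close>
        finally have "1 / 2 \<le> b * sqrt (sketch_sq q z x)" using \<eta>4 b\<eta> by (simp add: distrib_left)
        then have "(1 / 2)\<^sup>2 \<le> (b * sqrt (sketch_sq q z x))\<^sup>2" by (rule power_mono) simp
        then have "1 \<le> 4 * (4 * (real q)\<^sup>2 * 2 ^ p * sketch_sq q z x)" by (simp add: power_mult_distrib b2 power2_eq_square[of "1 / 2 :: real"])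
        also have "\<dots> \<le> 4 * (4 * (real q)\<^sup>2 * (256 * real d * real q) * sketch_sq q z x)"
          using pr by (intro mult_left_mono mult_right_mono) auto
        also have "\<dots> = 4096 * real q ^ 3 * real d * sketch_sq q z x" by (simp add: power2_eq_square power3_eq_cube)
        also have "sketch_sq q z x = (1 / s)\<^sup>2 * sketch_sq q z (lincomb_n d v c)"
          unfolding x_def by (rule sketch_sq_scale)
        finally show ?thesis using s unfolding s_def[symmetric] by (simp add: power_divide pos_le_divide_eq)
      qed simp
      moreover have "sketch_sq q z (lincomb_n d v c) \<le> sketch_sq (t + 1) z (lincomb_n d v c)" for c
        by (rule sketch_sq_mono[OF q(3)])
      ultimately have "(L (lincomb_n d v c))\<^sup>2 \<le> 4096 * real q ^ 3 * real d * sketch_sq (t + 1) z (lincomb_n d v c)" for c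
        by (rule order_trans[OF _ mult_left_mono]) simp
      then show ?thesis by simp
    qed
    have "1 - measure_pmf.prob ?P (\<Union>\<zeta>\<in>Z. B \<zeta>) = measure_pmf.prob ?P (- (\<Union>\<zeta>\<in>Z. B \<zeta>))"
      by (subst measure_pmf.prob_compl[symmetric]) (auto simp: Compl_eq_Diff_UNIV)
    also have "\<dots> \<le> measure_pmf.prob ?P ?G" using good by (intro measure_pmf.finite_measure_mono) auto
    finally show ?thesis using bad by simp
  qed
qed

end

section \<open>The sampling matrices: dilation\<close>

lemma sum_inverse_le_ln:
  assumes "n \<ge> 1"
  shows "(\<Sum>\<rho><n. 1 / real (\<rho> + 1)) \<le> 1 + ln (real n)"
  using assms
proof (induction n rule: nat_induct_at_least)
  case (Suc n)
  have "ln (real n / real (n + 1)) \<le> real n / real (n + 1) - 1" using Suc by (intro ln_le_minus_one) auto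
  also have "\<dots> = - 1 / real (n + 1)" by (simp add: field_simps)
  finally have "1 / real (n + 1) \<le> ln (real (n + 1)) - ln (real n)" using Suc by (simp add: ln_div)
  then show ?case using Suc.IH by simp
qed simp

context sym_norm
begin

text \<open>A coordinate of decreasing rank \<open>\<rho> + 1\<close> should not be sampled at a level \<open>i\<close> with
  \<open>2 ^ i \<ge> K (\<rho> + 1)\<close>; away from this event the expectation is controlled.\<close>

lemma sketch_upper_column:
  assumes K: "K \<ge> 1"
    and H: "\<And>s r. 1 \<le> s \<Longrightarrow> s \<le> r \<Longrightarrow> r \<le> n \<Longrightarrow> (W s)\<^sup>2 / real s \<le> H * ((W r)\<^sup>2 / real r)"
  shows "\<exists>Bad Tr. measure_pmf.prob (sampling_pmf n t) Bad \<le> real (t + 1) / K \<and>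
    (\<forall>z. z \<notin> Bad \<longrightarrow> sketch_sq (t + 1) z u = Tr z) \<and> (\<forall>z. 0 \<le> Tr z) \<and>
    (\<integral>\<^sup>+z. ennreal (Tr z) \<partial>sampling_pmf n t) \<le> ennreal (real (t + 1) * ((H + 4 * K) * (1 + ln (real n)) * (L u)\<^sup>2))"
proof -
  let ?P = "sampling_pmf n t"
  obtain \<sigma> where \<sigma>: "\<sigma> permutes {..<n}" and mon: "\<And>i j. i \<le> j \<Longrightarrow> j < n \<Longrightarrow> \<bar>u (\<sigma> j)\<bar> \<le> \<bar>u (\<sigma> i)\<bar>"
    using sorted_perm_exists[of u] by blast
  have \<sigma>n: "\<sigma> \<rho> < n" if "\<rho> < n" for \<rho> using permutes_in_image[OF \<sigma>] that by auto
  have H0: "H \<ge> 0"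
  proof -
    have "0 < (W 1)\<^sup>2" using W_1_pos by simp
    moreover have "(W 1)\<^sup>2 \<le> H * (W 1)\<^sup>2" using H[of 1 1] dim_pos by simp
    ultimately have "0 < H * (W 1)\<^sup>2" by linarith
    then show ?thesis using W_1_pos by (simp add: zero_less_mult_iff)
  qed
  define g where "g i \<rho> \<longleftrightarrow> 2 ^ i < K * real (\<rho> + 1)" for i \<rho> :: nat
  define Bad where "Bad = (\<Union>i\<in>{..t}. \<Union>\<rho>\<in>{\<rho>. \<rho> < n \<and> \<not> g i \<rho>}. {z. z (i, \<sigma> \<rho>)})"
  \<comment> \<open>The stack without the forbidden samples. It equals the true stack outside
    \<open>Bad\<close>, but its expectation is controlled, whereas a large coordinate kept at high
    levels could dominate that of the full stack.\<close>
  define Tr where "Tr z = (\<Sum>i<t + 1. \<Sum>\<rho><n. (W (2 ^ i))\<^sup>2 * (of_bool (g i \<rho>) * of_bool (z (i, \<sigma> \<rho>))) * (u (\<sigma> \<rho>))\<^sup>2)" for z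
  have "measure_pmf.prob ?P Bad \<le> (\<Sum>i\<in>{..t}. measure_pmf.prob ?P (\<Union>\<rho>\<in>{\<rho>. \<rho> < n \<and> \<not> g i \<rho>}. {z. z (i, \<sigma> \<rho>)}))"
    unfolding Bad_def by (rule measure_pmf.finite_measure_subadditive_finite) auto
  also have "\<dots> \<le> (\<Sum>i\<in>{..t}. 1 / K)"
  proof (rule sum_mono)
    fix i assume i: "i \<in> {..t}"
    have "measure_pmf.prob ?P (\<Union>\<rho>\<in>{\<rho>. \<rho> < n \<and> \<not> g i \<rho>}. {z. z (i, \<sigma> \<rho>)}) \<le>
        (\<Sum>\<rho>\<in>{\<rho>. \<rho> < n \<and> \<not> g i \<rho>}. measure_pmf.prob ?P {z. z (i, \<sigma> \<rho>)})"
      by (rule measure_pmf.finite_measure_subadditive_finite) auto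
    also have "\<dots> = real (card {\<rho>. \<rho> < n \<and> \<not> g i \<rho>}) * (1 / 2 ^ i)"
      using i \<sigma>n by (simp add: sampling_prob)
    also have "\<dots> \<le> (2 ^ i / K) * (1 / 2 ^ i)"
    proof (rule mult_right_mono)
      \<comment> \<open>At most \<open>2 ^ i / K\<close> ranks are forbidden at level
        \<open>i\<close>, and each of them is sampled with probability
        \<open>1 / 2 ^ i\<close>.\<close>
      have "{\<rho>. \<rho> < n \<and> \<not> g i \<rho>} \<subseteq> {..<nat \<lfloor>2 ^ i / K\<rfloor>}"
      proof
        fix \<rho> assume "\<rho> \<in> {\<rho>. \<rho> < n \<and> \<not> g i \<rho>}"
        then have "K * real (\<rho> + 1) \<le> 2 ^ i" by (simp add: g_def)
        then have "real (\<rho> + 1) \<le> 2 ^ i / K" using K by (simp add: field_simps)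
        then have "int (\<rho> + 1) \<le> \<lfloor>2 ^ i / K\<rfloor>" by (simp add: le_floor_iff)
        then show "\<rho> \<in> {..<nat \<lfloor>2 ^ i / K\<rfloor>}" by simp
      qed
      then have "card {\<rho>. \<rho> < n \<and> \<not> g i \<rho>} \<le> nat \<lfloor>2 ^ i / K\<rfloor>"
        using card_mono[OF finite_lessThan] by fastforce
      then have "real (card {\<rho>. \<rho> < n \<and> \<not> g i \<rho>}) \<le> real (nat \<lfloor>2 ^ i / K\<rfloor>)" by (simp only: of_nat_le_iff)
      also have "\<dots> \<le> 2 ^ i / K" using K by (intro of_nat_floor) auto
      finally show "real (card {\<rho>. \<rho> < n \<and> \<not> g i \<rho>}) \<le> 2 ^ i / K" .
    qed simp
    also have "\<dots> = 1 / K" by simp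
    finally show "measure_pmf.prob ?P (\<Union>\<rho>\<in>{\<rho>. \<rho> < n \<and> \<not> g i \<rho>}. {z. z (i, \<sigma> \<rho>)}) \<le> 1 / K" .
  qed
  also have "\<dots> = real (t + 1) / K" by simp
  finally have 1: "measure_pmf.prob ?P Bad \<le> real (t + 1) / K" .
  have 2: "sketch_sq (t + 1) z u = Tr z" if z: "z \<notin> Bad" for z
  proof -
    have "sketch_sq (t + 1) z u = (\<Sum>i<t + 1. \<Sum>\<rho><n. (W (2 ^ i))\<^sup>2 * of_bool (z (i, \<sigma> \<rho>)) * (u (\<sigma> \<rho>))\<^sup>2)"
      unfolding sqn_stacked[OF dim_pos]
    proof (rule sum.cong[OF refl])
      fix i
      show "(\<Sum>j<n. (W (2 ^ i))\<^sup>2 * of_bool (z (i, j)) * (u j)\<^sup>2) =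
          (\<Sum>\<rho><n. (W (2 ^ i))\<^sup>2 * of_bool (z (i, \<sigma> \<rho>)) * (u (\<sigma> \<rho>))\<^sup>2)"
        using sum.permute[OF \<sigma>, of "\<lambda>j. (W (2 ^ i))\<^sup>2 * of_bool (z (i, j)) * (u j)\<^sup>2"] by (simp add: comp_def)
    qed
    also have "\<dots> = Tr z"
      unfolding Tr_def
    proof (intro sum.cong refl)
      fix i \<rho> assume "i \<in> {..<t + 1}" "\<rho> \<in> {..<n}"
      then have "of_bool (z (i, \<sigma> \<rho>)) = (of_bool (g i \<rho>) * of_bool (z (i, \<sigma> \<rho>)) :: real)"
        using z by (auto simp: Bad_def)
      then show "(W (2 ^ i))\<^sup>2 * of_bool (z (i, \<sigma> \<rho>)) * (u (\<sigma> \<rho>))\<^sup>2 =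
          (W (2 ^ i))\<^sup>2 * (of_bool (g i \<rho>) * of_bool (z (i, \<sigma> \<rho>))) * (u (\<sigma> \<rho>))\<^sup>2" by simp
    qed
    finally show ?thesis .
  qed
  have 3: "0 \<le> Tr z" for z unfolding Tr_def by (intro sum_nonneg) auto
  \<comment> \<open>\<open>W_rank_le\<close> bounds the coordinate by
    \<open>L u / W (\<rho> + 1)\<close>, which leaves a comparison of
    \<open>W (2 ^ i)\<^sup>2 / 2 ^ i\<close> with the same quotient at \<open>\<rho> + 1\<close>.
    For \<open>2 ^ i <= \<rho> + 1\<close> this is the hypothesis on \<open>H\<close>; above, linear
    growth costs \<open>4 * 2 ^ i / (\<rho> + 1)\<close>, which \<open>g\<close> keeps below
    \<open>4 * K\<close>.\<close>
  have summand: "of_bool (g i \<rho>) * (W (2 ^ i))\<^sup>2 * (1 / 2 ^ i) * (u (\<sigma> \<rho>))\<^sup>2 \<le> (H + 4 * K) * (1 / real (\<rho> + 1)) * (L u)\<^sup>2"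
    if \<rho>: "\<rho> < n" for i \<rho>
  proof -
    let ?r = "\<rho> + 1"
    have Wr: "W ?r > 0" by (rule W_pos) simp
    have "\<bar>u (\<sigma> \<rho>)\<bar> * W ?r \<le> L u" by (rule W_rank_le[where x = u, OF \<sigma> mon \<rho>])
    then have "(\<bar>u (\<sigma> \<rho>)\<bar> * W ?r)\<^sup>2 \<le> (L u)\<^sup>2" using Wr by (intro power_mono) auto
    then have ub: "(u (\<sigma> \<rho>))\<^sup>2 * (W ?r)\<^sup>2 \<le> (L u)\<^sup>2" by (simp add: power_mult_distrib)
    have "of_bool (g i \<rho>) * ((W (2 ^ i))\<^sup>2 / 2 ^ i) \<le> (H + 4 * K) * ((W ?r)\<^sup>2 / real ?r)"
    proof (cases "2 ^ i \<le> ?r")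
      case True
      have "(W (2 ^ i))\<^sup>2 / real (2 ^ i) \<le> H * ((W ?r)\<^sup>2 / real ?r)"
        by (rule H) (use True \<rho> in auto)
      also have "\<dots> \<le> (H + 4 * K) * ((W ?r)\<^sup>2 / real ?r)" using K by (intro mult_right_mono) auto
      finally have "(W (2 ^ i))\<^sup>2 / 2 ^ i \<le> (H + 4 * K) * ((W ?r)\<^sup>2 / real ?r)" by simp
      moreover have "of_bool (g i \<rho>) * ((W (2 ^ i))\<^sup>2 / 2 ^ i) \<le> (W (2 ^ i))\<^sup>2 / 2 ^ i" by simp
      ultimately show ?thesis by linarith
    next
      case False
      show ?thesis
      proof (cases "g i \<rho>")
        case True
        have "W (2 ^ i) \<le> 2 * (real (2 ^ i) / real ?r) * W ?r" using False by (intro W_ratio) auto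
        then have "(W (2 ^ i))\<^sup>2 \<le> (2 * (real (2 ^ i) / real ?r) * W ?r)\<^sup>2" using W_nonneg by (intro power_mono) auto
        then have "(W (2 ^ i))\<^sup>2 / 2 ^ i \<le> (2 * (real (2 ^ i) / real ?r) * W ?r)\<^sup>2 / 2 ^ i" by (intro divide_right_mono) auto
        also have "\<dots> = (4 * (2 ^ i / real ?r)) * ((W ?r)\<^sup>2 / real ?r)"
          by (simp add: power_mult_distrib power_divide power2_eq_square)
        also have "\<dots> \<le> (H + 4 * K) * ((W ?r)\<^sup>2 / real ?r)"
        proof (rule mult_right_mono)
          have "2 ^ i / real ?r \<le> K" using True by (simp add: g_def pos_divide_le_eq)
          then show "4 * (2 ^ i / real ?r) \<le> H + 4 * K" using H0 by simp
        qed simp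
        finally show ?thesis using True by simp
      qed (use H0 K in simp)
    qed
    then have "of_bool (g i \<rho>) * ((W (2 ^ i))\<^sup>2 / 2 ^ i) * (u (\<sigma> \<rho>))\<^sup>2 \<le> (H + 4 * K) * ((W ?r)\<^sup>2 / real ?r) * (u (\<sigma> \<rho>))\<^sup>2"
      by (rule mult_right_mono) simp
    also have "\<dots> = ((H + 4 * K) * (1 / real ?r)) * ((u (\<sigma> \<rho>))\<^sup>2 * (W ?r)\<^sup>2)" by simp
    also have "\<dots> \<le> ((H + 4 * K) * (1 / real ?r)) * (L u)\<^sup>2" using H0 K by (intro mult_left_mono ub) auto
    finally show ?thesis by simp
  qed
  have "(\<integral>\<^sup>+z. ennreal (Tr z) \<partial>?P) = ennreal (measure_pmf.expectation ?P Tr)"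
    using 3 by (intro nn_integral_eq_integral integrable_measure_pmf_finite finite_set_sampling) auto
  also have "measure_pmf.expectation ?P Tr = (\<Sum>i<t + 1. \<Sum>\<rho><n. of_bool (g i \<rho>) * (W (2 ^ i))\<^sup>2 * (1 / 2 ^ i) * (u (\<sigma> \<rho>))\<^sup>2)"
  proof -
    have I: "integrable (measure_pmf ?P) f" for f :: "_ \<Rightarrow> real"
      by (rule integrable_measure_pmf_finite[OF finite_set_sampling])
    have "measure_pmf.expectation ?P Tr = (\<Sum>i<t + 1. \<Sum>\<rho><n. measure_pmf.expectation ?P
        (\<lambda>z. (W (2 ^ i))\<^sup>2 * (of_bool (g i \<rho>) * of_bool (z (i, \<sigma> \<rho>))) * (u (\<sigma> \<rho>))\<^sup>2))"
      unfolding Tr_def by (simp add: I Bochner_Integration.integral_sum del: sum.lessThan_Suc)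
    also have "\<dots> = (\<Sum>i<t + 1. \<Sum>\<rho><n. of_bool (g i \<rho>) * (W (2 ^ i))\<^sup>2 * (1 / 2 ^ i) * (u (\<sigma> \<rho>))\<^sup>2)"
    proof (intro sum.cong refl)
      fix i \<rho> assume i: "i \<in> {..<t + 1}" and \<rho>: "\<rho> \<in> {..<n}"
      have "measure_pmf.expectation ?P (\<lambda>z. of_bool (z (i, \<sigma> \<rho>))) = measure_pmf.expectation ?P (indicator {z. z (i, \<sigma> \<rho>)} :: _ \<Rightarrow> real)"
        by (intro Bochner_Integration.integral_cong) (auto simp: indicator_def)
      also have "\<dots> = measure_pmf.prob ?P {z. z (i, \<sigma> \<rho>)}" by simp
      also have "\<dots> = 1 / 2 ^ i" using i \<rho> \<sigma>n by (intro sampling_prob) auto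
      finally show "measure_pmf.expectation ?P (\<lambda>z. (W (2 ^ i))\<^sup>2 * (of_bool (g i \<rho>) * of_bool (z (i, \<sigma> \<rho>))) * (u (\<sigma> \<rho>))\<^sup>2) =
          of_bool (g i \<rho>) * (W (2 ^ i))\<^sup>2 * (1 / 2 ^ i) * (u (\<sigma> \<rho>))\<^sup>2"
        by simp
    qed
    finally show ?thesis .
  qed
  also have "ennreal (\<Sum>i<t + 1. \<Sum>\<rho><n. of_bool (g i \<rho>) * (W (2 ^ i))\<^sup>2 * (1 / 2 ^ i) * (u (\<sigma> \<rho>))\<^sup>2) \<le>
      ennreal (real (t + 1) * ((H + 4 * K) * (1 + ln (real n)) * (L u)\<^sup>2))"
  proof (rule ennreal_leI)
    have "(\<Sum>i<t + 1. \<Sum>\<rho><n. of_bool (g i \<rho>) * (W (2 ^ i))\<^sup>2 * (1 / 2 ^ i) * (u (\<sigma> \<rho>))\<^sup>2) \<le>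
        (\<Sum>i<t + 1. \<Sum>\<rho><n. (H + 4 * K) * (1 / real (\<rho> + 1)) * (L u)\<^sup>2)"
      by (intro sum_mono summand) simp
    also have "\<dots> = real (t + 1) * ((H + 4 * K) * (\<Sum>\<rho><n. 1 / real (\<rho> + 1)) * (L u)\<^sup>2)"
      by (simp only: sum_constant card_lessThan sum_distrib_left sum_distrib_right of_nat_id)
    \<comment> \<open>The factors \<open>1 / (\<rho> + 1)\<close> form a harmonic sum, which costs
      one logarithm; the other one is the number of levels.\<close>
    also have "\<dots> \<le> real (t + 1) * ((H + 4 * K) * (1 + ln (real n)) * (L u)\<^sup>2)"
      using sum_inverse_le_ln[OF dim_pos] H0 K by (intro mult_left_mono mult_right_mono) auto
    finally show "(\<Sum>i<t + 1. \<Sum>\<rho><n. of_bool (g i \<rho>) * (W (2 ^ i))\<^sup>2 * (1 / 2 ^ i) * (u (\<sigma> \<rho>))\<^sup>2) \<le>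
        real (t + 1) * ((H + 4 * K) * (1 + ln (real n)) * (L u)\<^sup>2)" .
  qed
  finally have 4: "(\<integral>\<^sup>+z. ennreal (Tr z) \<partial>?P) \<le> ennreal (real (t + 1) * ((H + 4 * K) * (1 + ln (real n)) * (L u)\<^sup>2))" .
  show ?thesis using 1 2 3 4 by blast
qed

lemma sketch_sq_lincomb_le:
  "sqrt (sketch_sq T z (lincomb_n r u e)) \<le> (\<Sum>k<r. \<bar>e k\<bar> * sqrt (sketch_sq T z (u k)))"
proof (induction r)
  case 0
  show ?case by (simp add: lincomb_n_def sqn_def stacked_def)
next
  case (Suc r)
  have "lincomb_n (Suc r) u e = (\<lambda>i. lincomb_n r u e i + e r * u r i)" by (simp add: lincomb_n_def)
  then have "sqrt (sketch_sq T z (lincomb_n (Suc r) u e)) \<le>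
      sqrt (sketch_sq T z (lincomb_n r u e)) + sqrt (sketch_sq T z (\<lambda>i. e r * u r i))"
    using sketch_sq_triangle[of T z "lincomb_n r u e" "\<lambda>i. e r * u r i"] by simp
  also have "sqrt (sketch_sq T z (\<lambda>i. e r * u r i)) = \<bar>e r\<bar> * sqrt (sketch_sq T z (u r))"
    by (simp add: sketch_sq_scale real_sqrt_mult)
  finally show ?case using Suc by simp
qed

text \<open>Markov's inequality is applied once, to the sum of the truncated stacks over the basis,
  with threshold \<open>100 * d * X\<close>. Coordinates of size at most \<open>2 * L\<close> and
  Cauchy-Schwarz then give \<open>4 * d * (100 * d * X)\<close>, for all \<open>c\<close>
  simultaneously.\<close>

lemma sketch_upper_all:
  fixes v :: "nat \<Rightarrow> nat \<Rightarrow> real"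
  assumes d: "d \<ge> 1"
    and H: "\<And>s r. 1 \<le> s \<Longrightarrow> s \<le> r \<Longrightarrow> r \<le> n \<Longrightarrow> (W s)\<^sup>2 / real s \<le> H * ((W r)\<^sup>2 / real r)"
  shows "measure_pmf.prob (sampling_pmf n t)
    {z. \<forall>c. sketch_sq (t + 1) z (lincomb_n d v c) \<le>
      400 * (real d)\<^sup>2 * real (t + 1) * (1 + ln (real n)) * (H + 400 * real d * real (t + 1)) * (L (lincomb_n d v c))\<^sup>2} \<ge> 0.98"
    (is "measure_pmf.prob ?P ?G \<ge> _")
proof -
  obtain r u where r: "r \<le> d" and u: "\<And>k. k < r \<Longrightarrow> L (u k) \<le> 1"
    and cov: "\<And>c. \<exists>e. (\<forall>i<n. lincomb_n d v c i = lincomb_n r u e i) \<and> (\<forall>k<r. \<bar>e k\<bar> \<le> 2 * L (lincomb_n d v c))"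
    using auerbach_basis[of d v] by metis
  \<comment> \<open>Makes the bad events of at most \<open>d\<close> basis vectors, each over
    \<open>t + 1\<close> levels, have total probability at most \<open>1 / 100\<close>.\<close>
  define K where "K = 100 * real d * real (t + 1)"
  have K1: "K \<ge> 1"
  proof -
    have "1 * 1 \<le> (100 * real d) * real (t + 1)" using d by (intro mult_mono) auto
    then show ?thesis by (simp add: K_def)
  qed
  define X where "X = real (t + 1) * ((H + 4 * K) * (1 + ln (real n)))"
  have H0: "H \<ge> 0"
  proof -
    have "0 < (W 1)\<^sup>2" using W_1_pos by simp
    moreover have "(W 1)\<^sup>2 \<le> H * (W 1)\<^sup>2" using H[of 1 1] dim_pos by simp
    ultimately have "0 < H * (W 1)\<^sup>2" by linarith
    then show ?thesis using W_1_pos by (simp add: zero_less_mult_iff)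
  qed
  have ln0: "ln (real n) \<ge> 0" using dim_pos by simp
  have X0: "X > 0" unfolding X_def using H0 K1 ln0 by (intro mult_pos_pos add_nonneg_pos add_pos_nonneg) auto
  have "\<exists>Bad Tr. measure_pmf.prob ?P Bad \<le> real (t + 1) / K \<and>
    (\<forall>z. z \<notin> Bad \<longrightarrow> sketch_sq (t + 1) z (u k) = Tr z) \<and> (\<forall>z. 0 \<le> Tr z) \<and>
    (\<integral>\<^sup>+z. ennreal (Tr z) \<partial>?P) \<le> ennreal (real (t + 1) * ((H + 4 * K) * (1 + ln (real n)) * (L (u k))\<^sup>2))" for k
    by (rule sketch_upper_column[OF K1 H])
  then obtain Bad Tr where Bad: "\<And>k. measure_pmf.prob ?P (Bad k) \<le> real (t + 1) / K"
    and eq: "\<And>k z. z \<notin> Bad k \<Longrightarrow> sketch_sq (t + 1) z (u k) = Tr k z" and Tr0: "\<And>k z. 0 \<le> Tr k z"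
    and E: "\<And>k. (\<integral>\<^sup>+z. ennreal (Tr k z) \<partial>?P) \<le> ennreal (real (t + 1) * ((H + 4 * K) * (1 + ln (real n)) * (L (u k))\<^sup>2))"
    by metis
  have "measure_pmf.prob ?P (\<Union>k\<in>{..<r}. Bad k) \<le> (\<Sum>k<r. measure_pmf.prob ?P (Bad k))"
    by (rule measure_pmf.finite_measure_subadditive_finite) auto
  also have "\<dots> \<le> (\<Sum>k<r. real (t + 1) / K)" by (intro sum_mono Bad)
  also have "\<dots> \<le> real d * (real (t + 1) / K)" using r K1 by (simp add: mult_right_mono divide_right_mono)
  also have "\<dots> = 0.01" using d by (simp add: K_def)
  finally have bad1: "measure_pmf.prob ?P (\<Union>k\<in>{..<r}. Bad k) \<le> 0.01" .
  have "(\<integral>\<^sup>+z. ennreal (\<Sum>k<r. Tr k z) \<partial>?P) = (\<Sum>k<r. \<integral>\<^sup>+z. ennreal (Tr k z) \<partial>?P)"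
    using Tr0 by (subst nn_integral_sum[symmetric]) (auto simp: sum_ennreal)
  also have "\<dots> \<le> (\<Sum>k<r. ennreal X)"
  proof (rule sum_mono)
    fix k assume "k \<in> {..<r}"
    then have "(L (u k))\<^sup>2 \<le> 1" using u[of k] nonneg[of "u k"] by (simp add: power_le_one)
    then have "real (t + 1) * ((H + 4 * K) * (1 + ln (real n)) * (L (u k))\<^sup>2) \<le> real (t + 1) * ((H + 4 * K) * (1 + ln (real n)) * 1)"
      using H0 K1 ln0 by (intro mult_left_mono) auto
    then show "(\<integral>\<^sup>+z. ennreal (Tr k z) \<partial>?P) \<le> ennreal X"
      by (intro order_trans[OF E] ennreal_leI) (simp add: X_def)
  qed
  also have "\<dots> = ennreal (real r * X)" using X0 by (simp add: ennreal_mult ennreal_of_nat_eq_real_of_nat)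
  also have "\<dots> \<le> ennreal (real d * X)" using r X0 by (intro ennreal_leI mult_right_mono) auto
  finally have "measure_pmf.prob ?P {z. 100 * (real d * X) \<le> (\<Sum>k<r. Tr k z)} \<le> real d * X / (100 * (real d * X))"
    by (rule pmf_markov) (use d X0 in auto)
  then have bad2: "measure_pmf.prob ?P {z. 100 * (real d * X) \<le> (\<Sum>k<r. Tr k z)} \<le> 0.01"
    using d X0 by simp
  define B where "B = (\<Union>k\<in>{..<r}. Bad k) \<union> {z. 100 * (real d * X) \<le> (\<Sum>k<r. Tr k z)}"
  have "measure_pmf.prob ?P B \<le> 2 / 100"
    unfolding B_def using bad1 bad2 measure_Un_le[of "\<Union>k\<in>{..<r}. Bad k" "measure_pmf ?P" "{z. 100 * (real d * X) \<le> (\<Sum>k<r. Tr k z)}"]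
    by simp
  moreover have "1 - measure_pmf.prob ?P B = measure_pmf.prob ?P (- B)"
    by (subst measure_pmf.prob_compl[symmetric]) (auto simp: Compl_eq_Diff_UNIV)
  moreover have "measure_pmf.prob ?P (- B) \<le> measure_pmf.prob ?P ?G"
  proof (rule measure_pmf.finite_measure_mono)
    show "- B \<subseteq> ?G"
    proof (intro subsetI CollectI allI)
      fix z c assume z: "z \<in> - B"
      let ?y = "lincomb_n d v c"
      let ?Q = "\<lambda>y. sketch_sq (t + 1) z y"
      obtain e where e: "\<And>i. i < n \<Longrightarrow> ?y i = lincomb_n r u e i" "\<And>k. k < r \<Longrightarrow> \<bar>e k\<bar> \<le> 2 * L ?y"
        using cov[of c] by blast
      have "(\<Sum>k<r. ?Q (u k)) = (\<Sum>k<r. Tr k z)" using z by (intro sum.cong refl eq) (auto simp: B_def)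
      also have "\<dots> \<le> 100 * (real d * X)" using z by (simp add: B_def)
      finally have sumQ: "(\<Sum>k<r. ?Q (u k)) \<le> 100 * (real d * X)" .
      have "?Q ?y = ?Q (lincomb_n r u e)" using stacked_cong[OF dim_pos e(1)] by simp
      then have "sqrt (?Q ?y) \<le> (\<Sum>k<r. \<bar>e k\<bar> * sqrt (?Q (u k)))" using sketch_sq_lincomb_le[of "t + 1" z r u e] by simp
      also have "\<dots> \<le> (\<Sum>k<r. (2 * L ?y) * sqrt (?Q (u k)))" using e(2) by (intro sum_mono mult_right_mono) auto
      also have "\<dots> = 2 * L ?y * (\<Sum>k<r. 1 * sqrt (?Q (u k)))" by (simp add: sum_distrib_left)
      finally have "(sqrt (?Q ?y))\<^sup>2 \<le> (2 * L ?y * (\<Sum>k<r. 1 * sqrt (?Q (u k))))\<^sup>2" by (rule power_mono) simp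
      then have "?Q ?y \<le> 4 * (L ?y)\<^sup>2 * (\<Sum>k<r. 1 * sqrt (?Q (u k)))\<^sup>2" by (simp add: power_mult_distrib)
      also have "\<dots> \<le> 4 * (L ?y)\<^sup>2 * ((\<Sum>k<r. 1\<^sup>2) * (\<Sum>k<r. (sqrt (?Q (u k)))\<^sup>2))"
        by (intro mult_left_mono Cauchy_Schwarz_ineq_sum) auto
      also have "\<dots> = 4 * (L ?y)\<^sup>2 * (real r * (\<Sum>k<r. ?Q (u k)))" by simp
      also have "\<dots> \<le> 4 * (L ?y)\<^sup>2 * (real d * (100 * (real d * X)))"
        using r sumQ X0 by (intro mult_left_mono mult_mono) (auto intro!: sum_nonneg)
      also have "\<dots> = 400 * (real d)\<^sup>2 * real (t + 1) * (1 + ln (real n)) * (H + 400 * real d * real (t + 1)) * (L ?y)\<^sup>2"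
        unfolding X_def K_def by (simp only: power2_eq_square mult_ac) (simp add: mult_ac)
      finally show "?Q ?y \<le> 400 * (real d)\<^sup>2 * real (t + 1) * (1 + ln (real n)) * (H + 400 * real d * real (t + 1)) * (L ?y)\<^sup>2" .
    qed
  qed auto
  ultimately have "98 / 100 \<le> measure_pmf.prob ?P ?G" by linarith
  then show ?thesis by simp
qed

end

section \<open>The distortion of the sketch\<close>

lemma stacked_mat_mult_vec:
  assumes n: "n \<ge> 1" and y: "y \<in> carrier_vec n" and r: "r < n * (t + 1)"
  shows "(stacked_mat n t l z *\<^sub>v y) $ r = stacked n (level_weight n l) z (\<lambda>j. y $ j) r"
proof -
  have rm: "r mod n < n" using n by simp
  have "(stacked_mat n t l z *\<^sub>v y) $ r =
      (\<Sum>c = 0..<n. (level_weight n l (r div n) \<cdot>\<^sub>m sampling_mat n z (r div n)) $$ (r mod n, c) * y $ c)"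
    using y r by (simp add: stacked_mat_def scalar_prod_def)
  also have "\<dots> = (\<Sum>c = 0..<n. if c = r mod n then level_weight n l (r div n) * of_bool (z (r div n, c)) * y $ c else 0)"
    using rm by (intro sum.cong refl) (auto simp: sampling_mat_def mat_diag_def)
  also have "\<dots> = stacked n (level_weight n l) z (\<lambda>j. y $ j) r" using rm by (simp add: stacked_def)
  finally show ?thesis .
qed

lemma count_sketch_carrier: "count_sketch m N h s \<in> carrier_mat m N"
  unfolding count_sketch_def by (rule mult_carrier_mat[OF _ mat_diag_dim]) simp

lemma count_sketch_mult_vec:
  assumes x: "x \<in> carrier_vec N" and b: "b < m"
  shows "(count_sketch m N h s *\<^sub>v x) $ b = bucket N h s (\<lambda>j. x $ j) b"
proof -
  have e: "count_sketch m N h s $$ (b, j) = of_bool (h j = b) * s j" if j: "j < N" for j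
    unfolding count_sketch_def using b j by (subst mat_diag_mult_right[where nr = m]) auto
  have "(count_sketch m N h s *\<^sub>v x) $ b = (\<Sum>j = 0..<N. count_sketch m N h s $$ (b, j) * x $ j)"
    using x b count_sketch_carrier[of m N h s] by (auto simp: scalar_prod_def)
  also have "\<dots> = bucket N h s (\<lambda>j. x $ j) b"
    unfolding bucket_def by (intro sum.cong) (auto simp: e)
  finally show ?thesis .
qed

text \<open>The image of a vector under the sketch, evaluated from the right without matrix
  products; \<open>sym_sketch_mult_vec\<close> makes the connection.\<close>

definition sketch_vec :: "nat \<Rightarrow> nat \<Rightarrow> nat \<Rightarrow> nat \<Rightarrow> (nat \<Rightarrow> real) \<Rightarrow> seed \<Rightarrow> (nat \<Rightarrow> real) \<Rightarrow> nat \<Rightarrow> real" where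
  "sketch_vec n t m m' w = (\<lambda>((z, h, s), g) y a.
     1 / sqrt (real m') * gauss_apply m g (bucket (n * (t + 1)) h s (stacked n w z y)) a)"

lemma sym_sketch_carrier: "sym_sketch n t m m' l \<omega> \<in> carrier_mat m' n"
  by (auto simp: sym_sketch_def gauss_sketch_def stacked_mat_def split: prod.splits)

lemma sym_sketch_mult_vec:
  assumes n: "n \<ge> 1" and y: "y \<in> carrier_vec n" and a: "a < m'"
  shows "(sym_sketch n t m m' l \<omega> *\<^sub>v y) $ a = sketch_vec n t m m' (level_weight n l) \<omega> (\<lambda>j. y $ j) a"
proof -
  obtain z h s g where \<omega>: "\<omega> = ((z, h, s), g)" by (metis surj_pair)
  let ?N = "n * (t + 1)"
  let ?G = "gauss_sketch m' m g" and ?C = "count_sketch m ?N h s" and ?S = "stacked_mat n t l z"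
  have G: "?G \<in> carrier_mat m' m" by (simp add: gauss_sketch_def)
  have C: "?C \<in> carrier_mat m ?N" by (rule count_sketch_carrier)
  have S: "?S \<in> carrier_mat ?N n" by (simp add: stacked_mat_def)
  have "(?G * ?C * ?S) *\<^sub>v y = ?G *\<^sub>v (?C *\<^sub>v (?S *\<^sub>v y))"
    using assoc_mult_mat_vec[OF mult_carrier_mat[OF G C] S y] assoc_mult_mat_vec[OF G C mult_mat_vec_carrier[OF S y]] by simp
  moreover have "(?G *\<^sub>v (?C *\<^sub>v (?S *\<^sub>v y))) $ a = (\<Sum>b = 0..<m. (1 / sqrt (real m') * g (a, b)) * (?C *\<^sub>v (?S *\<^sub>v y)) $ b)"
    using a C by (simp add: gauss_sketch_def scalar_prod_def)
  moreover have "(?C *\<^sub>v (?S *\<^sub>v y)) $ b = bucket ?N h s (stacked n (level_weight n l) z (\<lambda>j. y $ j)) b" if b: "b < m" for b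
  proof -
    have "?S *\<^sub>v y \<in> carrier_vec ?N" using S y by simp
    from count_sketch_mult_vec[OF this b]
    have "(?C *\<^sub>v (?S *\<^sub>v y)) $ b = bucket ?N h s (\<lambda>j. (?S *\<^sub>v y) $ j) b" .
    also have "\<dots> = bucket ?N h s (stacked n (level_weight n l) z (\<lambda>j. y $ j)) b"
      by (rule fun_cong[OF bucket_cong]) (rule stacked_mat_mult_vec[OF n y])
    finally show ?thesis .
  qed
  ultimately have "(sym_sketch n t m m' l \<omega> *\<^sub>v y) $ a =
      (\<Sum>b = 0..<m. (1 / sqrt (real m') * g (a, b)) * bucket ?N h s (stacked n (level_weight n l) z (\<lambda>j. y $ j)) b)"
    by (simp add: sym_sketch_def \<omega>)
  also have "\<dots> = sketch_vec n t m m' (level_weight n l) \<omega> (\<lambda>j. y $ j) a"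
    unfolding sketch_vec_def \<omega> gauss_apply_def prod.case sum_distrib_left
    by (intro sum.cong) auto
  finally show ?thesis .
qed

lemma l2_norm_eq: "l2_norm v = sqrt (sqn (dim_vec v) (\<lambda>i. v $ i))"
  by (simp add: l2_norm_def scalar_prod_def sqn_def power2_eq_square atLeast0LessThan)

lemma sketch_vec_cong:
  assumes "n \<ge> 1" "\<And>i. i < n \<Longrightarrow> x i = y i"
  shows "sketch_vec n t m m' w \<omega> x = sketch_vec n t m m' w \<omega> y"
  by (simp add: sketch_vec_def case_prod_beta stacked_cong[OF assms])

lemma mult_mat_vec_lincomb:
  assumes "A \<in> carrier_mat n d" "x \<in> carrier_vec d" "i < n"
  shows "(A *\<^sub>v x) $ i = lincomb_n d (\<lambda>j i. A $$ (i, j)) (\<lambda>j. x $ j) i"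
  using assms by (simp add: scalar_prod_def lincomb_n_def atLeast0LessThan mult.commute)

lemma l2_norm_sketch:
  assumes n: "n \<ge> 1" and A: "A \<in> carrier_mat n d" and x: "x \<in> carrier_vec d"
  shows "l2_norm ((sym_sketch n t m m' l \<omega> * A) *\<^sub>v x) =
    sqrt (sqn m' (sketch_vec n t m m' (level_weight n l) \<omega> (lincomb_n d (\<lambda>j i. A $$ (i, j)) (\<lambda>j. x $ j))))"
proof -
  let ?S = "sym_sketch n t m m' l \<omega>"
  have S: "?S \<in> carrier_mat m' n" by (rule sym_sketch_carrier)
  have Ax: "A *\<^sub>v x \<in> carrier_vec n" using A x by simp
  have "(?S * A) *\<^sub>v x = ?S *\<^sub>v (A *\<^sub>v x)" by (rule assoc_mult_mat_vec[OF S A x])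
  then have "l2_norm ((?S * A) *\<^sub>v x) = sqrt (sqn m' (\<lambda>a. (?S *\<^sub>v (A *\<^sub>v x)) $ a))"
    using S by (simp add: l2_norm_eq)
  also have "sqn m' (\<lambda>a. (?S *\<^sub>v (A *\<^sub>v x)) $ a) =
      sqn m' (sketch_vec n t m m' (level_weight n l) \<omega> (\<lambda>j. (A *\<^sub>v x) $ j))"
    by (rule sqn_cong) (rule sym_sketch_mult_vec[OF n Ax])
  also have "sketch_vec n t m m' (level_weight n l) \<omega> (\<lambda>j. (A *\<^sub>v x) $ j) =
      sketch_vec n t m m' (level_weight n l) \<omega> (lincomb_n d (\<lambda>j i. A $$ (i, j)) (\<lambda>j. x $ j))"
    by (rule sketch_vec_cong[OF n]) (rule mult_mat_vec_lincomb[OF A x])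
  finally show ?thesis .
qed

lemma vec_lincomb:
  assumes A: "A \<in> carrier_mat n d" and x: "x \<in> carrier_vec d"
  shows "vec n (lincomb_n d (\<lambda>j i. A $$ (i, j)) (\<lambda>j. x $ j)) = A *\<^sub>v x"
  using assms mult_mat_vec_lincomb[OF A x] by (intro eq_vecI) auto

section \<open>What the program computes on an actual input\<close>

lemma sum_nth_distinct:
  fixes f :: "'a \<Rightarrow> real"
  assumes "distinct es"
  shows "(\<Sum>e<length es. f (es ! e)) = (\<Sum>p\<in>set es. f p)"
  using bij_betw_nth[OF assms refl refl] by (rule sum.reindex_bij_betw)

lemma sketch_prog_output:
  assumes n: "n \<ge> 1" and A: "A \<in> carrier_mat n d" and es: "lists_nonzeros A es"
  shows "\<exists>\<sigma> k. exec sketch_prog (input_state n d t m m' l \<omega> A es) k \<sigma> \<and>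
    outputs_mat \<sigma> (sym_sketch n t m m' l \<omega> * A) \<and>
    k \<le> 2 + nnz A * (5 + Suc t * 5) + m' * (4 + d * (4 + m * 3))"
proof -
  obtain z h s g where \<omega>: "\<omega> = ((z, h, s), g)" by (metis surj_pair)
  let ?N = "n * (t + 1)"
  let ?w = "level_weight n l"
  obtain \<mu> \<rho> where st: "input_state n d t m m' l \<omega> A es = (\<mu>, \<rho>)" by fastforce
  have \<mu>: "\<mu> = (\<lambda>_ _ _. 0)
        (''n'' := cell n, ''d'' := cell d, ''t'' := cell t, ''m'' := cell m, ''m1'' := cell m',
         ''nnz'' := cell (length es),
         ''row'' := table1 (length es) (\<lambda>e. fst (es ! e)),
         ''col'' := table1 (length es) (\<lambda>e. snd (es ! e)),
         ''sample'' := table2 (t + 1) n (\<lambda>ij. of_bool (z ij)),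
         ''hash'' := table1 ?N h)"
    and \<rho>: "\<rho> = (\<lambda>_ _ _. 0)
        (''val'' := table1 (length es) (\<lambda>e. A $$ (es ! e)),
         ''weight'' := table1 (t + 1) ?w,
         ''sign'' := table1 ?N s,
         ''gauss'' := table2 m' m (\<lambda>ij. gauss_sketch m' m g $$ ij))"
    using st unfolding input_state_def \<omega> prod.case by (simp_all only: prod.inject)
  have mu: "\<mu> ''n'' 0 0 = n" "\<mu> ''d'' 0 0 = d" "\<mu> ''t'' 0 0 = t" "\<mu> ''m'' 0 0 = m" "\<mu> ''m1'' 0 0 = m'"
    "\<mu> ''nnz'' 0 0 = length es"
    and arr: "\<mu> ''row'' = table1 (length es) (\<lambda>e. fst (es ! e))" "\<mu> ''col'' = table1 (length es) (\<lambda>e. snd (es ! e))"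
    "\<mu> ''sample'' = table2 (t + 1) n (\<lambda>ij. of_bool (z ij))" "\<mu> ''hash'' = table1 ?N h"
    unfolding \<mu> by (simp_all add: cell_def)
  have rarr: "\<rho> ''val'' = table1 (length es) (\<lambda>e. A $$ (es ! e))" "\<rho> ''weight'' = table1 (t + 1) ?w"
    "\<rho> ''sign'' = table1 ?N s" "\<rho> ''gauss'' = table2 m' m (\<lambda>ij. gauss_sketch m' m g $$ ij)"
    unfolding \<rho> by simp_all
  interpret sketch_input \<mu> \<rho>
  proof
    show "\<rho> ''acc'' = (\<lambda>_ _. 0)" "\<rho> ''out'' = (\<lambda>_ _. 0)" unfolding \<rho> by simp_all
    show "\<mu> x 0 0 = 0" if "x \<in> scratch" for x using that unfolding scratch_def \<mu> by (elim insertE) simp_all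
  qed
  have di: "distinct es" "set es = nonzeros A" using es by (auto simp: lists_nonzeros_def)
  have nnz: "nnz A = length es" unfolding nnz_def di(2)[symmetric] by (rule distinct_card[OF di(1)])
  obtain \<sigma> k where ex: "exec sketch_prog (\<mu>, \<rho>) k \<sigma>"
    "k \<le> 2 + length es * (5 + Suc t * 5) + m' * (4 + d * (4 + m * 3))"
    "\<And>a c. a < m' \<Longrightarrow> c < d \<Longrightarrow> snd \<sigma> ''out'' a c = (\<Sum>b<m. \<rho> ''gauss'' a b * acc_final b c)"
    using sketch_prog_correct unfolding mu by blast
  have acc: "acc_final b c = bucket ?N h s (stacked n ?w z (\<lambda>j. A $$ (j, c))) b" if c: "c < d" for b c
  proof -
    define T where "T i p = of_bool (h (i * n + fst p) = b) * (s (i * n + fst p) * (?w i * of_bool (z (i, fst p)) * A $$ p)) * of_bool (snd p = c)"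
      for i and p :: "nat \<times> nat"
    have "acc_final b c = (\<Sum>e<length es. \<Sum>i<Suc t. T i (es ! e))"
      unfolding acc_final_def mu
    proof (rule sum.cong[OF refl], rule sum.cong[OF refl])
      fix e i assume e: "e \<in> {..<length es}" and i: "i \<in> {..<Suc t}"
      have "es ! e \<in> nonzeros A" unfolding di(2)[symmetric] using e by simp
      then have j: "fst (es ! e) < n" using A by (auto simp: nonzeros_def)
      have q: "i * n + fst (es ! e) < ?N"
      proof -
        have "i * n + fst (es ! e) < i * n + n" using j by simp
        also have "\<dots> = (i + 1) * n" by simp
        also have "\<dots> \<le> (t + 1) * n" using i by (intro mult_le_mono1) auto
        finally show ?thesis by (simp add: mult.commute)
      qed
      show "contrib e i b c = T i (es ! e)"
        unfolding contrib_def arr rarr mu T_def Let_def using e i j q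
        by (cases "z (i, fst (es ! e))"; cases "h (i * n + fst (es ! e)) = b"; cases "snd (es ! e) = c")
          (simp_all add: table1_def table2_def add.commute[of "fst (es ! e)"])
    qed
    also have "\<dots> = (\<Sum>p\<in>nonzeros A. \<Sum>i<Suc t. T i p)"
      unfolding di(2)[symmetric] by (rule sum_nth_distinct[OF di(1)])
    \<comment> \<open>Positions outside \<open>nonzeros A\<close> contribute zero, so the sum may
      run over the whole matrix and be split into rows and columns, of which only column
      \<open>c\<close> survives.\<close>
    also have "\<dots> = (\<Sum>p\<in>{..<n} \<times> {..<d}. \<Sum>i<Suc t. T i p)"
      using A by (intro sum.mono_neutral_left) (auto simp: nonzeros_def T_def)
    also have "\<dots> = (\<Sum>i<Suc t. \<Sum>p\<in>{..<n} \<times> {..<d}. T i p)" by (rule sum.swap)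
    also have "\<dots> = (\<Sum>i<Suc t. \<Sum>j<n. \<Sum>c'<d. T i (j, c'))"
      by (simp only: sum.cartesian_product case_prod_eta)
    also have "\<dots> = (\<Sum>i<t + 1. \<Sum>j<n. of_bool (h (i * n + j) = b) * (s (i * n + j) * (?w i * of_bool (z (i, j)) * A $$ (j, c))))"
    proof -
      have "(\<Sum>c'<d. T i (j, c')) = of_bool (h (i * n + j) = b) * (s (i * n + j) * (?w i * of_bool (z (i, j)) * A $$ (j, c)))" for i j
      proof -
        have "(\<Sum>c'<d. T i (j, c')) = (\<Sum>c'<d. if c' = c then T i (j, c) else 0)"
          by (intro sum.cong) (auto simp: T_def)
        then show ?thesis using c by (simp add: T_def)
      qed
      then show ?thesis by simp
    qed
    also have "\<dots> = (\<Sum>r<?N. of_bool (h (r div n * n + r mod n) = b) *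
        (s (r div n * n + r mod n) * (?w (r div n) * of_bool (z (r div n, r mod n)) * A $$ (r mod n, c))))"
      by (rule sum_blocks[OF n, symmetric])
    also have "\<dots> = bucket ?N h s (stacked n ?w z (\<lambda>j. A $$ (j, c))) b"
      by (simp add: bucket_def stacked_def)
    finally show ?thesis .
  qed
  have S: "sym_sketch n t m m' l \<omega> \<in> carrier_mat m' n" by (rule sym_sketch_carrier)
  have "outputs_mat \<sigma> (sym_sketch n t m m' l \<omega> * A)"
    unfolding outputs_mat_def
  proof (intro allI impI)
    fix a c assume "a < dim_row (sym_sketch n t m m' l \<omega> * A)" "c < dim_col (sym_sketch n t m m' l \<omega> * A)"
    then have ac: "a < m'" "c < d" using S A by auto
    have cA: "col A c \<in> carrier_vec n" using col_dim[of A c] carrier_matD(1)[OF A] by simp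
    have "(sym_sketch n t m m' l \<omega> * A) $$ (a, c) = (sym_sketch n t m m' l \<omega> *\<^sub>v col A c) $ a"
      using S A ac by simp
    also have "\<dots> = sketch_vec n t m m' ?w \<omega> (\<lambda>j. col A c $ j) a" by (rule sym_sketch_mult_vec[OF n cA ac(1)])
    also have "\<dots> = sketch_vec n t m m' ?w \<omega> (\<lambda>j. A $$ (j, c)) a"
      by (rule fun_cong[OF sketch_vec_cong[OF n]]) (use A ac in auto)
    also have "\<dots> = (\<Sum>b<m. \<rho> ''gauss'' a b * acc_final b c)"
      unfolding sketch_vec_def \<omega> prod.case gauss_apply_def sum_distrib_left rarr acc[OF ac(2)]
      using ac by (intro sum.cong) (auto simp: table2_def gauss_sketch_def)
    also have "\<dots> = snd \<sigma> ''out'' a c" by (rule ex(3)[OF ac, symmetric])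
    finally show "snd \<sigma> ''out'' a c = (sym_sketch n t m m' l \<omega> * A) $$ (a, c)" ..
  qed
  then show ?thesis using ex(1,2) unfolding st nnz by blast
qed

section \<open>Measurability of the distortion event\<close>

lemma seed_measure_eq:
  "seed_measure n t m m' =
    measure_pmf (pair_pmf (sampling_pmf n t) (count_sketch_pmf (n * (t + 1)) m)) \<Otimes>\<^sub>M gauss_measure m' m"
  by (simp add: seed_measure_def sampling_pmf_def count_sketch_pmf_def hash_pmf_def rademacher_def gauss_measure_def)

text \<open>Every function of the discrete part of the seed is measurable, so only the Gaussian
  coordinates need an argument.\<close>

lemma sketch_vec_measurable:
  "(\<lambda>\<omega>. sqrt (sqn m' (sketch_vec n t m m' w \<omega> y))) \<in> borel_measurable (seed_measure n t m m')"
proof -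
  let ?M = "seed_measure n t m m'"
  have "(\<lambda>\<omega>. sketch_vec n t m m' w \<omega> y a) \<in> borel_measurable ?M" if a: "a < m'" for a
  proof -
    have eq: "(\<lambda>\<omega>. sketch_vec n t m m' w \<omega> y a) = (\<lambda>\<omega>. 1 / sqrt (real m') * (\<Sum>b<m.
        bucket (n * (t + 1)) (fst (snd (fst \<omega>))) (snd (snd (fst \<omega>))) (stacked n w (fst (fst \<omega>)) y) b * (snd \<omega>) (a, b)))"
      by (simp add: sketch_vec_def case_prod_beta gauss_apply_def)
    have "(\<lambda>\<omega>. f (fst \<omega>)) \<in> borel_measurable ?M" for f :: "_ \<Rightarrow> real"
      unfolding seed_measure_eq by (rule measurable_compose[OF measurable_fst]) simp
    moreover have "(\<lambda>\<omega>. (snd \<omega>) (a, b)) \<in> borel_measurable ?M" if "b < m" for b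
      unfolding seed_measure_eq by (rule measurable_compose[OF measurable_snd measurable_gauss_coord]) (use a that in auto)
    ultimately show ?thesis unfolding eq
      by (intro borel_measurable_times borel_measurable_sum borel_measurable_const) auto
  qed
  then have [measurable]: "(\<lambda>\<omega>. sqn m' (sketch_vec n t m m' w \<omega> y)) \<in> borel_measurable ?M"
    unfolding sqn_def by (intro borel_measurable_sum borel_measurable_power) auto
  show ?thesis by measurable
qed

lemma sketch_vec_lincomb:
  "sketch_vec n t m m' w \<omega> (lincomb_n d v c) = lincomb_n d (\<lambda>j. sketch_vec n t m m' w \<omega> (v j)) c"
proof -
  obtain z h s g where \<omega>: "\<omega> = ((z, h, s), g)" by (metis surj_pair)
  show ?thesis
    unfolding sketch_vec_def \<omega> prod.case stacked_lincomb bucket_lincomb gauss_apply_lincomb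
    unfolding lincomb_n_def by (simp add: sum_distrib_left mult_ac)
qed

text \<open>Turns a universal statement over uncountably many coefficient vectors into one over a
  countable dense set, hence into a countable intersection of events.\<close>

lemma all_vec_iff_dense:
  fixes P :: "(nat \<Rightarrow> real) \<Rightarrow> bool"
  assumes "closed {c. P c}" and D: "\<And>X. open X \<Longrightarrow> X \<noteq> {} \<Longrightarrow> \<exists>d\<in>D. d \<in> X"
  shows "(\<forall>c. P c) \<longleftrightarrow> (\<forall>c\<in>D. P c)"
proof
  assume *: "\<forall>c\<in>D. P c"
  have "open (- {c. P c})" using assms(1) by (simp add: open_Compl)
  then have "- {c. P c} = {}" using D * by blast
  then show "\<forall>c. P c" by blast
qed simp

text \<open>Needed since \<open>measure\<close> vanishes on sets that are not measurable.\<close>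

lemma (in sym_norm) distortion_event_measurable:
  fixes v :: "nat \<Rightarrow> nat \<Rightarrow> real"
  shows "{\<omega> \<in> space (seed_measure n t m m'). \<forall>c.
      \<alpha> * L (lincomb_n d v c) \<le> sqrt (sqn m' (sketch_vec n t m m' w \<omega> (lincomb_n d v c))) \<and>
      sqrt (sqn m' (sketch_vec n t m m' w \<omega> (lincomb_n d v c))) \<le> \<beta> * L (lincomb_n d v c)}
    \<in> sets (seed_measure n t m m')"
proof -
  let ?M = "seed_measure n t m m'"
  let ?P = "\<lambda>\<omega> c. \<alpha> * L (lincomb_n d v c) \<le> sqrt (sqn m' (sketch_vec n t m m' w \<omega> (lincomb_n d v c))) \<and>
      sqrt (sqn m' (sketch_vec n t m m' w \<omega> (lincomb_n d v c))) \<le> \<beta> * L (lincomb_n d v c)"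
  obtain D :: "(nat \<Rightarrow> real) set" where D: "countable D" "\<And>X. open X \<Longrightarrow> X \<noteq> {} \<Longrightarrow> \<exists>d\<in>D. d \<in> X"
    using countable_dense_exists by blast
  have coord: "continuous_on UNIV (\<lambda>c::nat \<Rightarrow> real. c j)" for j by simp
  have lin: "continuous_on UNIV (\<lambda>c. lincomb_n d u c i)" for u i
    unfolding lincomb_n_def by (intro continuous_on_sum continuous_on_mult coord continuous_on_const)
  have cL: "continuous_on UNIV (\<lambda>c. L (lincomb_n d v c))"
  proof (rule continuous_on_compose2[OF continuous])
    show "continuous_on UNIV (lincomb_n d v)"
      by (rule continuous_on_coordinatewise_then_product) (rule lin)
  qed simp
  \<comment> \<open>With the columns sketched first, the image is a fixed linear combination with
    coefficients \<open>c\<close>, and continuity in \<open>c\<close> is visible.\<close>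
  have cS: "continuous_on UNIV (\<lambda>c. sqrt (sqn m' (sketch_vec n t m m' w \<omega> (lincomb_n d v c))))" for \<omega>
    unfolding sketch_vec_lincomb sqn_def
    by (intro continuous_on_real_sqrt continuous_on_sum continuous_on_power lin)
  have closed: "closed {c. ?P \<omega> c}" for \<omega>
    by (intro closed_Collect_conj closed_Collect_le continuous_on_mult continuous_on_const cL cS)
  have D0: "D \<noteq> {}" using D(2)[of UNIV] by auto
  have Int: "{\<omega> \<in> Z. \<forall>c. P \<omega> c} = (\<Inter>c\<in>D. {\<omega> \<in> Z. P \<omega> c})"
    if "\<And>\<omega>. closed {c. P \<omega> c}" for P :: "'z \<Rightarrow> (nat \<Rightarrow> real) \<Rightarrow> bool" and Z
    using all_vec_iff_dense[OF that D(2)] D0 by blast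
  have "{\<omega> \<in> space ?M. \<forall>c. ?P \<omega> c} = (\<Inter>c\<in>D. {\<omega> \<in> space ?M. ?P \<omega> c})"
    by (rule Int[OF closed])
  also have "\<dots> \<in> sets ?M"
  proof (rule sets.countable_INT'[OF D(1) D0])
    have "{\<omega> \<in> space ?M. ?P \<omega> c} \<in> sets ?M" for c
      by (rule sets.sets_Collect_conj; rule borel_measurable_le) (rule sketch_vec_measurable borel_measurable_const)+
    then show "(\<lambda>c. {\<omega> \<in> space ?M. ?P \<omega> c}) ` D \<subseteq> sets ?M" by (rule image_subsetI)
  qed
  finally show ?thesis .
qed

section \<open>Combining independent stages of randomness\<close>

lemma prob_pair_pmf_ge:
  assumes "\<And>a. a \<in> X \<Longrightarrow> \<beta> \<le> measure_pmf.prob B {b. (a, b) \<in> Y}" "0 \<le> \<beta>"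
  shows "\<beta> * measure_pmf.prob A X \<le> measure_pmf.prob (pair_pmf A B) Y"
proof -
  have "ennreal (\<beta> * measure_pmf.prob A X) = ennreal \<beta> * emeasure A X"
    using assms(2) by (simp add: measure_pmf.emeasure_eq_measure ennreal_mult)
  also have "\<dots> = (\<integral>\<^sup>+a. ennreal \<beta> * indicator X a \<partial>A)" by (simp add: nn_integral_cmult_indicator)
  also have "\<dots> \<le> (\<integral>\<^sup>+a. \<integral>\<^sup>+b. indicator Y (a, b) \<partial>B \<partial>A)"
  proof (rule nn_integral_mono)
    fix a
    have "(\<integral>\<^sup>+b. indicator Y (a, b) \<partial>B) = (\<integral>\<^sup>+b. indicator {b. (a, b) \<in> Y} b \<partial>B)"
      by (intro nn_integral_cong) (simp add: indicator_def)
    also have "\<dots> = ennreal (measure_pmf.prob B {b. (a, b) \<in> Y})" by (simp add: measure_pmf.emeasure_eq_measure)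
    finally show "ennreal \<beta> * indicator X a \<le> (\<integral>\<^sup>+b. indicator Y (a, b) \<partial>B)"
      using assms(1)[of a] by (cases "a \<in> X") (auto intro: ennreal_leI)
  qed
  also have "\<dots> = (\<integral>\<^sup>+p. indicator Y p \<partial>pair_pmf A B)" by (rule nn_integral_pair_pmf'[symmetric])
  also have "\<dots> = ennreal (measure_pmf.prob (pair_pmf A B) Y)" by (simp add: measure_pmf.emeasure_eq_measure)
  finally show ?thesis by simp
qed

text \<open>Fubini over the discrete stage. The good set \<open>E\<close> may vary with
  \<open>a\<close> without any joint measurability, because it only bounds a section of the
  measurable set \<open>F\<close> from below.\<close>

lemma prob_pmf_pair_measure_ge:
  assumes N: "prob_space N" and F: "F \<in> sets (measure_pmf p \<Otimes>\<^sub>M N)"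
    and sec: "\<And>a. a \<in> X \<Longrightarrow> \<exists>E\<in>sets N. \<beta> \<le> measure N E \<and> (\<forall>g\<in>E. (a, g) \<in> F)" and \<beta>: "0 \<le> \<beta>"
  shows "\<beta> * measure_pmf.prob p X \<le> measure (measure_pmf p \<Otimes>\<^sub>M N) F"
proof -
  interpret N: prob_space N by fact
  interpret P: pair_prob_space "measure_pmf p" N by unfold_locales
  have "ennreal (\<beta> * measure_pmf.prob p X) = ennreal \<beta> * emeasure p X"
    using \<beta> by (simp add: measure_pmf.emeasure_eq_measure ennreal_mult)
  also have "\<dots> = (\<integral>\<^sup>+a. ennreal \<beta> * indicator X a \<partial>p)" by (simp add: nn_integral_cmult_indicator)
  also have "\<dots> \<le> (\<integral>\<^sup>+a. emeasure N (Pair a -` F) \<partial>p)"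
  proof (rule nn_integral_mono)
    fix a
    show "ennreal \<beta> * indicator X a \<le> emeasure N (Pair a -` F)"
    proof (cases "a \<in> X")
      case True
      then obtain E where E: "E \<in> sets N" "\<beta> \<le> measure N E" "\<forall>g\<in>E. (a, g) \<in> F" using sec by blast
      have "ennreal \<beta> \<le> emeasure N E" using E(2) by (simp add: N.emeasure_eq_measure ennreal_leI)
      also have "\<dots> \<le> emeasure N (Pair a -` F)"
        using E(3) sets_Pair1[OF F] by (intro emeasure_mono) auto
      finally show ?thesis using True by simp
    qed simp
  qed
  also have "\<dots> = emeasure (measure_pmf p \<Otimes>\<^sub>M N) F" by (rule N.emeasure_pair_measure_alt[OF F, symmetric])
  also have "\<dots> = ennreal (measure (measure_pmf p \<Otimes>\<^sub>M N) F)" by (rule P.emeasure_eq_measure)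
  finally show ?thesis by simp
qed

text \<open>Used with \<open>a = ln 2\<close> and \<open>x = ln n\<close>. The hypotheses yield a
  loss of order \<open>sqrt d * x^(3/2)\<close>; the surplus is given away through
  \<open>a <= x\<close>. The constant is the root of
  \<open>4096 * 50 * 8 = 1280\<^sup>2\<close>.\<close>

lemma distortion_lower_arith:
  fixes a x q d s Q l :: real
  assumes a: "0 < a" "a \<le> x" and q: "0 \<le> q" "q * a \<le> 2 * x" and d: "1 \<le> d" and s: "0 \<le> s" and l: "0 \<le> l"
    and lQ: "l\<^sup>2 \<le> 4096 * q ^ 3 * d * Q" and Qs: "Q \<le> 50 * s\<^sup>2"
  shows "a ^ 3 / 1280 / (sqrt d * x ^ 3) * l \<le> s"
proof (rule power2_le_imp_le[OF _ s])
  have x: "x > 0" using a by linarith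
  have "l\<^sup>2 \<le> 4096 * q ^ 3 * d * (50 * s\<^sup>2)"
    by (rule order_trans[OF lQ]) (intro mult_left_mono Qs mult_nonneg_nonneg zero_le_power q, use d in auto)
  then have "(a ^ 3)\<^sup>2 * l\<^sup>2 \<le> (a ^ 3)\<^sup>2 * (4096 * q ^ 3 * d * (50 * s\<^sup>2))" by (rule mult_left_mono) simp
  also have "\<dots> = 204800 * (a ^ 3 * ((q * a) ^ 3 * (d * s\<^sup>2)))" by (simp add: power2_eq_square power3_eq_cube)
  also have "\<dots> \<le> 204800 * (x ^ 3 * ((2 * x) ^ 3 * (d * s\<^sup>2)))"
  proof (rule mult_left_mono)
    have 1: "a ^ 3 \<le> x ^ 3" using a by (intro power_mono) auto
    have 2: "(q * a) ^ 3 \<le> (2 * x) ^ 3" by (rule power_mono[OF q(2)]) (use a q in simp)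
    show "a ^ 3 * ((q * a) ^ 3 * (d * s\<^sup>2)) \<le> x ^ 3 * ((2 * x) ^ 3 * (d * s\<^sup>2))"
      by (rule mult_mono[OF 1 mult_right_mono[OF 2]]) (use a q d x in auto)
  qed simp
  also have "\<dots> = 1638400 * (d * (x ^ 3)\<^sup>2 * s\<^sup>2)" by (simp add: power2_eq_square power3_eq_cube)
  finally have *: "(a ^ 3)\<^sup>2 * l\<^sup>2 \<le> 1638400 * (d * (x ^ 3)\<^sup>2 * s\<^sup>2)" .
  have "(a ^ 3 / 1280 / (sqrt d * x ^ 3) * l)\<^sup>2 = (a ^ 3)\<^sup>2 * l\<^sup>2 / (1638400 * (d * (x ^ 3)\<^sup>2))"
    using d by (simp add: power_mult_distrib power_divide)
  also have "\<dots> \<le> s\<^sup>2"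
    using * d x by (subst pos_divide_le_eq) (auto simp: mult_ac)
  finally show "(a ^ 3 / 1280 / (sqrt d * x ^ 3) * l)\<^sup>2 \<le> s\<^sup>2" .
qed

text \<open>The term \<open>400 * d * T\<close> carries no mmc; the lower bound on
  \<open>M\<^sup>2 * (12 * a)\<close> lets it be multiplied by \<open>M\<^sup>2\<close>. The square
  is then of order \<open>M\<^sup>2 * d ^ 3 * x ^ 3\<close>, and the remaining powers up to
  \<open>d ^ 4\<close> and \<open>x ^ 5\<close> are slack.\<close>

lemma distortion_upper_arith:
  fixes a x d s Q l T C M :: real
  assumes a: "0 < a" "a \<le> x" and d: "1 \<le> d" and l: "0 \<le> l" and M: "0 \<le> M" "1 \<le> M\<^sup>2 * (12 * a)"
    and T: "0 \<le> T" "T \<le> C * x" and C: "0 < C"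
    and sQ: "s\<^sup>2 \<le> 75 / 8 * Q"
    and Q: "Q \<le> 400 * d\<^sup>2 * T * (1 + x) * (M\<^sup>2 * (4 * (3 * a + x)) + 400 * d * T) * l\<^sup>2"
  shows "s \<le> sqrt (3750 * C * (1 / a + 1) * (16 + 4800 * C * a)) / a * (M * d\<^sup>2 * x powr (5 / 2)) * l"
proof (rule power2_le_imp_le)
  have x: "x > 0" using a by linarith
  let ?D = "16 + 4800 * C * a"
  have H: "M\<^sup>2 * (4 * (3 * a + x)) + 400 * d * T \<le> M\<^sup>2 * x * d * ?D"
  proof -
    have "M\<^sup>2 * (4 * (3 * a + x)) \<le> M\<^sup>2 * (16 * x)" using a by (intro mult_left_mono) auto
    also have "\<dots> \<le> M\<^sup>2 * (16 * x) * d" using mult_left_mono[of 1 d "M\<^sup>2 * (16 * x)"] d x by simp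
    finally have 1: "M\<^sup>2 * (4 * (3 * a + x)) \<le> M\<^sup>2 * (16 * x) * d" .
    have "400 * d * T * 1 \<le> 400 * d * (C * x) * (M\<^sup>2 * (12 * a))"
      using T M d C x by (intro mult_mono) auto
    then have 2: "400 * d * T \<le> M\<^sup>2 * x * d * (4800 * C * a)" by (simp add: mult_ac)
    show ?thesis using 1 2 by (simp add: distrib_left mult_ac)
  qed
  have lx: "1 + x \<le> (1 / a + 1) * x" using a by (simp add: distrib_right pos_le_divide_eq)
  have "Q \<le> 400 * d\<^sup>2 * T * (1 + x) * (M\<^sup>2 * (4 * (3 * a + x)) + 400 * d * T) * l\<^sup>2" by (rule Q)
  also have "\<dots> \<le> 400 * d\<^sup>2 * (C * x) * ((1 / a + 1) * x) * (M\<^sup>2 * x * d * ?D) * l\<^sup>2"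
    using H lx T C x a d M by (intro mult_mono mult_nonneg_nonneg) auto
  finally have Qle: "Q \<le> 400 * d\<^sup>2 * (C * x) * ((1 / a + 1) * x) * (M\<^sup>2 * x * d * ?D) * l\<^sup>2" .
  have "s\<^sup>2 \<le> 75 / 8 * (400 * d\<^sup>2 * (C * x) * ((1 / a + 1) * x) * (M\<^sup>2 * x * d * ?D) * l\<^sup>2)"
    by (rule order_trans[OF sQ mult_left_mono[OF Qle]]) simp
  also have "\<dots> = (3750 * C * (1 / a + 1) * ?D) * (d ^ 3 * x ^ 3 * (M\<^sup>2 * l\<^sup>2))"
    by (simp add: power2_eq_square power3_eq_cube)
  also have "\<dots> \<le> (3750 * C * (1 / a + 1) * ?D) * (d ^ 4 * (x ^ 5 / a\<^sup>2) * (M\<^sup>2 * l\<^sup>2))"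
  proof (intro mult_left_mono mult_right_mono mult_mono)
    show "d ^ 3 \<le> d ^ 4" using d by (intro power_increasing) auto
    have "a\<^sup>2 \<le> x\<^sup>2" using a by (intro power_mono) auto
    then have "x ^ 3 * a\<^sup>2 \<le> x ^ 3 * x\<^sup>2" using x by (intro mult_left_mono) auto
    then show "x ^ 3 \<le> x ^ 5 / a\<^sup>2" using a by (simp add: pos_le_divide_eq flip: power_add)
  qed (use a C x d in auto)
  also have "\<dots> = (sqrt (3750 * C * (1 / a + 1) * ?D) / a * (M * d\<^sup>2 * x powr (5 / 2)) * l)\<^sup>2"
  proof -
    have 1: "(x powr (5 / 2))\<^sup>2 = x ^ 5"
      using x by (simp add: power2_eq_square powr_add[symmetric])
    have 2: "(d\<^sup>2)\<^sup>2 = d ^ 4" by (simp flip: power_mult)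
    have 3: "E * (d ^ 4 * (x ^ 5 / a\<^sup>2) * (M\<^sup>2 * l\<^sup>2)) = (sqrt E / a * (M * d\<^sup>2 * X) * l)\<^sup>2"
      if "0 \<le> E" "X\<^sup>2 = x ^ 5" for E X
      unfolding power_mult_distrib power_divide that(2) 2 using that(1) by simp
    have "0 \<le> 3750 * C * (1 / a + 1) * ?D"
      using a C by (intro mult_nonneg_nonneg add_nonneg_nonneg) auto
    then show ?thesis by (rule 3[OF _ 1])
  qed
  finally show "s\<^sup>2 \<le> (sqrt (3750 * C * (1 / a + 1) * ?D) / a * (M * d\<^sup>2 * x powr (5 / 2)) * l)\<^sup>2" .
  show "0 \<le> sqrt (3750 * C * (1 / a + 1) * ?D) / a * (M * d\<^sup>2 * x powr (5 / 2)) * l"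
    using a C M l by (intro mult_nonneg_nonneg divide_nonneg_nonneg) auto
qed

text \<open>The dense product costs \<open>m' * d * m\<close>, of order \<open>d ^ 4\<close>;
  scattering costs \<open>nz * (t + 1)\<close>. Terms without a logarithm are multiplied by
  \<open>x / a >= 1\<close>, and nonnegative cross terms are added to reach a product.\<close>

lemma running_time_arith:
  fixes a x C C1 C2 :: real and nz t d m m' :: nat
  assumes a: "0 < a" "a \<le> x" and t: "real (t + 1) \<le> C * x" and d: "d \<ge> 1" and C: "0 \<le> C"
    and m: "real m \<le> 100 * \<bar>C1\<bar> * (real d)\<^sup>2" and m': "real m' \<le> 100 * \<bar>C2\<bar> * real d"
  shows "real (2 + nz * (5 + Suc t * 5) + m' * (4 + d * (4 + m * 3))) \<le>
    (10 * C + (2 + 100 * \<bar>C2\<bar> * (8 + 300 * \<bar>C1\<bar>)) / a) * (real nz + real d ^ 4) * x ^ 1"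
proof -
  have x: "x > 0" using a by linarith
  let ?Z = "100 * \<bar>C2\<bar> * (8 + 300 * \<bar>C1\<bar>)"
  have dd: "1 \<le> real d" "real d ^ i \<le> real d ^ j" if "i \<le> j" for i j
    using d that by (auto intro: power_increasing)
  have "real (nz * (5 + Suc t * 5)) \<le> real nz * (10 * real (t + 1))" by (simp add: mult_left_mono)
  also have "\<dots> \<le> real nz * (10 * (C * x))" using t by (intro mult_left_mono) auto
  finally have 1: "real (nz * (5 + Suc t * 5)) \<le> 10 * C * x * real nz" by (simp add: mult_ac)
  have "real (m' * (4 + d * (4 + m * 3))) = real m' * (4 + real d * (4 + real m * 3))" by simp
  also have "\<dots> \<le> (100 * \<bar>C2\<bar> * real d) * (4 + real d * (4 + (100 * \<bar>C1\<bar> * (real d)\<^sup>2) * 3))"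
    using m m' by (intro mult_mono add_mono) auto
  also have "\<dots> = 100 * \<bar>C2\<bar> * (4 * real d ^ 1 + 4 * real d ^ 2 + 300 * \<bar>C1\<bar> * real d ^ 4)"
    by (simp add: algebra_simps power2_eq_square power4_eq_xxxx)
  also have "\<dots> \<le> 100 * \<bar>C2\<bar> * (4 * real d ^ 4 + 4 * real d ^ 4 + 300 * \<bar>C1\<bar> * real d ^ 4)"
    using dd(2)[of 1 4] dd(2)[of 2 4] by (intro mult_left_mono add_mono) auto
  also have "\<dots> = ?Z * real d ^ 4" by (simp add: algebra_simps)
  finally have 2: "real (m' * (4 + d * (4 + m * 3))) \<le> ?Z * real d ^ 4" .
  have "1 \<le> real d ^ 4" using d by (intro one_le_power) auto
  then have "real (2 + nz * (5 + Suc t * 5) + m' * (4 + d * (4 + m * 3))) \<le> 10 * C * x * real nz + (2 + ?Z) * real d ^ 4 * 1"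
    using 1 2 by (simp add: algebra_simps)
  also have "\<dots> \<le> 10 * C * x * real nz + (2 + ?Z) * real d ^ 4 * (x / a)"
    using a by (intro add_mono order_refl mult_left_mono) auto
  also have "\<dots> \<le> 10 * C * x * real nz + (2 + ?Z) * real d ^ 4 * (x / a) + (10 * C * x * real d ^ 4 + (2 + ?Z) / a * x * real nz)"
  proof -
    have "0 \<le> 10 * C * x * real d ^ 4" "0 \<le> (2 + ?Z) / a * x * real nz"
      using C x a by (auto intro!: mult_nonneg_nonneg divide_nonneg_nonneg add_nonneg_nonneg)
    then show ?thesis by linarith
  qed
  also have "\<dots> = (10 * C + (2 + ?Z) / a) * (real nz + real d ^ 4) * x ^ 1"
  proof -
    have "10 * C * x * N + P * D * (x / a) + (10 * C * x * D + P / a * x * N) = (10 * C + P / a) * (N + D) * x ^ 1"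
      for P N D :: real by (simp add: algebra_simps add_divide_distrib)
    then show ?thesis .
  qed
  finally show ?thesis .
qed

text \<open>The stages are conditioned in turn. CountSketch is applied to the span of the stacked
  columns for a fixed sampling outcome, the Gaussian matrix to the span of the bucketed columns for
  a fixed discrete outcome, so both face a fixed subspace of dimension at most
  \<open>d\<close>.\<close>

lemma sketch_good_event:
  fixes n d t m m' :: nat and l :: "real vec \<Rightarrow> real" and v :: "nat \<Rightarrow> nat \<Rightarrow> real"
  defines "a \<equiv> ln 2 :: real"
  assumes n: "n \<ge> 2" and d: "d \<ge> 1" and t: "\<lfloor>log 2 (real n)\<rfloor> \<le> int t"
    and tC: "real (t + 1) \<le> C * ln (real n)" "0 < C"
    and m: "800 * (real d)\<^sup>2 \<le> real m" and m': "1000 * d \<le> m'" and S: "symmetric_norm n l"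
    and cU: "cU = sqrt (3750 * C * (1 / a + 1) * (16 + 4800 * C * a)) / a" and cL: "cL = a ^ 3 / 1280"
  shows "measure (seed_measure n t m m') {\<omega> \<in> space (seed_measure n t m m'). \<forall>c.
      cL / (sqrt (real d) * ln (real n) ^ 3) * l (vec n (lincomb_n d v c))
        \<le> sqrt (sqn m' (sketch_vec n t m m' (level_weight n l) \<omega> (lincomb_n d v c))) \<and>
      sqrt (sqn m' (sketch_vec n t m m' (level_weight n l) \<omega> (lincomb_n d v c)))
        \<le> cU * (mmc n l * (real d)\<^sup>2 * ln (real n) powr (5 / 2)) * l (vec n (lincomb_n d v c))} \<ge> 0.9"
    (is "measure ?M ?F \<ge> _")
proof -
  let ?L = "\<lambda>x. l (vec n x)"
  let ?w = "level_weight n l"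
  let ?N = "n * (t + 1)"
  let ?x = "ln (real n)"
  interpret sym_norm n ?L using S n by (intro symmetric_norm_sym_norm) auto
  have w: "?w = (\<lambda>i. W (2 ^ i))"
    by (simp add: level_weight_def pad_vec_def W_def fun_eq_iff)
  have a: "0 < a" "a \<le> ?x" using n by (simp_all add: a_def)
  obtain k where k: "2 ^ k \<le> n" "n < 2 ^ (k + 1)" using ex_power_ivl1[of 2 n] n by auto
  \<comment> \<open>\<open>2 ^ q\<close> is the least power of two above \<open>n\<close>; levels
    \<open>0\<close> to \<open>q - 1\<close> are all present since \<open>k <= t\<close>.\<close>
  define q where "q = k + 1"
  have kt: "k \<le> t"
  proof -
    have "real (2 ^ k) \<le> real n" using k(1) by (simp only: of_nat_le_iff)
    then have "real k \<le> log 2 (real n)" using n by (simp add: le_log_iff powr_realpow)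
    then have "int k \<le> \<lfloor>log 2 (real n)\<rfloor>" by (simp add: le_floor_iff)
    then show ?thesis using t by linarith
  qed
  have q: "n < 2 ^ q" "2 ^ q \<le> 2 * n" "q \<le> t + 1" using k kt by (auto simp: q_def)
  have qa: "real q * a \<le> 2 * ?x"
  proof -
    have "real (2 ^ q) \<le> real (2 * n)" using q(2) by (simp only: of_nat_le_iff)
    then have "ln (2 ^ q) \<le> ln (2 * real n)" using n by (subst ln_le_cancel_iff) auto
    then have "real q * a \<le> a + ?x" using n by (simp add: ln_realpow ln_mult a_def)
    then show ?thesis using a by simp
  qed
  have ln8: "ln (8 * real k) \<le> 3 * a + ?x" if "1 \<le> k" "k \<le> n" for k
  proof -
    have "ln (8 * real k) \<le> ln (8 * real n)" using that by simp
    also have "\<dots> = ln (2 ^ 3) + ?x" using n by (simp add: ln_mult)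
    also have "ln (2 ^ 3 :: real) = 3 * a" unfolding a_def by (subst ln_realpow) auto
    finally show ?thesis .
  qed
  define M where "M = mmc n l"
  have M0: "M > 0" unfolding M_def using n by (intro W_le_mmc(2)[OF S, of 1 1]) auto
  define H where "H = M\<^sup>2 * (4 * (3 * a + ?x))"
  have HW: "(W s)\<^sup>2 / real s \<le> H * ((W r)\<^sup>2 / real r)" if sr: "1 \<le> s" "s \<le> r" "r \<le> n" for s r
  proof -
    have "(W s)\<^sup>2 / real s \<le> M\<^sup>2 * (4 * ln (8 * real r) / real r * (W r)\<^sup>2)"
      unfolding M_def by (rule W_le_mmc(1)[OF S sr])
    also have "\<dots> = M\<^sup>2 * (4 * ln (8 * real r)) * ((W r)\<^sup>2 / real r)" by simp
    also have "\<dots> \<le> H * ((W r)\<^sup>2 / real r)"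
      unfolding H_def using sr ln8[of r] by (intro mult_right_mono mult_left_mono) auto
    finally show ?thesis .
  qed
  \<comment> \<open>The case \<open>s = k = 1\<close> of \<open>W_le_mmc\<close>: a constant lower
    bound on the mmc.\<close>
  have M1: "1 \<le> M\<^sup>2 * (12 * a)"
  proof -
    have "(W 1)\<^sup>2 \<le> M\<^sup>2 * (4 * ln 8 * (W 1)\<^sup>2)"
      using W_le_mmc(1)[OF S, of 1 1] n unfolding M_def by simp
    moreover have "ln (8::real) = 3 * a"
    proof -
      have "ln (2 ^ 3 :: real) = 3 * a" unfolding a_def by (subst ln_realpow) auto
      then show ?thesis by simp
    qed
    ultimately have "1 * (W 1)\<^sup>2 \<le> (M\<^sup>2 * (12 * a)) * (W 1)\<^sup>2" by (simp add: mult_ac)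
    then show ?thesis using W_1_pos by (simp add: mult_le_cancel_right)
  qed
  let ?P = "sampling_pmf n t"
  let ?Q = "\<lambda>z c. sketch_sq (t + 1) z (lincomb_n d v c)"
  let ?y = "lincomb_n d v"
  define G1 where "G1 = {z. \<forall>c. (?L (?y c))\<^sup>2 \<le> 4096 * real q ^ 3 * real d * ?Q z c}"
  define G2 where "G2 = {z. \<forall>c. ?Q z c \<le>
      400 * (real d)\<^sup>2 * real (t + 1) * (1 + ?x) * (H + 400 * real d * real (t + 1)) * (?L (?y c))\<^sup>2}"
  have P1: "99 / 100 \<le> measure_pmf.prob ?P G1"
    using sketch_lower_all[OF q d, of v] unfolding G1_def by simp
  have P2: "98 / 100 \<le> measure_pmf.prob ?P G2"
    using sketch_upper_all[OF d HW, of t v] unfolding G2_def by simp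
  have "measure_pmf.prob ?P (- G1) = 1 - measure_pmf.prob ?P G1" "measure_pmf.prob ?P (- G2) = 1 - measure_pmf.prob ?P G2"
    "measure_pmf.prob ?P (- (- G1 \<union> - G2)) = 1 - measure_pmf.prob ?P (- G1 \<union> - G2)"
    by (simp_all add: measure_pmf.prob_compl[symmetric] Compl_eq_Diff_UNIV del: Diff_UNIV)
  moreover have "measure_pmf.prob ?P (- G1 \<union> - G2) \<le> measure_pmf.prob ?P (- G1) + measure_pmf.prob ?P (- G2)"
    by (rule measure_Un_le) auto
  moreover have "- (- G1 \<union> - G2) = G1 \<inter> G2" by auto
  ultimately have P12: "97 / 100 \<le> measure_pmf.prob ?P (G1 \<inter> G2)" using P1 P2 by simp
  let ?B = "\<lambda>z hs c. bucket ?N (fst hs) (snd hs) (stacked n ?w z (?y c))"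
  define G3 where "G3 z = {hs. \<forall>c. ?Q z c / 2 \<le> sqn m (?B z hs c) \<and> sqn m (?B z hs c) \<le> 3 / 2 * ?Q z c}" for z
  have P3: "99 / 100 \<le> measure_pmf.prob (count_sketch_pmf ?N m) (G3 z)" for z
    using count_sketch_embedding[OF m d, of ?N "\<lambda>j. stacked n ?w z (v j)"]
    unfolding G3_def stacked_lincomb w by simp
  define G where "G = {zhs. fst zhs \<in> G1 \<inter> G2 \<and> snd zhs \<in> G3 (fst zhs)}"
  have "99 / 100 * measure_pmf.prob ?P (G1 \<inter> G2) \<le> measure_pmf.prob (pair_pmf ?P (count_sketch_pmf ?N m)) G"
    by (rule prob_pair_pmf_ge) (use P3 in \<open>auto simp: G_def\<close>)
  then have PG: "99 / 100 * (97 / 100) \<le> measure_pmf.prob (pair_pmf ?P (count_sketch_pmf ?N m)) G"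
    using P12 by simp
  have Fm: "?F \<in> sets ?M" by (rule distortion_event_measurable)
  have "97 / 100 * measure_pmf.prob (pair_pmf ?P (count_sketch_pmf ?N m)) G \<le>
      measure (measure_pmf (pair_pmf ?P (count_sketch_pmf ?N m)) \<Otimes>\<^sub>M gauss_measure m' m) ?F"
  proof (rule prob_pmf_pair_measure_ge[OF prob_space_gauss_measure])
    show "?F \<in> sets (measure_pmf (pair_pmf ?P (count_sketch_pmf ?N m)) \<Otimes>\<^sub>M gauss_measure m' m)"
      using Fm by (simp only: seed_measure_eq)
    fix zhs assume zhs: "zhs \<in> G"
    obtain z h s where z: "zhs = (z, h, s)" by (metis surj_pair)
    have good: "z \<in> G1" "z \<in> G2" "(h, s) \<in> G3 z" using zhs by (auto simp: G_def z)
    have lc: "?B z (h, s) c = lincomb_n d (\<lambda>j. bucket ?N h s (stacked n ?w z (v j))) c" for c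
      by (simp add: stacked_lincomb bucket_lincomb)
    obtain E where E: "E \<in> sets (gauss_measure m' m)" "0.97 \<le> measure (gauss_measure m' m) E"
      and Eg: "\<And>g c. g \<in> E \<Longrightarrow> real m' / 25 * sqn m (?B z (h, s) c) \<le> sqn m' (gauss_apply m g (?B z (h, s) c)) \<and>
        sqn m' (gauss_apply m g (?B z (h, s) c)) \<le> 25 / 4 * real m' * sqn m (?B z (h, s) c)"
      using gaussian_embedding[OF m' d, of m "\<lambda>j. bucket ?N h s (stacked n ?w z (v j))"] unfolding lc by blast
    have "(zhs, g) \<in> ?F" if g: "g \<in> E" for g
    proof -
      have "g \<in> space (gauss_measure m' m)" using g E(1) sets.sets_into_space by blast
      then have sp: "(zhs, g) \<in> space ?M" by (simp add: seed_measure_eq space_pair_measure)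
      have "cL / (sqrt (real d) * ?x ^ 3) * ?L (?y c) \<le> sqrt (sqn m' (sketch_vec n t m m' ?w (zhs, g) (?y c))) \<and>
        sqrt (sqn m' (sketch_vec n t m m' ?w (zhs, g) (?y c))) \<le> cU * (M * (real d)\<^sup>2 * ?x powr (5 / 2)) * ?L (?y c)" for c
      proof -
        define s' where "s' = sqrt (sqn m' (sketch_vec n t m m' ?w (zhs, g) (?y c)))"
        have m'0: "real m' > 0" using m' d by simp
        have "sketch_vec n t m m' ?w (zhs, g) (?y c) = (\<lambda>a. 1 / sqrt (real m') * gauss_apply m g (?B z (h, s) c) a)"
          by (simp add: sketch_vec_def z)
        then have "s'\<^sup>2 = (1 / sqrt (real m'))\<^sup>2 * sqn m' (gauss_apply m g (?B z (h, s) c))"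
          unfolding s'_def by (simp only: sqn_scale) simp
        then have s2: "s'\<^sup>2 = sqn m' (gauss_apply m g (?B z (h, s) c)) / real m'"
          using m'0 by (simp add: power_divide)
        have b1: "real m' / 25 * sqn m (?B z (h, s) c) \<le> real m' * s'\<^sup>2"
          and b2: "real m' * s'\<^sup>2 \<le> 25 / 4 * real m' * sqn m (?B z (h, s) c)"
          using Eg[OF g, of c] m'0 by (simp_all add: s2)
        have b1': "sqn m (?B z (h, s) c) \<le> 25 * s'\<^sup>2"
        proof -
          have "real m' * sqn m (?B z (h, s) c) \<le> real m' * (25 * s'\<^sup>2)" using b1 by simp
          then show ?thesis using m'0 by (simp only: mult_le_cancel_left_pos)
        qed
        have b2': "s'\<^sup>2 \<le> 25 / 4 * sqn m (?B z (h, s) c)"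
        proof -
          have "real m' * s'\<^sup>2 \<le> real m' * (25 / 4 * sqn m (?B z (h, s) c))" using b2 by (simp add: mult_ac)
          then show ?thesis using m'0 by (simp only: mult_le_cancel_left_pos)
        qed
        have g3: "?Q z c / 2 \<le> sqn m (?B z (h, s) c)" "sqn m (?B z (h, s) c) \<le> 3 / 2 * ?Q z c"
          using good(3) by (auto simp: G3_def)
        have Qlo: "?Q z c \<le> 50 * s'\<^sup>2" and Qup: "s'\<^sup>2 \<le> 75 / 8 * ?Q z c"
          using b1' b2' g3 by linarith+
        have "cL / (sqrt (real d) * ?x ^ 3) * ?L (?y c) \<le> s'"
          unfolding cL
        proof (rule distortion_lower_arith[OF a _ qa _ _ nonneg _ Qlo])
          show "(?L (?y c))\<^sup>2 \<le> 4096 * real q ^ 3 * real d * ?Q z c" using good(1) by (auto simp: G1_def)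
        qed (use d in \<open>auto simp: s'_def\<close>)
        moreover have "s' \<le> cU * (M * (real d)\<^sup>2 * ?x powr (5 / 2)) * ?L (?y c)"
          unfolding cU
        proof (rule distortion_upper_arith[OF a _ nonneg _ M1 _ tC Qup])
          show "?Q z c \<le> 400 * (real d)\<^sup>2 * real (t + 1) * (1 + ?x) *
              (M\<^sup>2 * (4 * (3 * a + ?x)) + 400 * real d * real (t + 1)) * (?L (?y c))\<^sup>2"
            using good(2) unfolding G2_def H_def by blast
        qed (use d M0 in auto)
        ultimately show ?thesis by (simp add: s'_def)
      qed
      then show ?thesis using sp unfolding M_def by simp
    qed
    then show "\<exists>E\<in>sets (gauss_measure m' m). 97 / 100 \<le> measure (gauss_measure m' m) E \<and> (\<forall>g\<in>E. (zhs, g) \<in> ?F)"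
      using E by (intro bexI[of _ E]) auto
  qed simp
  \<comment> \<open>The product exceeds \<open>0.93\<close>: Gaussian, CountSketch and sampling
    success in this order.\<close>
  then have "97 / 100 * (99 / 100 * (97 / 100)) \<le> measure ?M ?F"
    using PG by (simp only: seed_measure_eq)
  then show ?thesis by (rule order_trans[rotated]) simp
qed

theorem theorem3p1:
  fixes \<epsilon> :: real
  assumes "\<epsilon> = 1 / 10"
  shows "\<exists>(prog :: com) (a :: nat) (b :: nat) (c\<^sub>1 :: real) (c\<^sub>2 :: real). c\<^sub>1 > 0 \<and> c\<^sub>2 > 0 \<and>
    (\<forall>(C\<^sub>0 :: real) (C\<^sub>1 :: real) (C\<^sub>2 :: real).
      \<exists>(cL :: real) (cU :: real) (K :: real). cL > 0 \<and> cU > 0 \<and> K > 0 \<and>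
      (\<forall>(n :: nat) (d :: nat) (t :: nat) (m :: nat) (m' :: nat) (l :: real vec \<Rightarrow> real) (A :: real mat).
         n \<ge> 2 \<longrightarrow> d \<ge> 1 \<longrightarrow>
         \<lfloor>log 2 (real n)\<rfloor> \<le> int t \<longrightarrow> real t \<le> C\<^sub>0 * ln (real n) \<longrightarrow>
         c\<^sub>1 * (real d)\<^sup>2 / \<epsilon>\<^sup>2 \<le> real m \<longrightarrow> real m \<le> C\<^sub>1 * (real d)\<^sup>2 / \<epsilon>\<^sup>2 \<longrightarrow>
         c\<^sub>2 * real d / \<epsilon>\<^sup>2 \<le> real m' \<longrightarrow> real m' \<le> C\<^sub>2 * real d / \<epsilon>\<^sup>2 \<longrightarrow>
         symmetric_norm n l \<longrightarrow> A \<in> carrier_mat n d \<longrightarrow>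
         measure (seed_measure n t m m')
           {\<omega> \<in> space (seed_measure n t m m'). \<forall>x\<in>carrier_vec d.
              cL / (sqrt (real d) * ln (real n) ^ 3) * l (A *\<^sub>v x)
                \<le> l2_norm ((sym_sketch n t m m' l \<omega> * A) *\<^sub>v x) \<and>
              l2_norm ((sym_sketch n t m m' l \<omega> * A) *\<^sub>v x)
                \<le> cU * (mmc n l * (real d)\<^sup>2 * ln (real n) powr (5 / 2)) * l (A *\<^sub>v x)}
           \<ge> 0.9 \<and>
         (\<forall>\<omega>\<in>space (seed_measure n t m m'). \<forall>es. lists_nonzeros A es \<longrightarrow>
            (\<exists>\<sigma> k. exec prog (input_state n d t m m' l \<omega> A es) k \<sigma> \<and>
               outputs_mat \<sigma> (sym_sketch n t m m' l \<omega> * A) \<and>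
               real k \<le> K * (real (nnz A) + real d ^ a) * ln (real n) ^ b))))"
\<comment> \<open>With \<open>\<epsilon> = 1 / 10\<close> the constants 8 and 10 become the sizes
  \<open>800 * d\<^sup>2\<close> and \<open>1000 * d\<close> that the two embeddings require; the
  exponents 4 and 1 come from \<open>running_time_arith\<close>.\<close>
proof (rule exI[of _ sketch_prog], rule exI[of _ 4], rule exI[of _ 1], rule exI[of _ 8], rule exI[of _ 10],
    intro conjI allI)
  fix C\<^sub>0 C\<^sub>1 C\<^sub>2 :: real
  define a where "a = (ln 2 :: real)"
  have a: "a > 0" by (simp add: a_def)
  \<comment> \<open>The summand \<open>1 / a\<close> absorbs the additional level in
    \<open>t + 1\<close>, because \<open>ln n >= a\<close>.\<close>
  define C where "C = \<bar>C\<^sub>0\<bar> + 1 / a"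
  have C: "C > 0" using a by (simp add: C_def add_nonneg_pos)
  define cU where "cU = sqrt (3750 * C * (1 / a + 1) * (16 + 4800 * C * a)) / a"
  define cL where "cL = a ^ 3 / 1280"
  define K where "K = 10 * C + (2 + 100 * \<bar>C\<^sub>2\<bar> * (8 + 300 * \<bar>C\<^sub>1\<bar>)) / a"
  have pos: "cL > 0" "cU > 0" "K > 0"
  proof -
    show "cL > 0" using a by (simp add: cL_def)
    have "3750 * C * (1 / a + 1) * (16 + 4800 * C * a) > 0"
      using a C by (intro mult_pos_pos add_pos_pos) auto
    then show "cU > 0" using a by (simp add: cU_def)
    have "(2 + 100 * \<bar>C\<^sub>2\<bar> * (8 + 300 * \<bar>C\<^sub>1\<bar>)) / a \<ge> 0"
      using a by (intro divide_nonneg_nonneg add_nonneg_nonneg mult_nonneg_nonneg) auto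
    then show "K > 0" unfolding K_def using C by linarith
  qed
  show "\<exists>(cL :: real) (cU :: real) (K :: real). cL > 0 \<and> cU > 0 \<and> K > 0 \<and>
      (\<forall>(n :: nat) (d :: nat) (t :: nat) (m :: nat) (m' :: nat) (l :: real vec \<Rightarrow> real) (A :: real mat).
         n \<ge> 2 \<longrightarrow> d \<ge> 1 \<longrightarrow>
         \<lfloor>log 2 (real n)\<rfloor> \<le> int t \<longrightarrow> real t \<le> C\<^sub>0 * ln (real n) \<longrightarrow>
         8 * (real d)\<^sup>2 / \<epsilon>\<^sup>2 \<le> real m \<longrightarrow> real m \<le> C\<^sub>1 * (real d)\<^sup>2 / \<epsilon>\<^sup>2 \<longrightarrow>
         10 * real d / \<epsilon>\<^sup>2 \<le> real m' \<longrightarrow> real m' \<le> C\<^sub>2 * real d / \<epsilon>\<^sup>2 \<longrightarrow>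
         symmetric_norm n l \<longrightarrow> A \<in> carrier_mat n d \<longrightarrow>
         measure (seed_measure n t m m')
           {\<omega> \<in> space (seed_measure n t m m'). \<forall>x\<in>carrier_vec d.
              cL / (sqrt (real d) * ln (real n) ^ 3) * l (A *\<^sub>v x)
                \<le> l2_norm ((sym_sketch n t m m' l \<omega> * A) *\<^sub>v x) \<and>
              l2_norm ((sym_sketch n t m m' l \<omega> * A) *\<^sub>v x)
                \<le> cU * (mmc n l * (real d)\<^sup>2 * ln (real n) powr (5 / 2)) * l (A *\<^sub>v x)}
           \<ge> 0.9 \<and>
         (\<forall>\<omega>\<in>space (seed_measure n t m m'). \<forall>es. lists_nonzeros A es \<longrightarrow>
            (\<exists>\<sigma> k. exec sketch_prog (input_state n d t m m' l \<omega> A es) k \<sigma> \<and>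
               outputs_mat \<sigma> (sym_sketch n t m m' l \<omega> * A) \<and>
               real k \<le> K * (real (nnz A) + real d ^ 4) * ln (real n) ^ 1)))"
  proof (rule exI[of _ cL], rule exI[of _ cU], rule exI[of _ K], intro conjI pos allI impI)
    fix n d t m m' :: nat and l :: "real vec \<Rightarrow> real" and A :: "real mat"
    assume n: "n \<ge> 2" and d: "d \<ge> 1" and t: "\<lfloor>log 2 (real n)\<rfloor> \<le> int t" "real t \<le> C\<^sub>0 * ln (real n)"
      and m: "8 * (real d)\<^sup>2 / \<epsilon>\<^sup>2 \<le> real m" "real m \<le> C\<^sub>1 * (real d)\<^sup>2 / \<epsilon>\<^sup>2"
      and m': "10 * real d / \<epsilon>\<^sup>2 \<le> real m'" "real m' \<le> C\<^sub>2 * real d / \<epsilon>\<^sup>2"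
      and S: "symmetric_norm n l" and A: "A \<in> carrier_mat n d"
    let ?x = "ln (real n)"
    have ax: "a \<le> ?x" using n by (simp add: a_def)
    have n1: "n \<ge> 1" using n by simp
    have eps: "y / \<epsilon>\<^sup>2 = 100 * y" for y by (simp add: assms power2_eq_square)
    have tC: "real (t + 1) \<le> C * ?x"
    proof -
      have "C\<^sub>0 * ?x \<le> \<bar>C\<^sub>0\<bar> * ?x" using ax a by (intro mult_right_mono) auto
      moreover have "1 \<le> 1 / a * ?x" using ax a by simp
      ultimately show ?thesis using t(2) by (simp add: C_def distrib_right)
    qed
    have m1: "800 * (real d)\<^sup>2 \<le> real m" using m(1) by (simp add: eps)
    have "real (1000 * d) \<le> real m'" using m'(1) by (simp add: eps)
    then have m'1: "1000 * d \<le> m'" by (simp only: of_nat_le_iff)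
    let ?v = "\<lambda>j i. A $$ (i, j)"
    let ?w = "level_weight n l"
    let ?Pc = "\<lambda>\<omega> c. cL / (sqrt (real d) * ?x ^ 3) * l (vec n (lincomb_n d ?v c))
        \<le> sqrt (sqn m' (sketch_vec n t m m' ?w \<omega> (lincomb_n d ?v c))) \<and>
      sqrt (sqn m' (sketch_vec n t m m' ?w \<omega> (lincomb_n d ?v c)))
        \<le> cU * (mmc n l * (real d)\<^sup>2 * ?x powr (5 / 2)) * l (vec n (lincomb_n d ?v c))"
    let ?Px = "\<lambda>\<omega> x. cL / (sqrt (real d) * ln (real n) ^ 3) * l (A *\<^sub>v x)
                \<le> l2_norm ((sym_sketch n t m m' l \<omega> * A) *\<^sub>v x) \<and>
              l2_norm ((sym_sketch n t m m' l \<omega> * A) *\<^sub>v x)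
                \<le> cU * (mmc n l * (real d)\<^sup>2 * ln (real n) powr (5 / 2)) * l (A *\<^sub>v x)"
    have PP: "?Px \<omega> x \<longleftrightarrow> ?Pc \<omega> (\<lambda>j. x $ j)" if "x \<in> carrier_vec d" for \<omega> x
      unfolding l2_norm_sketch[OF n1 A that] vec_lincomb[OF A that] ..
    have "(\<forall>x\<in>carrier_vec d. ?Px \<omega> x) \<longleftrightarrow> (\<forall>c. ?Pc \<omega> c)" for \<omega>
    proof
      assume *: "\<forall>x\<in>carrier_vec d. ?Px \<omega> x"
      show "\<forall>c. ?Pc \<omega> c"
      proof
        fix c :: "nat \<Rightarrow> real"
        have "lincomb_n d ?v (\<lambda>j. vec d c $ j) = lincomb_n d ?v c"
          unfolding lincomb_n_def by (intro ext sum.cong) auto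
        then show "?Pc \<omega> c" using PP[of "vec d c" \<omega>] * by (metis vec_carrier)
      qed
    qed (use PP in blast)
    then have "{\<omega> \<in> space (seed_measure n t m m'). \<forall>x\<in>carrier_vec d. ?Px \<omega> x} =
        {\<omega> \<in> space (seed_measure n t m m'). \<forall>c. ?Pc \<omega> c}" by simp
    moreover have "measure (seed_measure n t m m') {\<omega> \<in> space (seed_measure n t m m'). \<forall>c. ?Pc \<omega> c} \<ge> 0.9"
      using sketch_good_event[OF n d t(1) tC C m1 m'1 S] cU_def cL_def unfolding a_def by blast
    ultimately show "measure (seed_measure n t m m') {\<omega> \<in> space (seed_measure n t m m'). \<forall>x\<in>carrier_vec d. ?Px \<omega> x} \<ge> 0.9"
      by (simp only:)
    have m2: "real m \<le> 100 * \<bar>C\<^sub>1\<bar> * (real d)\<^sup>2"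
    proof -
      have "C\<^sub>1 * (real d)\<^sup>2 \<le> \<bar>C\<^sub>1\<bar> * (real d)\<^sup>2" by (intro mult_right_mono) auto
      then show ?thesis using m(2) unfolding eps by linarith
    qed
    have m'2: "real m' \<le> 100 * \<bar>C\<^sub>2\<bar> * real d"
    proof -
      have "C\<^sub>2 * real d \<le> \<bar>C\<^sub>2\<bar> * real d" by (intro mult_right_mono) auto
      then show ?thesis using m'(2) unfolding eps by linarith
    qed
    show "\<forall>\<omega>\<in>space (seed_measure n t m m'). \<forall>es. lists_nonzeros A es \<longrightarrow>
            (\<exists>\<sigma> k. exec sketch_prog (input_state n d t m m' l \<omega> A es) k \<sigma> \<and>
               outputs_mat \<sigma> (sym_sketch n t m m' l \<omega> * A) \<and>
               real k \<le> K * (real (nnz A) + real d ^ 4) * ln (real n) ^ 1)"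
    proof (intro ballI allI impI)
      fix \<omega> es assume es: "lists_nonzeros A es"
      obtain \<sigma> k where k: "exec sketch_prog (input_state n d t m m' l \<omega> A es) k \<sigma>"
        "outputs_mat \<sigma> (sym_sketch n t m m' l \<omega> * A)"
        "k \<le> 2 + nnz A * (5 + Suc t * 5) + m' * (4 + d * (4 + m * 3))"
        using sketch_prog_output[OF n1 A es] by blast
      have "real k \<le> real (2 + nnz A * (5 + Suc t * 5) + m' * (4 + d * (4 + m * 3)))"
        using k(3) by (simp only: of_nat_le_iff)
      also have "\<dots> \<le> K * (real (nnz A) + real d ^ 4) * ?x ^ 1"
        unfolding K_def using C by (intro running_time_arith[OF a ax tC d _ m2 m'2]) simp
      finally show "\<exists>\<sigma> k. exec sketch_prog (input_state n d t m m' l \<omega> A es) k \<sigma> \<and>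
               outputs_mat \<sigma> (sym_sketch n t m m' l \<omega> * A) \<and>
               real k \<le> K * (real (nnz A) + real d ^ 4) * ln (real n) ^ 1"
        using k by blast
    qed
  qed
qed simp_all

end
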